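(* For every Uniform Facility Location instance $(V,d,f,\vec N)$ with $|V|=n$ and every $\epsilon>0$, there is an efficient $\epsilon$-differentially private algorithm in the super-set output setting whose expected multiplicative approximation ratio is $O\!\left(\frac{\log n}{\epsilon}\right)$.
   Context: Uniform Facility Location (UFL): an instance is a tuple $(V,d,f,\vec N)$, where $(V,d)$ is an $n$-point metric, $f\ge 0$ is the facility cost, and $\vec N=(N_v)_{v\in V}\in\mathbb{Z}_{\ge0}^V$ gives the number of clients at each location. The cost of $S\subseteq V$ is $\mathrm{cost}_d(S;\vec N)=|S|\cdot f+\sum_{v\in V}N_v\, d(v,S)$, where $d(v,S)=\min_{s\in S}d(v,s)$; the goal is to minimize it. Super-set output setting: the algorithm outputs a set $R$ of potential facility locations (and may also output the metric, e.g. a tree metric, with respect to which clients connect); every client is connected to its nearest location in $R$, and the set $S\subseteq R$ of actually opened facilities is the set of locations in $R$ with at least one connected client. The cost of the solution is the cost of $S$ under $d$. Differential privacy: a randomized algorithm $\mathcal{A}$ taking $\vec N$ as input is $\epsilon$-DP if for all $\vec N,\vec N'$ with $\|\vec N-\vec N'\|_1=1$ and every event $\mathcal{T}$ in the output space, $\Pr[\mathcal{A}(\vec N)\in\mathcal{T}]\le e^{\epsilon}\Pr[\mathcal{A}(\vec N')\in\mathcal{T}]$. The (expected multiplicative) approximation ratio is the expected cost of the algorithm's solution (expectation over its randomness) divided by the optimum cost.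
   Formalization: The approximation ratio is proved as O(log n / min(1, ε)), and only for n ≥ 2: read literally, O(log n / ε) would drop below 1 for large ε, and log n = 0 for n = 1, which no algorithm can achieve. Privacy and efficiency are proved for all n ≥ 1 and all ε > 0. *)

theory Defs
  imports "HOL-Probability.Probability"
begin

section \<open>Uniform facility location\<close>

text \<open>
  The \<open>n\<close> points are labelled \<open>0, \<dots>, n - 1\<close>, so that an instance can be the input of a
  program. Only the values of \<open>d\<close> and \<open>N\<close> on these labels matter.
\<close>

definition ufl_instance :: "nat \<Rightarrow> (nat \<Rightarrow> nat \<Rightarrow> real) \<Rightarrow> real \<Rightarrow> bool" where
  "ufl_instance n d f \<longleftrightarrow> 1 \<le> n \<and> Metric_space {..<n} d \<and> 0 \<le> f"

definition dist_set :: "(nat \<Rightarrow> nat \<Rightarrow> real) \<Rightarrow> nat \<Rightarrow> nat set \<Rightarrow> real" where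
  "dist_set d v S = Min (d v ` S)"

definition ufl_cost :: "nat \<Rightarrow> (nat \<Rightarrow> nat \<Rightarrow> real) \<Rightarrow> real \<Rightarrow> (nat \<Rightarrow> nat) \<Rightarrow> nat set \<Rightarrow> real" where
  "ufl_cost n d f N S = real (card S) * f + (\<Sum>v<n. real (N v) * dist_set d v S)"

text \<open>
  The distance to the empty set is unspecified above. Hence opening nothing is admitted
  exactly when there are no clients, and then its cost is \<open>0\<close>.
\<close>

definition feasible :: "nat \<Rightarrow> (nat \<Rightarrow> nat) \<Rightarrow> nat set \<Rightarrow> bool" where
  "feasible n N S \<longleftrightarrow> S \<subseteq> {..<n} \<and> (S = {} \<longrightarrow> (\<forall>v<n. N v = 0))"

definition ufl_opt :: "nat \<Rightarrow> (nat \<Rightarrow> nat \<Rightarrow> real) \<Rightarrow> real \<Rightarrow> (nat \<Rightarrow> nat) \<Rightarrow> real" where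
  "ufl_opt n d f N = Min (ufl_cost n d f N ` {S. feasible n N S})"

section \<open>Super-set output\<close>

text \<open>
  An output \<open>(R, D)\<close> consists of the potential locations and the metric that the clients
  use to find their nearest location. Ties go to the smallest label.
\<close>

type_synonym superset_output = "nat set \<times> (nat \<Rightarrow> nat \<Rightarrow> real)"

fun valid_output :: "nat \<Rightarrow> superset_output \<Rightarrow> bool" where
  "valid_output n (R, D) \<longleftrightarrow> R \<subseteq> {..<n} \<and> R \<noteq> {} \<and> Metric_space {..<n} D"

definition nearest :: "(nat \<Rightarrow> nat \<Rightarrow> real) \<Rightarrow> nat set \<Rightarrow> nat \<Rightarrow> nat" where
  "nearest D R v = (LEAST r. r \<in> R \<and> (\<forall>s\<in>R. D v r \<le> D v s))"

fun opened :: "nat \<Rightarrow> (nat \<Rightarrow> nat) \<Rightarrow> superset_output \<Rightarrow> nat set" where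
  "opened n N (R, D) = {nearest D R v |v. v < n \<and> 0 < N v}"

definition expected_cost ::
  "nat \<Rightarrow> (nat \<Rightarrow> nat \<Rightarrow> real) \<Rightarrow> real \<Rightarrow> (nat \<Rightarrow> nat) \<Rightarrow> superset_output pmf \<Rightarrow> real" where
  "expected_cost n d f N p =
     measure_pmf.expectation p (\<lambda>out. ufl_cost n d f N (opened n N out))"

section \<open>Differential privacy\<close>

definition neighbours :: "nat \<Rightarrow> (nat \<Rightarrow> nat) \<Rightarrow> (nat \<Rightarrow> nat) \<Rightarrow> bool" where
  "neighbours n N N' \<longleftrightarrow> (\<Sum>v<n. \<bar>int (N v) - int (N' v)\<bar>) = 1"

definition differentially_private ::
  "nat \<Rightarrow> real \<Rightarrow> ((nat \<Rightarrow> nat) \<Rightarrow> 'o pmf) \<Rightarrow> bool" where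
  "differentially_private n \<epsilon> A \<longleftrightarrow>
     (\<forall>N N' T. neighbours n N N' \<longrightarrow>
        measure_pmf.prob (A N) T \<le> exp \<epsilon> * measure_pmf.prob (A N') T)"

section \<open>Randomized real RAM programs\<close>

text \<open>
  A program works on natural-number cells and real cells. A cell is addressed by the name of
  an array and a list of indices. Reals support exact field operations (with \<open>x / 0 = 0\<close>)
  and comparison. There is neither rounding from reals to naturals nor multiplication,
  division or bit manipulation of naturals, because at unit cost these would make the machine
  unrealistically powerful. The only source of randomness is a coin of computed bias, that is,
  the comparison of the bias with a fresh uniform sample from \<open>[0, 1]\<close>.
\<close>

datatype iexp =
    ICon nat
  | ICell string "iexp list"
  | IAdd iexp iexp
  | ISub iexp iexp

datatype rexp =
    RInt iexp
  | RCell string "iexp list"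
  | RAdd rexp rexp
  | RSub rexp rexp
  | RMul rexp rexp
  | RDiv rexp rexp

datatype bexp =
    ILess iexp iexp
  | RLess rexp rexp
  | BNot bexp
  | BAnd bexp bexp

datatype com =
    Skip
  | ISet string "iexp list" iexp
  | RSet string "iexp list" rexp
  | Flip string "iexp list" rexp
  | Seq com com
  | Cond bexp com com
  | Loop bexp com

record store =
  imem :: "string \<Rightarrow> nat list \<Rightarrow> nat"
  rmem :: "string \<Rightarrow> nat list \<Rightarrow> real"

fun ival :: "store \<Rightarrow> iexp \<Rightarrow> nat" where
  "ival s (ICon k) = k"
| "ival s (ICell x is) = imem s x (map (ival s) is)"
| "ival s (IAdd a b) = ival s a + ival s b"
| "ival s (ISub a b) = ival s a - ival s b"

fun rval :: "store \<Rightarrow> rexp \<Rightarrow> real" where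
  "rval s (RInt a) = real (ival s a)"
| "rval s (RCell x is) = rmem s x (map (ival s) is)"
| "rval s (RAdd a b) = rval s a + rval s b"
| "rval s (RSub a b) = rval s a - rval s b"
| "rval s (RMul a b) = rval s a * rval s b"
| "rval s (RDiv a b) = rval s a / rval s b"

fun bval :: "store \<Rightarrow> bexp \<Rightarrow> bool" where
  "bval s (ILess a b) \<longleftrightarrow> ival s a < ival s b"
| "bval s (RLess a b) \<longleftrightarrow> rval s a < rval s b"
| "bval s (BNot b) \<longleftrightarrow> \<not> bval s b"
| "bval s (BAnd b c) \<longleftrightarrow> bval s b \<and> bval s c"

definition iset :: "string \<Rightarrow> nat list \<Rightarrow> nat \<Rightarrow> store \<Rightarrow> store" where
  "iset x is k s = s\<lparr>imem := (imem s)(x := (imem s x)(is := k))\<rparr>"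

definition rset :: "string \<Rightarrow> nat list \<Rightarrow> real \<Rightarrow> store \<Rightarrow> store" where
  "rset x is r s = s\<lparr>rmem := (rmem s)(x := (rmem s x)(is := r))\<rparr>"

text \<open>
  A configuration holds the commands still to be executed, and an empty list means that the
  program has halted. Every step has unit cost; as the expressions of a fixed program have
  bounded size, this counts the elementary operations up to a constant factor. The library
  function \<^const>\<open>bernoulli_pmf\<close> truncates biases outside \<open>[0, 1]\<close>.
\<close>

type_synonym config = "com list \<times> store"

fun step :: "config \<Rightarrow> config pmf" where
  "step ([], s) = return_pmf ([], s)"
| "step (Skip # K, s) = return_pmf (K, s)"
| "step (ISet x is a # K, s) = return_pmf (K, iset x (map (ival s) is) (ival s a) s)"
| "step (RSet x is a # K, s) = return_pmf (K, rset x (map (ival s) is) (rval s a) s)"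
| "step (Flip x is a # K, s) =
     map_pmf (\<lambda>b. (K, iset x (map (ival s) is) (if b then 1 else 0) s))
       (bernoulli_pmf (rval s a))"
| "step (Seq P Q # K, s) = return_pmf (P # Q # K, s)"
| "step (Cond b P Q # K, s) = return_pmf ((if bval s b then P else Q) # K, s)"
| "step (Loop b P # K, s) = return_pmf (if bval s b then P # Loop b P # K else K, s)"

primrec run :: "nat \<Rightarrow> config \<Rightarrow> config pmf" where
  "run 0 c = return_pmf c"
| "run (Suc t) c = bind_pmf (step c) (run t)"

definition halts_within :: "com \<Rightarrow> store \<Rightarrow> nat \<Rightarrow> bool" where
  "halts_within P s t \<longleftrightarrow> (\<forall>c\<in>set_pmf (run t ([P], s)). fst c = [])"

text \<open>
  This is meaningful for programs whose running time on \<open>s\<close> is bounded. After halting,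
  further steps change nothing, so any larger number of steps gives the same distribution.
\<close>

definition final_store :: "com \<Rightarrow> store \<Rightarrow> store pmf" where
  "final_store P s = map_pmf snd (run (LEAST t. halts_within P s t) ([P], s))"

section \<open>Programs for uniform facility location\<close>

definition input_store ::
  "nat \<Rightarrow> (nat \<Rightarrow> nat \<Rightarrow> real) \<Rightarrow> real \<Rightarrow> real \<Rightarrow> (nat \<Rightarrow> nat) \<Rightarrow> store" where
  "input_store n d f \<epsilon> N =
     \<lparr>imem = (\<lambda>x is. if x = ''n'' \<and> is = [] then n else 0),
      rmem = (\<lambda>x is.
        if x = ''f'' \<and> is = [] then f
        else if x = ''eps'' \<and> is = [] then \<epsilon>
        else if x = ''N'' \<and> length is = 1 \<and> is ! 0 < n then real (N (is ! 0))
        else if x = ''d'' \<and> length is = 2 \<and> is ! 0 < n \<and> is ! 1 < n then d (is ! 0) (is ! 1)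
        else 0)\<rparr>"

definition output_of :: "nat \<Rightarrow> store \<Rightarrow> superset_output" where
  "output_of n s =
     ({v. v < n \<and> imem s ''R'' [v] \<noteq> 0},
      \<lambda>u v. if u < n \<and> v < n then rmem s ''D'' [u, v] else 0)"

definition ufl_algorithm ::
  "com \<Rightarrow> nat \<Rightarrow> (nat \<Rightarrow> nat \<Rightarrow> real) \<Rightarrow> real \<Rightarrow> real \<Rightarrow> (nat \<Rightarrow> nat) \<Rightarrow> superset_output pmf" where
  "ufl_algorithm P n d f \<epsilon> N = map_pmf (output_of n) (final_store P (input_store n d f \<epsilon> N))"

text \<open>
  A nonzero number of magnitude \<open>2 ^ k\<close> or \<open>2 ^ (- k)\<close> counts as \<open>1 + k\<close>. For rational
  inputs this is at most proportional to the length of the usual binary encoding as a fraction,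
  so a bound that is polynomial in \<open>input_size\<close> is also polynomial in the encoding length.
\<close>

definition number_size :: "real \<Rightarrow> real" where
  "number_size x = (if x = 0 then 1 else 1 + \<bar>log 2 \<bar>x\<bar>\<bar>)"

definition input_size ::
  "nat \<Rightarrow> (nat \<Rightarrow> nat \<Rightarrow> real) \<Rightarrow> real \<Rightarrow> real \<Rightarrow> (nat \<Rightarrow> nat) \<Rightarrow> real" where
  "input_size n d f \<epsilon> N =
     real n + (\<Sum>u<n. \<Sum>v<n. number_size (d u v)) + number_size f + number_size \<epsilon>
       + (\<Sum>v<n. number_size (real (N v)))"

definition efficient :: "com \<Rightarrow> bool" where
  "efficient P \<longleftrightarrow>
     (\<exists>c k. \<forall>n d f \<epsilon> N. ufl_instance n d f \<and> 0 < \<epsilon> \<longrightarrow>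
        (\<exists>t. real t \<le> c * input_size n d f \<epsilon> N ^ k \<and>
             halts_within P (input_store n d f \<epsilon> N) t))"

end

theory Submission
  imports Defs
begin

text \<open>
  Let \<open>e\<close> be the minimum of \<open>1\<close> and \<open>\<epsilon>\<close>. The points are refined by random partitions into parts of
  diameter \<open>\<rho> i = e f / 2 ^ i\<close> for \<open>i = 0, 1, \<dots>\<close>, in the manner of Calinescu-Karloff-Rabani and
  Fakcharoenphol-Rao-Talwar: a point belongs to the point of highest random priority within a
  random radius. From the second level on, a part is kept only if a coin says that it holds at
  least about \<open>k 2 ^ i / e\<close> clients, where \<open>k\<close> is about \<open>log n\<close>; the other points of a group join
  one of its kept parts, and a group without kept parts is final and gets one facility. The coins
  of level \<open>i\<close> cost privacy \<open>e / 2 ^ i\<close>, and nothing else depends on the clients.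

  Since \<open>k 2 ^ i / e\<close> clients at distance \<open>\<rho> i\<close> cost \<open>k f\<close>, an optimal facility can
  afford to lose the clients of a part that falls below the threshold, and the clients of a heavy
  part without optimal facility are all separated from their optimal facility and can pay for
  a new one. The expected total scale at which a client at distance \<open>t\<close> from its
  facility is separated is \<open>O(t log n)\<close>, and the factor \<open>1 / e\<close> is lost only at level \<open>0\<close>, where
  every part opens a facility. A light part is kept with probability at most \<open>1 / n\<close>,
  and this matters at most \<open>2 n\<close> times, since a group that does not split opens nothing new.
\<close>

section \<open>Reasoning about programs\<close>

text \<open>The scale halves while the threshold doubles, so their product is \<open>k f\<close> at
  every level. The privacy costs thus form a geometric series, although the number of levels depends
  on the distances and is not bounded in \<open>n\<close>. For the same reason no error may be
  charged once per level. The analysis therefore follows a potential whose expectation never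
  increases after the first level (\<open>level_potential\<close>): whatever a level spends is
  released by some term when the scale halves. The stretch of a pair telescopes over the scales and
  pays for its separation, \<open>spread\<close> decreases with every split, and
  \<open>saturate\<close> pays for lost parts. The second obstacle is the machine, which has neither
  exponentials nor real samples, only coins of computed bias. So the radius is never drawn, only its
  comparisons with the distances are decided; priorities are random integers that may tie, and the
  odds of a mark are a power. A coupling (\<open>refine\<close>) replaces the program by an explicit
  distribution, which is then analysed.\<close>

definition halted_by :: "nat \<Rightarrow> config \<Rightarrow> bool" where
  "halted_by T c \<longleftrightarrow> (\<forall>c'\<in>set_pmf (run T c). fst c' = [])"

lemma run_add: "run (t + T) c = bind_pmf (run t c) (run T)"
proof (induction t arbitrary: c)
  case (Suc t)
  then have "run (t + T) = (\<lambda>c. bind_pmf (run t c) (run T))"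
    by blast
  then show ?case
    by (simp add: bind_assoc_pmf)
qed (simp add: bind_return_pmf)

lemma run_halted [simp]: "run T ([], s) = return_pmf ([], s)"
  by (induction T) (simp_all add: bind_return_pmf)

lemma run_halted_by:
  assumes "halted_by T c"
  shows "run (T + T') c = run T c"
proof -
  have "run (T + T') c = bind_pmf (run T c) return_pmf"
    unfolding run_add
  proof (intro bind_pmf_cong refl)
    fix c' assume "c' \<in> set_pmf (run T c)"
    then have "fst c' = []"
      using assms by (simp add: halted_by_def)
    then show "run T' c' = return_pmf c'"
      by (cases c') simp
  qed
  then show ?thesis
    by (simp add: bind_return_pmf')
qed

lemma halted_by_mono:
  assumes "halted_by T c" "T \<le> T'"
  shows "halted_by T' c" "run T' c = run T c"
  using assms run_halted_by[OF assms(1), of "T' - T"] by (simp_all add: halted_by_def)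

text \<open>
  Only the store distribution after the whole continuation has halted is compared, so that
  branches of different running times need not be synchronised.
\<close>

definition computes :: "com \<Rightarrow> store \<Rightarrow> store pmf \<Rightarrow> nat \<Rightarrow> bool" where
  "computes P s p t \<longleftrightarrow>
     (\<forall>K T. (\<forall>s'\<in>set_pmf p. halted_by T (K, s')) \<longrightarrow>
        run (t + T) (P # K, s) = bind_pmf p (\<lambda>s'. run T (K, s')))"

lemma computes_run:
  assumes "computes P s p t" "\<And>s'. s' \<in> set_pmf p \<Longrightarrow> halted_by T (K, s')"
  shows "run (t + T) (P # K, s) = bind_pmf p (\<lambda>s'. run T (K, s'))"
    and "halted_by (t + T) (P # K, s)"
proof -
  show 1: "run (t + T) (P # K, s) = bind_pmf p (\<lambda>s'. run T (K, s'))"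
    using assms unfolding computes_def by blast
  show "halted_by (t + T) (P # K, s)"
    using assms(2) unfolding halted_by_def 1 by auto
qed

lemma computes_final:
  assumes "computes P s p t"
  shows "run t ([P], s) = map_pmf (Pair []) p" "halts_within P s t"
proof -
  have *: "run (t + 0) ([P], s) = bind_pmf p (\<lambda>s'. run 0 ([], s'))"
    by (rule computes_run(1)[OF assms]) (simp add: halted_by_def)
  then show "run t ([P], s) = map_pmf (Pair []) p"
    by (simp add: map_pmf_def)
  then show "halts_within P s t"
    by (auto simp: halts_within_def)
qed

lemma computes_final_store:
  assumes "computes P s p t"
  shows "final_store P s = p"
proof -
  define t0 where "t0 = (LEAST t. halts_within P s t)"
  note halts = computes_final(2)[OF assms]
  have t0: "halts_within P s t0" "t0 \<le> t"
    unfolding t0_def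
    by (rule LeastI[of "halts_within P s", OF halts], rule Least_le[of "halts_within P s", OF halts])
  have "run t ([P], s) = run t0 ([P], s)"
    using t0 by (intro halted_by_mono(2)) (auto simp: halts_within_def halted_by_def)
  then have "run t0 ([P], s) = map_pmf (Pair []) p"
    using computes_final(1)[OF assms] by simp
  then show ?thesis
    by (simp add: final_store_def t0_def[symmetric] pmf.map_comp o_def pmf.map_ident)
qed

text \<open>Once program and continuation have halted, further steps change nothing, so every upper
  bound on the time serves as well.\<close>

lemma computes_mono:
  assumes "computes P s p t" "t \<le> t'"
  shows "computes P s p t'"
  unfolding computes_def
proof (intro allI impI)
  fix K T
  assume *: "\<forall>s'\<in>set_pmf p. halted_by T (K, s')"
  have "run (t' + T) (P # K, s) = run (t + T) (P # K, s)"
    using * assms by (intro halted_by_mono(2) computes_run(2)) auto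
  then show "run (t' + T) (P # K, s) = bind_pmf p (\<lambda>s'. run T (K, s'))"
    using computes_run(1)[OF assms(1), of T K] * by simp
qed

lemma computes_step:
  assumes "\<And>K. step (P # K, s) = map_pmf (Pair K) p"
  shows "computes P s p (Suc 0)"
  using assms by (simp add: computes_def bind_map_pmf)

lemma computes_Seq:
  assumes "computes P s p t" "\<And>s'. s' \<in> set_pmf p \<Longrightarrow> computes Q s' (q s') t'"
  shows "computes (Seq P Q) s (bind_pmf p q) (Suc (t + t'))"
  unfolding computes_def
proof (intro allI impI)
  fix K T
  assume *: "\<forall>s'\<in>set_pmf (bind_pmf p q). halted_by T (K, s')"
  have "run (Suc (t + t') + T) (Seq P Q # K, s) = run (t + (t' + T)) (P # Q # K, s)"
    by (simp add: bind_return_pmf add.assoc)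
  also have "\<dots> = bind_pmf p (\<lambda>s'. run (t' + T) (Q # K, s'))"
    using * assms(2) by (intro computes_run[OF assms(1)] computes_run(2)) auto
  also have "\<dots> = bind_pmf p (\<lambda>s'. bind_pmf (q s') (\<lambda>s''. run T (K, s'')))"
    using * assms(2) by (intro bind_pmf_cong refl computes_run(1)) auto
  finally show "run (Suc (t + t') + T) (Seq P Q # K, s) = bind_pmf (bind_pmf p q) (\<lambda>s'. run T (K, s'))"
    by (simp add: bind_assoc_pmf)
qed

lemma computes_tau:
  assumes "\<And>K. step (P # K, s) = return_pmf (Ps @ K, s)"
    and "\<And>K T. (\<forall>s'\<in>set_pmf p. halted_by T (K, s')) \<Longrightarrow>
        run (t + T) (Ps @ K, s) = bind_pmf p (\<lambda>s'. run T (K, s'))"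
  shows "computes P s p (Suc t)"
  unfolding computes_def using assms by (simp add: bind_return_pmf)

lemma computes_Cond:
  assumes "computes (if bval s b then P else Q) s p t"
  shows "computes (Cond b P Q) s p (Suc t)"
  by (rule computes_tau[where Ps = "[if bval s b then P else Q]"])
     (use assms in \<open>auto simp: computes_def\<close>)

lemma computes_Loop_exit:
  assumes "\<not> bval s b"
  shows "computes (Loop b P) s (return_pmf s) (Suc 0)"
  using assms by (intro computes_step) simp

lemma computes_Loop_iter:
  assumes "bval s b" "computes P s p t"
    and "\<And>s'. s' \<in> set_pmf p \<Longrightarrow> computes (Loop b P) s' (q s') t'"
  shows "computes (Loop b P) s (bind_pmf p q) (Suc (t + t'))"
proof (rule computes_tau[where Ps = "[P, Loop b P]"])
  show "step (Loop b P # K, s) = return_pmf ([P, Loop b P] @ K, s)" for K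
    using assms(1) by simp
next
  fix K T
  assume *: "\<forall>s'\<in>set_pmf (bind_pmf p q). halted_by T (K, s')"
  have "run (t + t' + T) ([P, Loop b P] @ K, s) = run (t + (t' + T)) (P # Loop b P # K, s)"
    by (simp add: add.assoc)
  also have "\<dots> = bind_pmf p (\<lambda>s'. run (t' + T) (Loop b P # K, s'))"
    using * assms(3) by (intro computes_run[OF assms(2)] computes_run(2)) auto
  also have "\<dots> = bind_pmf p (\<lambda>s'. bind_pmf (q s') (\<lambda>s''. run T (K, s'')))"
    using * assms(3) by (intro bind_pmf_cong refl computes_run(1)) auto
  finally show "run (t + t' + T) ([P, Loop b P] @ K, s) = bind_pmf (bind_pmf p q) (\<lambda>s'. run T (K, s'))"
    by (simp add: bind_assoc_pmf)
qed

section \<open>Frame conditions and running time\<close>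

fun iwrites :: "com \<Rightarrow> string set" where
  "iwrites Skip = {}"
| "iwrites (ISet x is e) = {x}"
| "iwrites (RSet x is e) = {}"
| "iwrites (Flip x is e) = {x}"
| "iwrites (Seq P Q) = iwrites P \<union> iwrites Q"
| "iwrites (Cond b P Q) = iwrites P \<union> iwrites Q"
| "iwrites (Loop b P) = iwrites P"

fun rwrites :: "com \<Rightarrow> string set" where
  "rwrites Skip = {}"
| "rwrites (ISet x is e) = {}"
| "rwrites (RSet x is e) = {x}"
| "rwrites (Flip x is e) = {}"
| "rwrites (Seq P Q) = rwrites P \<union> rwrites Q"
| "rwrites (Cond b P Q) = rwrites P \<union> rwrites Q"
| "rwrites (Loop b P) = rwrites P"

definition same_outside :: "string set \<Rightarrow> string set \<Rightarrow> store \<Rightarrow> store \<Rightarrow> bool" where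
  "same_outside X Y s s' \<longleftrightarrow>
     (\<forall>x. x \<notin> X \<longrightarrow> imem s' x = imem s x) \<and> (\<forall>x. x \<notin> Y \<longrightarrow> rmem s' x = rmem s x)"

lemma same_outside_trans:
  assumes "same_outside X Y s s'" "same_outside X' Y' s' s''" "X' \<subseteq> X" "Y' \<subseteq> Y"
  shows "same_outside X Y s s''"
  using assms unfolding same_outside_def by (metis subsetD)

lemma imem_set [simp]:
  "imem (iset x is k s) = (imem s)(x := (imem s x)(is := k))" "rmem (iset x is k s) = rmem s"
  "rmem (rset x is r s) = (rmem s)(x := (rmem s x)(is := r))" "imem (rset x is r s) = imem s"
  by (simp_all add: iset_def rset_def)

text \<open>The write set of the whole list of pending commands can only shrink, which lets the
  frame condition pass through the unrolling of loops.\<close>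

lemma step_writes:
  assumes "(Ks', s') \<in> set_pmf (step (Ks, s))"
  shows "\<Union> (iwrites ` set Ks') \<subseteq> \<Union> (iwrites ` set Ks)"
    and "\<Union> (rwrites ` set Ks') \<subseteq> \<Union> (rwrites ` set Ks)"
    and "same_outside (\<Union> (iwrites ` set Ks)) (\<Union> (rwrites ` set Ks)) s s'"
proof -
  consider "Ks = []" | P K where "Ks = P # K"
    by (cases Ks) auto
  then have "\<Union> (iwrites ` set Ks') \<subseteq> \<Union> (iwrites ` set Ks) \<and>
      \<Union> (rwrites ` set Ks') \<subseteq> \<Union> (rwrites ` set Ks) \<and>
      same_outside (\<Union> (iwrites ` set Ks)) (\<Union> (rwrites ` set Ks)) s s'"
  proof cases
    case 2
    then show ?thesis
      using assms by (cases P) (auto simp: same_outside_def split: if_splits)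
  qed (use assms in \<open>auto simp: same_outside_def\<close>)
  then show "\<Union> (iwrites ` set Ks') \<subseteq> \<Union> (iwrites ` set Ks)"
    and "\<Union> (rwrites ` set Ks') \<subseteq> \<Union> (rwrites ` set Ks)"
    and "same_outside (\<Union> (iwrites ` set Ks)) (\<Union> (rwrites ` set Ks)) s s'"
    by blast+
qed

lemma run_writes:
  assumes "(Ks', s') \<in> set_pmf (run t (Ks, s))"
  shows "same_outside (\<Union> (iwrites ` set Ks)) (\<Union> (rwrites ` set Ks)) s s'"
  using assms
proof (induction t arbitrary: Ks s)
  case 0
  then show ?case
    by (simp add: same_outside_def)
next
  case (Suc t)
  then obtain Ks1 s1 where 1: "(Ks1, s1) \<in> set_pmf (step (Ks, s))"
      "(Ks', s') \<in> set_pmf (run t (Ks1, s1))"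
    by auto
  note w = step_writes[OF 1(1)]
  show ?case
    by (rule same_outside_trans[OF w(3) Suc.IH[OF 1(2)] w(1,2)])
qed

lemma computes_writes:
  assumes "computes P s p t" "s' \<in> set_pmf p"
  shows "same_outside (iwrites P) (rwrites P) s s'"
  using run_writes[of "[]" s' t "[P]" s] computes_final(1)[OF assms(1)] assms(2) by simp

text \<open>With one common bound \<open>B\<close> on the iterations of all loops, the running time
  can be read off the syntax; a conditional takes the sum as an upper bound for both
  branches.\<close>

fun time_bound :: "nat \<Rightarrow> com \<Rightarrow> nat" where
  "time_bound B (Seq P Q) = Suc (time_bound B P + time_bound B Q)"
| "time_bound B (Cond b P Q) = Suc (time_bound B P + time_bound B Q)"
| "time_bound B (Loop b P) = Suc (B * Suc (time_bound B P))"
| "time_bound B P = 1"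

fun com_size :: "com \<Rightarrow> nat" where
  "com_size (Seq P Q) = Suc (com_size P + com_size Q)"
| "com_size (Cond b P Q) = Suc (com_size P + com_size Q)"
| "com_size (Loop b P) = Suc (Suc (com_size P))"
| "com_size P = 1"

text \<open>The size of the program serves both as coefficient and as degree of a polynomial in
  \<open>B\<close>, so a fixed program is polynomial in its loop bounds.\<close>

lemma time_bound_le: "time_bound B P \<le> com_size P * Suc B ^ com_size P"
proof (induction P)
  case (Seq P Q)
  have "time_bound B P \<le> com_size P * Suc B ^ Suc (com_size P + com_size Q)"
      "time_bound B Q \<le> com_size Q * Suc B ^ Suc (com_size P + com_size Q)"
    by (rule order_trans[OF Seq.IH(1)], intro mult_le_mono power_increasing; simp)
       (rule order_trans[OF Seq.IH(2)], intro mult_le_mono power_increasing; simp)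
  moreover have "1 \<le> Suc B ^ Suc (com_size P + com_size Q)"
    by (rule one_le_power) simp
  ultimately show ?case
    unfolding time_bound.simps com_size.simps mult_Suc add_mult_distrib by linarith
next
  case (Cond b P Q)
  have "time_bound B P \<le> com_size P * Suc B ^ Suc (com_size P + com_size Q)"
      "time_bound B Q \<le> com_size Q * Suc B ^ Suc (com_size P + com_size Q)"
    by (rule order_trans[OF Cond.IH(1)], intro mult_le_mono power_increasing; simp)
       (rule order_trans[OF Cond.IH(2)], intro mult_le_mono power_increasing; simp)
  moreover have "1 \<le> Suc B ^ Suc (com_size P + com_size Q)"
    by (rule one_le_power) simp
  ultimately show ?case
    unfolding time_bound.simps com_size.simps mult_Suc add_mult_distrib by linarith
next
  case (Loop b P)
  let ?X = "Suc B ^ Suc (com_size P)"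
  have "B * time_bound B P \<le> B * (com_size P * Suc B ^ com_size P)"
    using Loop.IH by (rule mult_le_mono2)
  also have "\<dots> \<le> com_size P * ?X"
    by simp
  finally have 1: "B * time_bound B P \<le> com_size P * (Suc B * ?X)"
    by (simp add: algebra_simps)
  have "1 \<le> ?X"
    by (rule one_le_power) simp
  then have "Suc B \<le> Suc B * ?X"
    by (metis mult_le_mono2 mult.right_neutral)
  then have "Suc B + B * time_bound B P \<le> Suc B * ?X + com_size P * (Suc B * ?X)"
    using 1 by linarith
  also have "\<dots> \<le> Suc (Suc (com_size P)) * Suc B ^ Suc (Suc (com_size P))"
    by simp
  finally show ?case
    by (simp add: algebra_simps)
qed simp_all

text \<open>A coupling between the final store and a sample of the specification \<open>q\<close> on
  which \<open>R\<close> always holds. The time bound is included, so that halting follows from the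
  same derivation.\<close>

definition refine ::
  "nat \<Rightarrow> com \<Rightarrow> store \<Rightarrow> (store \<Rightarrow> 'a \<Rightarrow> bool) \<Rightarrow> 'a pmf \<Rightarrow> bool" where
  "refine B P s R q \<longleftrightarrow> (\<exists>p. computes P s p (time_bound B P) \<and> rel_pmf R p q)"

text \<open>Frame and support are added once and for all, so that an invariant \<open>R\<close> need
  only mention the arrays that change.\<close>

lemma refine_frame:
  assumes "refine B P s R q"
  shows "refine B P s (\<lambda>s' a. R s' a \<and> a \<in> set_pmf q \<and> same_outside (iwrites P) (rwrites P) s s') q"
proof -
  obtain p where p: "computes P s p (time_bound B P)" "rel_pmf R p q"
    using assms unfolding refine_def by blast
  have "rel_pmf (\<lambda>s' a. R s' a \<and> a \<in> set_pmf q \<and> same_outside (iwrites P) (rwrites P) s s') p q"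
    using p(2) by (rule pmf.rel_mono_strong) (use p(1) computes_writes in auto)
  then show ?thesis
    using p(1) unfolding refine_def by blast
qed

lemma refine_conseq:
  assumes "refine B P s R q" "q = q'" "\<And>s' a. R s' a \<Longrightarrow> R' s' a"
  shows "refine B P s R' q'"
  using assms unfolding refine_def by (blast intro: pmf.rel_mono_strong)

lemma refine_map:
  assumes "refine B P s R q" "\<And>s' a. R s' a \<Longrightarrow> R' s' (h a)"
  shows "refine B P s R' (map_pmf h q)"
  using assms unfolding refine_def pmf.rel_map by (blast intro: pmf.rel_mono_strong)

lemma refine_Skip: "R s a \<Longrightarrow> refine B Skip s R (return_pmf a)"
  unfolding refine_def
  by (rule exI[of _ "return_pmf s"]) (auto intro: computes_step)

lemma refine_ISet:
  "R (iset x (map (ival s) is) (ival s e) s) a \<Longrightarrow> refine B (ISet x is e) s R (return_pmf a)"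
  unfolding refine_def
  by (rule exI[of _ "return_pmf (iset x (map (ival s) is) (ival s e) s)"]) (auto intro: computes_step)

lemma refine_RSet:
  "R (rset x (map (ival s) is) (rval s e) s) a \<Longrightarrow> refine B (RSet x is e) s R (return_pmf a)"
  unfolding refine_def
  by (rule exI[of _ "return_pmf (rset x (map (ival s) is) (rval s e) s)"]) (auto intro: computes_step)

lemma refine_Flip:
  assumes "\<And>b. R (iset x (map (ival s) is) (if b then 1 else 0) s) b"
  shows "refine B (Flip x is e) s R (bernoulli_pmf (rval s e))"
  unfolding refine_def
  by (rule exI[of _ "map_pmf (\<lambda>b. iset x (map (ival s) is) (if b then 1 else 0) s) (bernoulli_pmf (rval s e))"])
     (auto intro!: computes_step pmf.rel_refl assms simp: pmf.rel_map map_pmf_comp)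

lemma refine_Seq:
  assumes "refine B P s R q"
    and "\<And>s' a. R s' a \<Longrightarrow> a \<in> set_pmf q \<Longrightarrow> same_outside (iwrites P) (rwrites P) s s' \<Longrightarrow>
        refine B Q s' R' (q' a)"
  shows "refine B (Seq P Q) s R' (bind_pmf q q')"
proof -
  obtain p where p: "computes P s p (time_bound B P)"
      "rel_pmf (\<lambda>s' a. R s' a \<and> a \<in> set_pmf q \<and> same_outside (iwrites P) (rwrites P) s s') p q"
    using refine_frame[OF assms(1)] unfolding refine_def by blast
  define t where "t = time_bound B Q"
  \<comment> \<open>Coupling the second halves requires one result distribution for each
    intermediate store. Running \<open>Q\<close> supplies it, since a computed distribution is
    determined by the run.\<close>
  define p' where "p' s' = map_pmf snd (run t ([Q], s'))" for s'
  have *: "computes Q s' (p' s') t \<and> rel_pmf R' (p' s') (q' a)"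
    if R: "R s' a" "a \<in> set_pmf q" "same_outside (iwrites P) (rwrites P) s s'" for s' a
  proof -
    obtain r where r: "computes Q s' r t" "rel_pmf R' r (q' a)"
      using assms(2)[OF R] unfolding refine_def t_def by blast
    have "p' s' = r"
      unfolding p'_def computes_final(1)[OF r(1)] by (simp add: pmf.map_comp o_def pmf.map_ident)
    then show ?thesis
      using r by simp
  qed
  have "rel_pmf R' (bind_pmf p p') (bind_pmf q q')"
    using p(2) by (rule rel_pmf_bindI) (use * in blast)
  moreover have "computes (Seq P Q) s (bind_pmf p p') (time_bound B (Seq P Q))"
    unfolding time_bound.simps t_def[symmetric]
  proof (rule computes_Seq[OF p(1)])
    fix s' assume "s' \<in> set_pmf p"
    then obtain a where "R s' a" "a \<in> set_pmf q" "same_outside (iwrites P) (rwrites P) s s'"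
      using rel_pmf_imp_rel_set[OF p(2)] by (auto dest: rel_setD1)
    then show "computes Q s' (p' s') t"
      using * by blast
  qed
  ultimately show ?thesis
    unfolding refine_def by blast
qed

lemma refine_Cond:
  assumes "bval s b \<Longrightarrow> refine B P s R q" "\<not> bval s b \<Longrightarrow> refine B Q s R q"
  shows "refine B (Cond b P Q) s R q"
proof -
  obtain p where p: "computes (if bval s b then P else Q) s p
      (if bval s b then time_bound B P else time_bound B Q)" "rel_pmf R p q"
    using assms unfolding refine_def by (cases "bval s b") auto
  have "computes (Cond b P Q) s p (time_bound B (Cond b P Q))"
    unfolding time_bound.simps by (rule computes_Cond, rule computes_mono[OF p(1)]) simp
  then show ?thesis
    using p(2) unfolding refine_def by blast
qed

section \<open>Loops as iterated random steps\<close>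

primrec iter_pmf :: "nat \<Rightarrow> (nat \<Rightarrow> 'a \<Rightarrow> 'a pmf) \<Rightarrow> 'a \<Rightarrow> 'a pmf" where
  "iter_pmf 0 F a = return_pmf a"
| "iter_pmf (Suc i) F a = bind_pmf (iter_pmf i F a) (F i)"

text \<open>Execution splits off the first iteration, whereas the recursion splits off the last one,
  which suits invariants.\<close>

lemma iter_pmf_shift:
  "iter_pmf (Suc i) F a = bind_pmf (F 0 a) (iter_pmf i (\<lambda>j. F (Suc j)))"
  by (induction i) (simp_all add: bind_return_pmf bind_return_pmf' bind_assoc_pmf)

lemma iter_pmf_return [simp]: "iter_pmf m (\<lambda>i a. return_pmf a) a = return_pmf a"
  by (induction m) (simp_all add: bind_return_pmf)

text \<open>The guard depends on the iteration number alone, so all random branches leave the loop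
  after the same \<open>m\<close> rounds.\<close>

lemma refine_Loop:
  assumes "m \<le> B" "R 0 s a"
    and "\<And>i s a. i \<le> m \<Longrightarrow> R i s a \<Longrightarrow> bval s b \<longleftrightarrow> i < m"
    and "\<And>i s a. i < m \<Longrightarrow> R i s a \<Longrightarrow> refine B P s (R (Suc i)) (F i a)"
  shows "refine B (Loop b P) s (R m) (iter_pmf m F a)"
proof -
  define t where "t = time_bound B P"
  have "\<exists>p. computes (Loop b P) s p (Suc (m * Suc t)) \<and> rel_pmf (R m) p (iter_pmf m F a)"
    using assms(2-4)
  proof (induction m arbitrary: R s a F)
    case 0
    then show ?case
      using computes_Loop_exit[of s b P] by (intro exI[of _ "return_pmf s"]) auto
  next
    case (Suc m)
    obtain p where p: "computes P s p t" "rel_pmf (R 1) p (F 0 a)"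
      using Suc.prems(3)[of 0] Suc.prems(1) unfolding refine_def t_def by auto
    have IH: "\<exists>p. computes (Loop b P) s' p (Suc (m * Suc t)) \<and>
        rel_pmf (R (Suc m)) p (iter_pmf m (\<lambda>j. F (Suc j)) a')" if "R 1 s' a'" for s' a'
      proof (rule Suc.IH[where R = "\<lambda>i. R (Suc i)"])
      show "R (Suc 0) s' a'"
        using that by simp
      show "bval s b \<longleftrightarrow> i < m" if "i \<le> m" "R (Suc i) s a" for i s a
        using Suc.prems(2)[OF _ that(2)] that(1) by simp
      show "refine B P s (R (Suc (Suc i))) (F (Suc i) a)" if "i < m" "R (Suc i) s a" for i s a
        using Suc.prems(3)[OF _ that(2)] that(1) by simp
    qed
    define p' where "p' s' = map_pmf snd (run (Suc (m * Suc t)) ([Loop b P], s'))" for s'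
    have *: "computes (Loop b P) s' (p' s') (Suc (m * Suc t)) \<and>
        rel_pmf (R (Suc m)) (p' s') (iter_pmf m (\<lambda>j. F (Suc j)) a')" if R: "R 1 s' a'" for s' a'
    proof -
      obtain r where r: "computes (Loop b P) s' r (Suc (m * Suc t))"
        "rel_pmf (R (Suc m)) r (iter_pmf m (\<lambda>j. F (Suc j)) a')"
        using IH[OF R] by blast
      have "p' s' = r"
        unfolding p'_def computes_final(1)[OF r(1)] by (simp add: pmf.map_comp o_def pmf.map_ident)
      then show ?thesis
        using r by simp
    qed
    have "computes (Loop b P) s (bind_pmf p p') (Suc (t + Suc (m * Suc t)))"
    proof (rule computes_Loop_iter[OF _ p(1)])
      show "bval s b"
        using Suc.prems(1,2) by force
      fix s' assume "s' \<in> set_pmf p"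
      then obtain a' where "R 1 s' a'"
        using rel_pmf_imp_rel_set[OF p(2)] by (auto dest: rel_setD1)
      then show "computes (Loop b P) s' (p' s') (Suc (m * Suc t))"
        using * by blast
    qed
    moreover have "rel_pmf (R (Suc m)) (bind_pmf p p') (iter_pmf (Suc m) F a)"
      unfolding iter_pmf_shift using p(2) by (rule rel_pmf_bindI) (use * in blast)
    ultimately show ?case
      by (intro exI[of _ "bind_pmf p p'"]) (simp add: add.left_commute)
  qed
  then obtain p where p: "computes (Loop b P) s p (Suc (m * Suc t))" "rel_pmf (R m) p (iter_pmf m F a)"
    by blast
  have "computes (Loop b P) s p (time_bound B (Loop b P))"
    using p(1) by (rule computes_mono) (use assms(1) in \<open>auto simp: t_def intro!: add_le_mono mult_le_mono1\<close>)
  then show ?thesis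
    using p(2) unfolding refine_def by blast
qed

definition For :: "string \<Rightarrow> iexp \<Rightarrow> com \<Rightarrow> com" where
  "For x e P = Seq (ISet x [] (ICon 0))
     (Loop (ILess (ICell x []) e) (Seq P (ISet x [] (IAdd (ICell x []) (ICon 1)))))"

lemma writes_For [simp]:
  "iwrites (For x e P) = insert x (iwrites P)" "rwrites (For x e P) = rwrites P"
  by (auto simp: For_def)

text \<open>The obligation for the body speaks of the store after the counter has advanced, since
  this is where the invariant has to hold when the guard is evaluated next.\<close>

lemma refine_For:
  assumes m: "m \<le> B" and R0: "R 0 (iset x [] 0 s) a"
    and x: "x \<notin> iwrites P"
    and e: "\<And>i s a. i \<le> m \<Longrightarrow> R i s a \<Longrightarrow> ival s e = m"
    and body: "\<And>i s a. i < m \<Longrightarrow> R i s a \<Longrightarrow> imem s x [] = i \<Longrightarrow>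
      refine B P s (\<lambda>s' a. R (Suc i) (iset x [] (Suc i) s') a) (F i a)"
  shows "refine B (For x e P) s (R m) (iter_pmf m F a)"
proof -
  have "refine B (For x e P) s (\<lambda>s a. R m s a \<and> imem s x [] = m)
      (bind_pmf (return_pmf a) (iter_pmf m F))"
    unfolding For_def
  proof (rule refine_Seq[where R = "\<lambda>s' a'. R 0 s' a' \<and> imem s' x [] = 0"])
    show "refine B (ISet x [] (ICon 0)) s (\<lambda>s' a'. R 0 s' a' \<and> imem s' x [] = 0) (return_pmf a)"
      by (rule refine_ISet) (use R0 in auto)
    fix s' a'
    assume *: "R 0 s' a' \<and> imem s' x [] = 0"
    show "refine B (Loop (ILess (ICell x []) e) (Seq P (ISet x [] (IAdd (ICell x []) (ICon 1))))) s'
        (\<lambda>s a. R m s a \<and> imem s x [] = m) (iter_pmf m F a')"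
    proof (rule refine_Loop[where R = "\<lambda>i s a. R i s a \<and> imem s x [] = i"])
      fix i s a
      assume i: "i < m" "R i s a \<and> imem s x [] = i"
      have "refine B (Seq P (ISet x [] (IAdd (ICell x []) (ICon 1)))) s
          (\<lambda>s a. R (Suc i) s a \<and> imem s x [] = Suc i) (bind_pmf (F i a) return_pmf)"
      proof (rule refine_Seq[OF body])
        fix s' a'
        assume **: "R (Suc i) (iset x [] (Suc i) s') a'" "same_outside (iwrites P) (rwrites P) s s'"
        then have "imem s' x [] = i"
          using i x by (auto simp: same_outside_def)
        then show "refine B (ISet x [] (IAdd (ICell x []) (ICon 1))) s'
            (\<lambda>s a. R (Suc i) s a \<and> imem s x [] = Suc i) (return_pmf a')"
          by (intro refine_ISet) (use ** in auto)
      qed (use i in auto)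
      then show "refine B (Seq P (ISet x [] (IAdd (ICell x []) (ICon 1)))) s
          (\<lambda>s a. R (Suc i) s a \<and> imem s x [] = Suc i) (F i a)"
        by (simp add: bind_return_pmf')
    qed (use * m e in auto)
  qed
  then show ?thesis
    unfolding bind_return_pmf by (rule refine_conseq) auto
qed

text \<open>The bound is read from a cell that the body leaves alone, and the frame relative to the
  store before the loop is carried along the iterations.\<close>

lemma refine_For':
  assumes m: "imem s y [] = m" "m \<le> B" "y \<noteq> x" "x \<notin> iwrites P" "y \<notin> iwrites P"
    and R0: "R 0 (iset x [] 0 s) a"
    and body: "\<And>i s' a. i < m \<Longrightarrow> R i s' a \<Longrightarrow> imem s' x [] = i \<Longrightarrow>
      same_outside (insert x (iwrites P)) (rwrites P) s s' \<Longrightarrow>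
      refine B P s' (\<lambda>s'' a. R (Suc i) (iset x [] (Suc i) s'') a) (F i a)"
  shows "refine B (For x (ICell y []) P) s (R m) (iter_pmf m F a)"
proof -
  define X where "X = insert x (iwrites P)"
  have "refine B (For x (ICell y []) P) s
      (\<lambda>s' a. R m s' a \<and> same_outside X (rwrites P) s s') (iter_pmf m F a)"
  proof (rule refine_For[where R = "\<lambda>i s' a. R i s' a \<and> same_outside X (rwrites P) s s'"])
    fix i s' a
    assume i: "i < m" "R i s' a \<and> same_outside X (rwrites P) s s'" "imem s' x [] = i"
    then have "refine B P s' (\<lambda>s'' a. R (Suc i) (iset x [] (Suc i) s'') a) (F i a)"
      using body[of i s' a] by (simp add: X_def)
    from refine_frame[OF this]
    show "refine B P s' (\<lambda>s'' a. R (Suc i) (iset x [] (Suc i) s'') a \<and>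
        same_outside X (rwrites P) s (iset x [] (Suc i) s'')) (F i a)"
    proof (rule refine_conseq)
      fix s'' a'
      assume *: "R (Suc i) (iset x [] (Suc i) s'') a' \<and> a' \<in> set_pmf (F i a) \<and>
        same_outside (iwrites P) (rwrites P) s' s''"
      have "same_outside X (rwrites P) s s''"
        by (rule same_outside_trans[of _ _ _ s' "iwrites P" "rwrites P"]) (use i * in \<open>auto simp: X_def\<close>)
      then show "R (Suc i) (iset x [] (Suc i) s'') a' \<and>
          same_outside X (rwrites P) s (iset x [] (Suc i) s'')"
        using * by (simp add: same_outside_def X_def)
    qed simp
  qed (use m R0 in \<open>auto simp: same_outside_def X_def\<close>)
  then show ?thesis
    by (rule refine_conseq) auto
qed

abbreviation hoare :: "nat \<Rightarrow> com \<Rightarrow> store \<Rightarrow> (store \<Rightarrow> bool) \<Rightarrow> bool" where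
  "hoare B P s Q \<equiv> refine B P s (\<lambda>s' _. Q s') (return_pmf ())"

lemma refine_after:
  assumes "hoare B P s Q"
    and "\<And>s'. Q s' \<Longrightarrow> same_outside (iwrites P) (rwrites P) s s' \<Longrightarrow> refine B P' s' R q"
  shows "refine B (Seq P P') s R q"
proof -
  have "refine B (Seq P P') s R (bind_pmf (return_pmf ()) (\<lambda>_. q))"
    by (rule refine_Seq[OF assms(1)]) (use assms(2) in simp)
  then show ?thesis
    by (simp add: bind_return_pmf)
qed

lemma refine_before:
  assumes "refine B P s R q"
    and "\<And>s' a. R s' a \<Longrightarrow> same_outside (iwrites P) (rwrites P) s s' \<Longrightarrow>
      hoare B P' s' (\<lambda>s''. R' s'' (h a))"
  shows "refine B (Seq P P') s R' (map_pmf h q)"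
proof -
  have "refine B (Seq P P') s R' (bind_pmf q (\<lambda>a. return_pmf (h a)))"
  proof (rule refine_Seq[OF assms(1)])
    fix s' a
    assume "R s' a" "same_outside (iwrites P) (rwrites P) s s'"
    from refine_map[OF assms(2)[OF this], of R' "\<lambda>_. h a"]
    show "refine B P' s' R' (return_pmf (h a))"
      by simp
  qed
  then show ?thesis
    by (simp add: map_pmf_def)
qed

lemma hoare_For:
  assumes "imem s y [] = m" "m \<le> B" "y \<noteq> x" "x \<notin> iwrites P" "y \<notin> iwrites P"
    and "Q 0 (iset x [] 0 s)"
    and "\<And>i s'. i < m \<Longrightarrow> Q i s' \<Longrightarrow> imem s' x [] = i \<Longrightarrow>
      same_outside (insert x (iwrites P)) (rwrites P) s s' \<Longrightarrow>
      hoare B P s' (\<lambda>s''. Q (Suc i) (iset x [] (Suc i) s''))"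
  shows "hoare B (For x (ICell y []) P) s (Q m)"
proof -
  have "refine B (For x (ICell y []) P) s (\<lambda>s' _. Q m s') (iter_pmf m (\<lambda>i a. return_pmf a) ())"
    using assms by (intro refine_For'[where R = "\<lambda>i s _. Q i s"]) (auto simp: unit_eq)
  then show ?thesis
    by simp
qed

lemma hoare_conseq: "hoare B P s Q \<Longrightarrow> (\<And>s'. Q s' \<Longrightarrow> Q' s') \<Longrightarrow> hoare B P s Q'"
  by (erule refine_conseq) simp_all

section \<open>The sampling procedure\<close>

text \<open>A uniform sample known to lie in \<open>[l, w)\<close> is compared with \<open>t\<close>
  by a coin whose bias is the conditional probability of lying above \<open>t\<close>, and the
  interval shrinks accordingly. No real number is ever sampled.\<close>

definition narrow :: "real \<Rightarrow> real \<times> real \<Rightarrow> (real \<times> real) pmf" where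
  "narrow t = (\<lambda>(l, w). if l < t \<and> t < w
     then map_pmf (\<lambda>b. if b then (t, w) else (l, t)) (bernoulli_pmf ((w - t) / (w - l)))
     else return_pmf (l, w))"

text \<open>After all distances have been compared, the lower end compares with each of them just as
  the uniform sample would, so it can serve as the radius.\<close>

definition radius_pmf :: "nat \<Rightarrow> (nat \<Rightarrow> nat \<Rightarrow> real) \<Rightarrow> real \<Rightarrow> real pmf" where
  "radius_pmf n d \<rho> =
     map_pmf fst (iter_pmf n (\<lambda>u. iter_pmf n (\<lambda>v. narrow (d u v))) (\<rho> / 4, \<rho> / 2))"

text \<open>Appending \<open>k\<close> random bits to a leading 1 gives a uniform number from
  \<open>2 ^ k\<close> to \<open>2 ^ (k + 1) - 1\<close>. The leading 1 keeps it above the priority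
  0 of the dummy value \<open>n\<close>.\<close>

definition priority_pmf :: "nat \<Rightarrow> nat pmf" where
  "priority_pmf k =
     iter_pmf k (\<lambda>_ g. map_pmf (\<lambda>b. g + g + (if b then 1 else 0)) (bernoulli_pmf (1 / 2))) 1"

definition priorities_pmf :: "nat \<Rightarrow> nat \<Rightarrow> (nat \<Rightarrow> nat) pmf" where
  "priorities_pmf n k =
     iter_pmf n (\<lambda>u g. map_pmf (\<lambda>x. g(u := x)) (priority_pmf k)) (\<lambda>_. 0)"

text \<open>The value \<open>n\<close> stands for ``none so far'' and has priority \<open>0\<close>.\<close>

primrec winner :: "nat \<Rightarrow> (nat \<Rightarrow> bool) \<Rightarrow> (nat \<Rightarrow> nat) \<Rightarrow> nat \<Rightarrow> nat" where
  "winner n X g 0 = n"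
| "winner n X g (Suc u) =
     (if X u \<and> g (winner n X g u) < g u then u else winner n X g u)"

definition center :: "nat \<Rightarrow> (nat \<Rightarrow> nat \<Rightarrow> real) \<Rightarrow> real \<Rightarrow> (nat \<Rightarrow> nat) \<Rightarrow> nat \<Rightarrow> nat" where
  "center n d r g v = winner n (\<lambda>u. d u v \<le> r) g n"

primrec least_below :: "nat \<Rightarrow> (nat \<Rightarrow> bool) \<Rightarrow> nat \<Rightarrow> nat" where
  "least_below v X 0 = v"
| "least_below v X (Suc u) =
     (if X u \<and> u < least_below v X u then u else least_below v X u)"

text \<open>
  The first component maps every point to its facility, whose preimages are called groups. The
  second one tells which points of a group still take part in its further refinement.
\<close>

type_synonym state = "(nat \<Rightarrow> nat) \<times> (nat \<Rightarrow> bool)"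

text \<open>The least point names its part, so the name of the part of a core point is itself a core
  point of this part.\<close>

definition child :: "nat \<Rightarrow> state \<Rightarrow> (nat \<Rightarrow> nat) \<Rightarrow> nat \<Rightarrow> nat" where
  "child n s c v =
     least_below v (\<lambda>u. snd s u \<and> fst s u = fst s v \<and> c u = c v) n"

definition weight :: "nat \<Rightarrow> (nat \<Rightarrow> nat) \<Rightarrow> (nat \<Rightarrow> bool) \<Rightarrow> (nat \<Rightarrow> nat) \<Rightarrow> nat \<Rightarrow> real" where
  "weight n N X q w = (\<Sum>v<n. if X v \<and> q v = w then real (N v) else 0)"

text \<open>
  Adding a client multiplies the odds by at most \<open>(1 + 1 / a) ^ k \<le> exp (k / a)\<close>, so a threshold
  with these odds is private, although the machine cannot compute exponentials.
\<close>

definition odds :: "nat \<Rightarrow> real \<Rightarrow> real \<Rightarrow> real" where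
  "odds k a x = ((x + a) / (4 * a)) ^ k"

text \<open>With \<open>z = 0\<close> every part is marked, whatever the clients are.\<close>

definition marks_pmf :: "nat \<Rightarrow> nat \<Rightarrow> real \<Rightarrow> nat \<Rightarrow> (nat \<Rightarrow> real) \<Rightarrow> (nat \<Rightarrow> bool) pmf" where
  "marks_pmf n k a z x =
     iter_pmf n (\<lambda>u h. map_pmf (\<lambda>b. h(u := b))
       (bernoulli_pmf (odds k a (x u) / (real z + odds k a (x u))))) (\<lambda>_. False)"

text \<open>
  In a group \<open>l\<close> with a marked part, all points outside of the marked parts move to the
  target, so that the group is split only into its marked parts.
\<close>

primrec target :: "nat \<Rightarrow> state \<Rightarrow> (nat \<Rightarrow> nat) \<Rightarrow> (nat \<Rightarrow> bool) \<Rightarrow> nat \<Rightarrow> nat \<Rightarrow> nat" where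
  "target n s q h 0 l = n"
| "target n s q h (Suc v) l =
     (if snd s v \<and> h (q v) \<and> fst s v = l then q v else target n s q h v l)"

definition update :: "nat \<Rightarrow> state \<Rightarrow> (nat \<Rightarrow> nat) \<Rightarrow> (nat \<Rightarrow> bool) \<Rightarrow> state" where
  "update n s q h =
     (\<lambda>v. if snd s v \<and> h (q v) then q v
        else if target n s q h n (fst s v) < n then target n s q h n (fst s v) else fst s v,
      \<lambda>v. snd s v \<and> h (q v))"

definition level_pmf ::
  "nat \<Rightarrow> (nat \<Rightarrow> nat \<Rightarrow> real) \<Rightarrow> (nat \<Rightarrow> nat) \<Rightarrow> nat \<Rightarrow> real \<Rightarrow> real \<Rightarrow> nat \<Rightarrow> state \<Rightarrow> state pmf" where
  "level_pmf n d N k \<rho> a z s =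
     bind_pmf (radius_pmf n d \<rho>) (\<lambda>r. bind_pmf (priorities_pmf n k) (\<lambda>g.
       let q = child n s (center n d r g)
       in map_pmf (update n s q) (marks_pmf n k a z (weight n N (snd s) q))))"

section \<open>The program\<close>

text \<open>
  Arrays: \<open>A\<close> and \<open>B\<close> hold the two components of the state, \<open>p\<close> the scale \<open>\<rho>\<close> and \<open>a\<close> the
  threshold of the level, \<open>l\<close> and \<open>w\<close> the interval for the radius, \<open>g\<close> the priorities, \<open>c\<close> the
  centers, \<open>q\<close> the children, \<open>x\<close> and \<open>o\<close> a weight and its odds, \<open>h\<close> the marks, \<open>T\<close> the targets,
  \<open>e\<close> the minimum of \<open>1\<close> and \<open>\<epsilon>\<close>, \<open>s\<close> the least positive distance, and \<open>z\<close> the value \<open>0\<close> at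
  the first level and \<open>1\<close> afterwards.
\<close>

abbreviation "iv x \<equiv> ICell x []"
abbreviation "rv x \<equiv> RCell x []"
abbreviation "iat x e \<equiv> ICell x [e]"

definition IEq :: "iexp \<Rightarrow> iexp \<Rightarrow> bexp" where
  "IEq a b = BAnd (BNot (ILess a b)) (BNot (ILess b a))"

lemma bval_IEq [simp]: "bval s (IEq a b) \<longleftrightarrow> ival s a = ival s b"
  by (auto simp: IEq_def)

definition Pos :: "iexp \<Rightarrow> bexp" where
  "Pos a = ILess (ICon 0) a"

lemma bval_Pos [simp]: "bval s (Pos a) \<longleftrightarrow> 0 < ival s a"
  by (simp add: Pos_def)

definition radius_com :: com where
  "radius_com =
     Seq (RSet ''l'' [] (RDiv (rv ''p'') (RInt (ICon 4))))
    (Seq (RSet ''w'' [] (RDiv (rv ''p'') (RInt (ICon 2))))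
     (For ''u'' (iv ''n'') (For ''v'' (iv ''n'')
       (Cond (BAnd (RLess (rv ''l'') (RCell ''d'' [iv ''u'', iv ''v'']))
                   (RLess (RCell ''d'' [iv ''u'', iv ''v'']) (rv ''w'')))
         (Seq (Flip ''b'' [] (RDiv (RSub (rv ''w'') (RCell ''d'' [iv ''u'', iv ''v'']))
                                   (RSub (rv ''w'') (rv ''l''))))
           (Cond (Pos (iv ''b''))
             (RSet ''l'' [] (RCell ''d'' [iv ''u'', iv ''v'']))
             (RSet ''w'' [] (RCell ''d'' [iv ''u'', iv ''v'']))))
         Skip))))"

definition priorities_com :: com where
  "priorities_com =
     Seq (For ''u'' (iv ''n'')
       (Seq (ISet ''g'' [iv ''u''] (ICon 1))
         (For ''j'' (iv ''k'')
           (Seq (Flip ''b'' [] (RDiv (RInt (ICon 1)) (RInt (ICon 2))))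
             (ISet ''g'' [iv ''u''] (IAdd (IAdd (iat ''g'' (iv ''u'')) (iat ''g'' (iv ''u''))) (iv ''b'')))))))
     (ISet ''g'' [iv ''n''] (ICon 0))"

definition center_com :: com where
  "center_com =
     For ''v'' (iv ''n'')
       (Seq (ISet ''c'' [iv ''v''] (iv ''n''))
         (For ''u'' (iv ''n'')
           (Cond (BAnd (BNot (RLess (rv ''l'') (RCell ''d'' [iv ''u'', iv ''v''])))
                       (ILess (iat ''g'' (iat ''c'' (iv ''v''))) (iat ''g'' (iv ''u''))))
             (ISet ''c'' [iv ''v''] (iv ''u''))
             Skip)))"

definition child_com :: com where
  "child_com =
     For ''v'' (iv ''n'')
       (Seq (ISet ''q'' [iv ''v''] (iv ''v''))
         (For ''u'' (iv ''n'')
           (Cond (BAnd (BAnd (Pos (iat ''B'' (iv ''u''))) (IEq (iat ''A'' (iv ''u'')) (iat ''A'' (iv ''v''))))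
                       (BAnd (IEq (iat ''c'' (iv ''u'')) (iat ''c'' (iv ''v'')))
                             (ILess (iv ''u'') (iat ''q'' (iv ''v'')))))
             (ISet ''q'' [iv ''v''] (iv ''u''))
             Skip)))"

definition marks_com :: com where
  "marks_com =
     For ''u'' (iv ''n'')
       (Seq (RSet ''x'' [] (RInt (ICon 0)))
       (Seq (For ''v'' (iv ''n'')
              (Cond (BAnd (Pos (iat ''B'' (iv ''v''))) (IEq (iat ''q'' (iv ''v'')) (iv ''u'')))
                (RSet ''x'' [] (RAdd (rv ''x'') (RCell ''N'' [iv ''v''])))
                Skip))
       (Seq (RSet ''o'' [] (RInt (ICon 1)))
       (Seq (For ''j'' (iv ''k'')
              (RSet ''o'' [] (RMul (RDiv (RAdd (rv ''x'') (rv ''a'')) (RMul (RInt (ICon 4)) (rv ''a''))) (rv ''o''))))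
         (Flip ''h'' [iv ''u''] (RDiv (rv ''o'') (RAdd (RInt (iv ''z'')) (rv ''o''))))))))"

definition update_com :: com where
  "update_com =
     Seq (For ''v'' (iv ''n'') (ISet ''T'' [iv ''v''] (iv ''n'')))
    (Seq (For ''v'' (iv ''n'')
           (Cond (BAnd (Pos (iat ''B'' (iv ''v''))) (Pos (iat ''h'' (iat ''q'' (iv ''v'')))))
             (ISet ''T'' [iat ''A'' (iv ''v'')] (iat ''q'' (iv ''v'')))
             Skip))
         (For ''v'' (iv ''n'')
           (Cond (BAnd (Pos (iat ''B'' (iv ''v''))) (Pos (iat ''h'' (iat ''q'' (iv ''v'')))))
             (ISet ''A'' [iv ''v''] (iat ''q'' (iv ''v'')))
             (Seq (ISet ''B'' [iv ''v''] (ICon 0))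
               (Cond (ILess (iat ''T'' (iat ''A'' (iv ''v''))) (iv ''n''))
                 (ISet ''A'' [iv ''v''] (iat ''T'' (iat ''A'' (iv ''v''))))
                 Skip)))))"

definition level_com :: com where
  "level_com =
     Seq radius_com (Seq priorities_com (Seq center_com (Seq child_com (Seq marks_com update_com))))"

section \<open>Correctness of the program of one level\<close>

lemma refine_radius:
  assumes n: "imem s ''n'' [] = n" "n \<le> B"
    and d: "\<And>u v. u < n \<Longrightarrow> v < n \<Longrightarrow> rmem s ''d'' [u, v] = d u v"
    and p: "rmem s ''p'' [] = \<rho>"
  shows "refine B radius_com s (\<lambda>s' r. rmem s' ''l'' [] = r) (radius_pmf n d \<rho>)"
  unfolding radius_com_def radius_pmf_def
proof (rule refine_after[where Q = "\<lambda>s. rmem s ''l'' [] = \<rho> / 4"], goal_cases)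
  case 1
  show ?case
    by (rule refine_RSet) (simp add: p)
next
  case (2 s1)
  note s1 = 2
  let ?R = "\<lambda>s (l, w). rmem s ''l'' [] = l \<and> rmem s ''w'' [] = w"
  show ?case
  proof (rule refine_map[where R = ?R], rule refine_after[where Q = "\<lambda>s. ?R s (\<rho> / 4, \<rho> / 2)"], goal_cases)
    case 1
    show ?case
      by (rule refine_RSet) (use s1 in \<open>simp add: p same_outside_def\<close>)
  next
    case (2 s2)
    note s2 = 2
    show ?case
    proof (rule refine_For'[where R = "\<lambda>_. ?R"], goal_cases)
      case (7 u s3 a)
      note s3 = 7
      show ?case
      proof (rule refine_For'[where R = "\<lambda>_ s. ?R (iset ''u'' [] (Suc u) s)"], goal_cases)
        case (7 v s4 a)
        note s4 = 7
        obtain l w where [simp]: "a = (l, w)"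
          by fastforce
        have [simp]: "rmem s4 ''d'' [u, v] = d u v" "imem s4 ''u'' [] = u" "imem s4 ''v'' [] = v"
            "rmem s4 ''l'' [] = l" "rmem s4 ''w'' [] = w"
          using s1 s2 s3 s4 by (simp_all add: same_outside_def d)
        show ?case
        proof (cases "l < d u v \<and> d u v < w")
          case True
          show ?thesis
          proof (rule refine_Cond, goal_cases)
            case 1
            have "refine B
               (Seq (Flip ''b'' [] (RDiv (RSub (rv ''w'') (RCell ''d'' [iv ''u'', iv ''v'']))
                                   (RSub (rv ''w'') (rv ''l''))))
               (Cond (Pos (iv ''b''))
                 (RSet ''l'' [] (RCell ''d'' [iv ''u'', iv ''v'']))
                 (RSet ''w'' [] (RCell ''d'' [iv ''u'', iv ''v''])))) s4
               (\<lambda>s'' a. ?R (iset ''u'' [] (Suc u) (iset ''v'' [] (Suc v) s'')) a)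
               (map_pmf (\<lambda>b. if b then (d u v, w) else (l, d u v)) (bernoulli_pmf ((w - d u v) / (w - l))))"
            proof (rule refine_before[where R = "\<lambda>s b. imem s ''b'' [] = (if b then 1 else 0)"], goal_cases)
              case 1
              show ?case
                by (rule refine_conseq[OF refine_Flip[where R = "\<lambda>s b. imem s ''b'' [] = (if b then 1 else 0)"]])
                   simp_all
            next
              case (2 s5 b)
              then show ?case
                by (intro refine_Cond refine_RSet) (auto simp: same_outside_def split: if_splits)
            qed
            then show ?case
              using True by (simp add: narrow_def)
          qed (use True in simp)
        next
          case False
          then show ?thesis
            unfolding narrow_def using s4 by (auto intro!: refine_Cond refine_Skip)
        qed
      qed (use s1 s2 s3 n in \<open>auto simp: same_outside_def\<close>)
    qed (use s1 s2 n in \<open>auto simp: same_outside_def\<close>)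
  qed auto
qed

lemma refine_priorities:
  assumes n: "imem s ''n'' [] = n" "n \<le> B" and k: "imem s ''k'' [] = k" "k \<le> B"
  shows "refine B priorities_com s (\<lambda>s' g. \<forall>u\<le>n. imem s' ''g'' [u] = g u) (priorities_pmf n k)"
proof -
  let ?R = "\<lambda>i s g. (\<forall>u<i. imem s ''g'' [u] = g u) \<and> (\<forall>u\<ge>i. g u = 0)"
  have "refine B priorities_com s (\<lambda>s' g. \<forall>u\<le>n. imem s' ''g'' [u] = g u)
      (map_pmf (\<lambda>g. g) (priorities_pmf n k))"
    unfolding priorities_com_def
  proof (rule refine_before[where R = "?R n"], goal_cases)
    case 1
    show ?case
      unfolding priorities_pmf_def
    proof (rule refine_For'[where R = ?R], goal_cases)
      case (7 u s1 g)
      note s1 = 7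
      let ?R1 = "\<lambda>s x. imem s ''g'' [u] = x \<and> (\<forall>w<u. imem s ''g'' [w] = g w)"
      show ?case
      proof (rule refine_map[where R = ?R1], rule refine_after[where Q = "\<lambda>s. ?R1 s 1"], goal_cases)
        case 1
        show ?case
          by (rule refine_ISet) (use s1 in simp)
      next
        case (2 s2)
        note s2 = 2
        show ?case
          unfolding priority_pmf_def
        proof (rule refine_For'[where R = "\<lambda>_. ?R1"], goal_cases)
          case (7 j s3 x)
          note s3 = 7
          have "imem s3 ''u'' [] = u"
            using s1 s2 s3 by (simp add: same_outside_def)
          note [simp] = this
          have "refine B (Seq (Flip ''b'' [] (RDiv (RInt (ICon 1)) (RInt (ICon 2))))
                   (ISet ''g'' [iv ''u''] (IAdd (IAdd (iat ''g'' (iv ''u'')) (iat ''g'' (iv ''u''))) (iv ''b'')))) s3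
              (\<lambda>s'' a. ?R1 (iset ''j'' [] (Suc j) s'') a)
              (map_pmf (\<lambda>b. x + x + (if b then 1 else 0)) (bernoulli_pmf (rval s3 (RDiv (RInt (ICon 1)) (RInt (ICon 2))))))"
          proof (rule refine_before[where R = "\<lambda>s b. imem s ''b'' [] = (if b then 1 else 0)"], goal_cases)
            case 1
            show ?case
              by (rule refine_conseq[OF refine_Flip[where R = "\<lambda>s b. imem s ''b'' [] = (if b then 1 else 0)"]])
                 simp_all
          next
            case (2 s4 b)
            then have "imem s4 ''u'' [] = u"
              using \<open>imem s3 ''u'' [] = u\<close> by (simp add: same_outside_def)
            then show ?case
              by (intro refine_ISet) (use s3 2 in \<open>auto simp: same_outside_def\<close>)
          qed
          then show ?case
            by simp
        qed (use s1 s2 k in \<open>auto simp: same_outside_def\<close>)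
      qed (use s1 in \<open>auto simp: less_Suc_eq\<close>)
    qed (use n in auto)
  next
    case (2 s1 g)
    then show ?case
      by (intro refine_ISet) (use n in \<open>auto simp: same_outside_def\<close>)
  qed
  then show ?thesis
    by (simp add: pmf.map_ident)
qed

lemma winner_le: "u \<le> n \<Longrightarrow> winner n X g u \<le> n"
  by (induction u) auto

lemma hoare_center:
  assumes n: "imem s ''n'' [] = n" "n \<le> B"
    and d: "\<And>u v. u < n \<Longrightarrow> v < n \<Longrightarrow> rmem s ''d'' [u, v] = d u v"
    and l: "rmem s ''l'' [] = r" and g: "\<forall>u\<le>n. imem s ''g'' [u] = g u"
  shows "hoare B center_com s (\<lambda>s'. \<forall>v<n. imem s' ''c'' [v] = center n d r g v)"
  unfolding center_com_def
proof (rule hoare_For[where Q = "\<lambda>i s. \<forall>v<i. imem s ''c'' [v] = center n d r g v"], goal_cases)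
  case (7 v s1)
  note s1 = 7
  let ?Q = "\<lambda>u s. imem s ''c'' [v] = winner n (\<lambda>u. d u v \<le> r) g u \<and>
    (\<forall>w<v. imem s ''c'' [w] = center n d r g w)"
  show ?case
  proof (rule hoare_conseq[where Q = "?Q n"], rule refine_after[where Q = "?Q 0"], goal_cases)
    case 1
    show ?case
      by (rule refine_ISet) (use s1 n in \<open>auto simp: same_outside_def\<close>)
  next
    case (2 s2)
    note s2 = 2
    show ?case
    proof (rule hoare_For[where Q = ?Q], goal_cases)
      case (7 u s3)
      note s3 = 7
      have [simp]: "imem s3 ''u'' [] = u" "imem s3 ''v'' [] = v" "rmem s3 ''l'' [] = r"
          "rmem s3 ''d'' [u, v] = d u v" "imem s3 ''g'' [u] = g u"
          "imem s3 ''g'' [winner n (\<lambda>u. d u v \<le> r) g u] = g (winner n (\<lambda>u. d u v \<le> r) g u)"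
        using s1 s2 s3 d l g winner_le[of u n] by (simp_all add: same_outside_def)
      show ?case
        by (intro refine_Cond refine_ISet refine_Skip) (use s3 in auto)
    qed (use s1 s2 n in \<open>auto simp: same_outside_def\<close>)
  next
    case (3 s2)
    then show ?case
      by (auto simp: less_Suc_eq center_def)
  qed
qed (use n in auto)

text \<open>The bound on \<open>fst st v\<close> makes facilities usable as indices of arrays that
  are filled only below \<open>n\<close>.\<close>

definition represents :: "nat \<Rightarrow> store \<Rightarrow> state \<Rightarrow> bool" where
  "represents n s st \<longleftrightarrow>
     (\<forall>v<n. imem s ''A'' [v] = fst st v \<and> (0 < imem s ''B'' [v]) = snd st v \<and> fst st v < n)"

lemma hoare_child:
  assumes n: "imem s ''n'' [] = n" "n \<le> B" and st: "represents n s st"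
    and c: "\<forall>v<n. imem s ''c'' [v] = c v"
  shows "hoare B child_com s (\<lambda>s'. \<forall>v<n. imem s' ''q'' [v] = child n st c v)"
  unfolding child_com_def
proof (rule hoare_For[where Q = "\<lambda>i s. \<forall>v<i. imem s ''q'' [v] = child n st c v"], goal_cases)
  case (7 v s1)
  note s1 = 7
  let ?Q = "\<lambda>u s. imem s ''q'' [v] =
      least_below v (\<lambda>u. snd st u \<and> fst st u = fst st v \<and> c u = c v) u \<and>
    (\<forall>w<v. imem s ''q'' [w] = child n st c w)"
  show ?case
  proof (rule hoare_conseq[where Q = "?Q n"], rule refine_after[where Q = "?Q 0"], goal_cases)
    case 1
    show ?case
      by (rule refine_ISet) (use s1 n in \<open>auto simp: same_outside_def\<close>)
  next
    case (2 s2)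
    note s2 = 2
    show ?case
    proof (rule hoare_For[where Q = ?Q], goal_cases)
      case (7 u s3)
      note s3 = 7
      have "imem s3 ''u'' [] = u" "imem s3 ''v'' [] = v"
          "imem s3 ''A'' [u] = fst st u" "imem s3 ''A'' [v] = fst st v"
          "(0 < imem s3 ''B'' [u]) = snd st u"
          "imem s3 ''c'' [u] = c u" "imem s3 ''c'' [v] = c v"
        using s1 s2 s3 st c by (simp_all add: same_outside_def represents_def)
      note [simp] = this
      show ?case
        by (intro refine_Cond refine_ISet refine_Skip) (use s3 in auto)
    qed (use s1 s2 n in \<open>auto simp: same_outside_def\<close>)
  next
    case (3 s2)
    then show ?case
      by (auto simp: less_Suc_eq child_def)
  qed
qed (use n in auto)

lemma refine_marks:
  assumes n: "imem s ''n'' [] = n" "n \<le> B" and k: "imem s ''k'' [] = k" "k \<le> B"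
    and N: "\<And>v. v < n \<Longrightarrow> rmem s ''N'' [v] = real (N v)"
    and a: "rmem s ''a'' [] = a" and z: "imem s ''z'' [] = z"
    and st: "represents n s st" and q: "\<forall>v<n. imem s ''q'' [v] = q v"
  shows "refine B marks_com s (\<lambda>s' h. \<forall>u<n. (0 < imem s' ''h'' [u]) = h u)
    (marks_pmf n k a z (weight n N (snd st) q))"
  unfolding marks_com_def marks_pmf_def
proof (rule refine_For'[where R = "\<lambda>i s h. \<forall>u<i. (0 < imem s ''h'' [u]) = h u"], goal_cases)
  case (7 u s1 h)
  note s1 = 7
  let ?w = "weight n N (snd st) q u"
  let ?h = "\<lambda>s. \<forall>w<u. (0 < imem s ''h'' [w]) = h w"
  let ?x = "\<lambda>i s. rmem s ''x'' [] = (\<Sum>v<i. if snd st v \<and> q v = u then real (N v) else 0)"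
  show ?case
  proof (rule refine_after[where Q = "?x 0"], goal_cases)
    case 1
    show ?case
      by (rule refine_RSet) simp
  next
    case (2 s2)
    note s2 = 2
    show ?case
    proof (rule refine_after[where Q = "?x n"], goal_cases)
      case 1
      show ?case
      proof (rule hoare_For[where Q = ?x], goal_cases)
        case (7 v s3)
        note s3 = 7
        have "imem s3 ''u'' [] = u" "imem s3 ''v'' [] = v" "rmem s3 ''N'' [v] = real (N v)"
            "(0 < imem s3 ''B'' [v]) = snd st v" "imem s3 ''q'' [v] = q v"
          using s1 s2 s3 st q N by (simp_all add: same_outside_def represents_def)
        note [simp] = this
        show ?case
          by (intro refine_Cond refine_RSet refine_Skip) (use s3 in auto)
      qed (use s1 s2 n in \<open>auto simp: same_outside_def\<close>)
    next
      case (2 s3)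
      note s3 = 2
      show ?case
      proof (rule refine_after[where Q = "\<lambda>s. rmem s ''o'' [] = 1"], goal_cases)
        case 1
        show ?case
          by (rule refine_RSet) simp
      next
        case (2 s4)
        note s4 = 2
        show ?case
        proof (rule refine_after[where Q = "\<lambda>s. rmem s ''o'' [] = odds k a ?w"], goal_cases)
          case 1
          have "hoare B (For ''j'' (iv ''k'')
              (RSet ''o'' [] (RMul (RDiv (RAdd (rv ''x'') (rv ''a'')) (RMul (RInt (ICon 4)) (rv ''a''))) (rv ''o'')))) s4
              (\<lambda>s. rmem s ''o'' [] = odds k a ?w)"
          proof (rule hoare_For[where Q = "\<lambda>i s. rmem s ''o'' [] = odds i a ?w"], goal_cases)
            case (7 j s5)
            note s5 = 7
            have "rmem s5 ''x'' [] = ?w" "rmem s5 ''a'' [] = a"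
              using s1 s2 s3 s4 s5 a by (simp_all add: same_outside_def weight_def)
            then show ?case
              by (intro refine_RSet) (use s5 in \<open>simp add: odds_def\<close>)
          qed (use s1 s2 s3 s4 k in \<open>auto simp: same_outside_def odds_def\<close>)
          then show ?case .
        next
          case (2 s5)
          note s5 = 2
          have h: "?h s5"
            using s1 s2 s3 s4 s5 by (simp add: same_outside_def)
          have *: "imem s5 ''u'' [] = u" "imem s5 ''z'' [] = z"
            using s1 s2 s3 s4 s5 z by (simp_all add: same_outside_def)
          have "refine B (Flip ''h'' [iv ''u''] (RDiv (rv ''o'') (RAdd (RInt (iv ''z'')) (rv ''o'')))) s5
              (\<lambda>s'' b. \<forall>w<Suc u. (0 < imem (iset ''u'' [] (Suc u) s'') ''h'' [w]) = (h(u := b)) w)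
              (bernoulli_pmf (rval s5 (RDiv (rv ''o'') (RAdd (RInt (iv ''z'')) (rv ''o'')))))"
            by (rule refine_Flip) (use h * in \<open>auto simp: less_Suc_eq\<close>)
          from refine_map[OF this, of "\<lambda>s'' h'. \<forall>w<Suc u. (0 < imem (iset ''u'' [] (Suc u) s'') ''h'' [w]) = h' w" "\<lambda>b. h(u := b)"]
          show ?case
            using s5 * by simp
        qed
      qed
    qed
  qed
qed (use n in auto)

lemma least_below_le: "least_below v X u \<le> v"
  by (induction u) auto

lemma child_le: "child n s c v \<le> v"
  by (simp add: child_def least_below_le)

text \<open>The second loop computes the targets of all groups at once: the last write to a cell
  wins, and this is the largest \<open>v\<close>, which the recursion of \<open>target\<close> meets
  first.\<close>

lemma hoare_update:
  assumes n: "imem s ''n'' [] = n" "n \<le> B" and st: "represents n s st"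
    and q: "\<forall>v<n. imem s ''q'' [v] = q v" "\<forall>v<n. q v < n"
    and h: "\<forall>u<n. (0 < imem s ''h'' [u]) = h u"
  shows "hoare B update_com s (\<lambda>s'. represents n s' (update n st q h))"
  unfolding update_com_def
proof (rule refine_after[where Q = "\<lambda>s. \<forall>l<n. imem s ''T'' [l] = target n st q h 0 l"], goal_cases)
  case 1
  show ?case
  proof (rule hoare_For[where Q = "\<lambda>i s. \<forall>l<i. imem s ''T'' [l] = target n st q h 0 l"], goal_cases)
    case (7 v s1)
    then show ?case
      by (intro refine_ISet) (use n in \<open>auto simp: same_outside_def less_Suc_eq\<close>)
  qed (use n in auto)
next
  case (2 s1)
  note s1 = 2
  show ?case
  proof (rule refine_after[where Q = "\<lambda>s. \<forall>l<n. imem s ''T'' [l] = target n st q h n l"], goal_cases)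
    case 1
    show ?case
    proof (rule hoare_For[where Q = "\<lambda>i s. \<forall>l<n. imem s ''T'' [l] = target n st q h i l"], goal_cases)
      case (7 v s2)
      note s2 = 7
      have "imem s2 ''v'' [] = v" "imem s2 ''A'' [v] = fst st v" "(0 < imem s2 ''B'' [v]) = snd st v"
          "imem s2 ''q'' [v] = q v" "(0 < imem s2 ''h'' [q v]) = h (q v)"
        using s1 s2 st q h by (simp_all add: same_outside_def represents_def)
      note [simp] = this
      show ?case
        by (intro refine_Cond refine_ISet refine_Skip) (use s2 in auto)
    qed (use s1 n in \<open>auto simp: same_outside_def\<close>)
  next
    case (2 s2)
    note s2 = 2
    let ?P = "\<lambda>s v st. imem s ''A'' [v] = fst st v \<and> (0 < imem s ''B'' [v]) = snd st v \<and> fst st v < n"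
    \<comment> \<open>Points below \<open>i\<close> have been updated in place. A later iteration
      reads only its own entries of \<open>A\<close> and \<open>B\<close> and the finished arrays
      \<open>T\<close>, \<open>q\<close> and \<open>h\<close>.\<close>
    let ?Q = "\<lambda>i s. (\<forall>v<i. ?P s v (update n st q h)) \<and> (\<forall>v<n. i \<le> v \<longrightarrow> ?P s v st)"
    show ?case
    proof (rule hoare_conseq[where Q = "?Q n"], rule hoare_For[where Q = ?Q], goal_cases)
      case (7 v s3)
      note s3 = 7
      have "imem s3 ''v'' [] = v" "imem s3 ''A'' [v] = fst st v" "(0 < imem s3 ''B'' [v]) = snd st v"
          "imem s3 ''q'' [v] = q v" "(0 < imem s3 ''h'' [q v]) = h (q v)" "imem s3 ''n'' [] = n"
          "imem s3 ''T'' [fst st v] = target n st q h n (fst st v)" "q v < n"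
        using s1 s2 s3 st q h n by (simp_all add: same_outside_def represents_def)
      note [simp] = this
      show ?case
        apply (intro refine_Cond)
         apply (rule refine_ISet)
        using s3 apply (auto simp: less_Suc_eq update_def)[1]
        apply (rule refine_after[where Q = "\<lambda>s. s = iset ''B'' [v] 0 s3"])
         apply (rule refine_ISet)
         apply simp
        apply (intro refine_Cond refine_ISet refine_Skip)
        using s3 apply (auto simp: less_Suc_eq update_def)
        done
    qed (use s1 s2 st n in \<open>auto simp: same_outside_def represents_def\<close>)
  qed
qed

lemma same_outside_imem: "same_outside X Y s s' \<Longrightarrow> x \<notin> X \<Longrightarrow> imem s' x = imem s x"
  and same_outside_rmem: "same_outside X Y s s' \<Longrightarrow> y \<notin> Y \<Longrightarrow> rmem s' y = rmem s y"
  by (simp_all add: same_outside_def)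

definition inputs :: "nat \<Rightarrow> (nat \<Rightarrow> nat \<Rightarrow> real) \<Rightarrow> (nat \<Rightarrow> nat) \<Rightarrow> store \<Rightarrow> bool" where
  "inputs n d N s \<longleftrightarrow> imem s ''n'' [] = n \<and>
     (\<forall>u<n. \<forall>v<n. rmem s ''d'' [u, v] = d u v) \<and> (\<forall>v<n. rmem s ''N'' [v] = real (N v))"

lemma inputs_same_outside:
  assumes "inputs n d N s" "same_outside X Y s s'" "''n'' \<notin> X" "''d'' \<notin> Y" "''N'' \<notin> Y"
  shows "inputs n d N s'"
  using assms(1) unfolding inputs_def
  by (simp add: same_outside_imem[OF assms(2,3)] same_outside_rmem[OF assms(2,4)] same_outside_rmem[OF assms(2,5)])

lemma inputs_set [simp]:
  "x \<noteq> ''n'' \<Longrightarrow> inputs n d N (iset x is k s) = inputs n d N s"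
  "x \<noteq> ''d'' \<Longrightarrow> x \<noteq> ''N'' \<Longrightarrow> inputs n d N (rset x is r s) = inputs n d N s"
  by (simp_all add: inputs_def)

lemma represents_same_outside:
  assumes "represents n s st" "same_outside X Y s s'" "''A'' \<notin> X" "''B'' \<notin> X"
  shows "represents n s' st"
  using assms(1) unfolding represents_def
  by (simp add: same_outside_imem[OF assms(2,3)] same_outside_imem[OF assms(2,4)])

lemma represents_set [simp]:
  "x \<noteq> ''A'' \<Longrightarrow> x \<noteq> ''B'' \<Longrightarrow> represents n (iset x is k s) st = represents n s st"
  "represents n (rset x is r s) st = represents n s st"
  by (simp_all add: represents_def)

lemma refine_level:
  assumes nk: "n \<le> B" "k \<le> B" and s: "inputs n d N s" "represents n s st"
    and k: "imem s ''k'' [] = k"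
    and p: "rmem s ''p'' [] = \<rho>" and a: "rmem s ''a'' [] = a" and z: "imem s ''z'' [] = z"
  shows "refine B level_com s (represents n) (level_pmf n d N k \<rho> a z st)"
  unfolding level_com_def level_pmf_def
proof (rule refine_Seq[OF refine_radius], goal_cases)
  case (5 s1 r)
  note f1 = 5(3)[unfolded radius_com_def]
  have s1: "inputs n d N s1" "represents n s1 st" "imem s1 ''k'' [] = k" "imem s1 ''z'' [] = z"
      "rmem s1 ''a'' [] = a"
    using inputs_same_outside[OF s(1) f1] represents_same_outside[OF s(2) f1]
      same_outside_imem[OF f1] same_outside_rmem[OF f1] k a z by simp_all
  note l1 = 5(1)
  show ?case
  proof (rule refine_Seq[OF refine_priorities], goal_cases)
    case (5 s2 g)
    note f2 = 5(3)[unfolded priorities_com_def]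
    have s2: "inputs n d N s2" "represents n s2 st" "imem s2 ''k'' [] = k" "imem s2 ''z'' [] = z"
        "rmem s2 ''a'' [] = a" "rmem s2 ''l'' [] = r"
      using inputs_same_outside[OF s1(1) f2] represents_same_outside[OF s1(2) f2]
        same_outside_imem[OF f2] same_outside_rmem[OF f2] s1(3-5) l1 by simp_all
    note g2 = 5(1)
    let ?c = "center n d r g"
    let ?q = "child n st ?c"
    show ?case
    proof (rule refine_after[OF hoare_center[where d = d and r = r and g = g and n = n]], goal_cases)
      case (6 s3)
      note f3 = 6(2)[unfolded center_com_def]
      have s3: "inputs n d N s3" "represents n s3 st" "imem s3 ''k'' [] = k" "imem s3 ''z'' [] = z"
          "rmem s3 ''a'' [] = a"
        using inputs_same_outside[OF s2(1) f3] represents_same_outside[OF s2(2) f3]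
          same_outside_imem[OF f3] same_outside_rmem[OF f3] s2(3-5) by simp_all
      note c3 = 6(1)
      show ?case
      proof (rule refine_after[OF hoare_child[where st = st and c = ?c and n = n]], goal_cases)
        case (5 s4)
        note f4 = 5(2)[unfolded child_com_def]
        have s4: "inputs n d N s4" "represents n s4 st" "imem s4 ''k'' [] = k" "imem s4 ''z'' [] = z"
            "rmem s4 ''a'' [] = a"
          using inputs_same_outside[OF s3(1) f4] represents_same_outside[OF s3(2) f4]
            same_outside_imem[OF f4] same_outside_rmem[OF f4] s3(3-5) by simp_all
        note q4 = 5(1)
        show ?case
          unfolding Let_def
        proof (rule refine_before[OF refine_marks[where st = st and q = ?q and n = n and k = k and N = N and a = a and z = z]], goal_cases)
          case (10 s5 h)
          note f5 = 10(2)[unfolded marks_com_def]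
          have s5: "inputs n d N s5" "represents n s5 st" "\<forall>v<n. imem s5 ''q'' [v] = ?q v"
            using inputs_same_outside[OF s4(1) f5] represents_same_outside[OF s4(2) f5]
              same_outside_imem[OF f5] q4 by simp_all
          show ?case
            by (rule hoare_update[OF _ nk(1) s5(2,3) _ 10(1)])
               (use s5(1) in \<open>auto simp: inputs_def intro: le_less_trans[OF child_le]\<close>)
        qed (use s4 nk q4 in \<open>simp_all add: inputs_def\<close>)
      qed (use s3 nk c3 in \<open>simp_all add: inputs_def\<close>)
    qed (use s2 nk g2 in \<open>simp_all add: inputs_def\<close>)
  qed (use s1 nk in \<open>simp_all add: inputs_def\<close>)
qed (use s nk p in \<open>simp_all add: inputs_def\<close>)

section \<open>The whole program and its distribution\<close>

definition gap :: "nat \<Rightarrow> (nat \<Rightarrow> nat \<Rightarrow> real) \<Rightarrow> real" where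
  "gap n d = Min (insert 1 {d u v |u v. u < n \<and> v < n \<and> 0 < d u v})"

definition log_bound :: "nat \<Rightarrow> nat" where
  "log_bound n = (LEAST j. n \<le> 2 ^ j)"

text \<open>At least \<open>log n\<close>, so that the probability \<open>2 ^ (- k)\<close> is at
  most \<open>1 / n\<close>; the additional 3 keeps the exponent of the odds above 1.\<close>

definition num_bits :: "nat \<Rightarrow> nat" where
  "num_bits n = 3 + log_bound n"

text \<open>At this scale points at positive distance no longer fit into one part. Only public data
  enter, so the number of levels reveals nothing about the clients.\<close>

definition depth :: "nat \<Rightarrow> (nat \<Rightarrow> nat \<Rightarrow> real) \<Rightarrow> real \<Rightarrow> real \<Rightarrow> nat" where
  "depth n d f \<epsilon> = (LEAST i. min 1 \<epsilon> * f / 2 ^ i < gap n d)"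

text \<open>Scale times threshold is \<open>num_bits n * f\<close> at all levels, and the privacy
  cost, which is \<open>num_bits n\<close> divided by the threshold, is
  \<open>min 1 \<epsilon> / 2 ^ i\<close>.\<close>

definition levels_pmf ::
  "nat \<Rightarrow> (nat \<Rightarrow> nat \<Rightarrow> real) \<Rightarrow> real \<Rightarrow> real \<Rightarrow> (nat \<Rightarrow> nat) \<Rightarrow> nat \<Rightarrow> state pmf" where
  "levels_pmf n d f \<epsilon> N m =
     iter_pmf m (\<lambda>i. level_pmf n d N (num_bits n) (min 1 \<epsilon> * f / 2 ^ i)
       (real (num_bits n) / min 1 \<epsilon> * 2 ^ i) (if i = 0 then 0 else 1)) (\<lambda>_. 0, \<lambda>_. True)"

text \<open>The metric is chosen such that the nearest facility is the one of the own group.\<close>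

definition partition_output :: "nat \<Rightarrow> state \<Rightarrow> superset_output" where
  "partition_output n s =
     ({v. v < n \<and> fst s v = v},
      \<lambda>u v. if u < n \<and> v < n then if u = v then 0 else if fst s u = fst s v then 1 else 2 else 0)"

definition init_com :: com where
  "init_com =
     Seq (Cond (RLess (rv ''eps'') (RInt (ICon 1))) (RSet ''e'' [] (rv ''eps'')) (RSet ''e'' [] (RInt (ICon 1))))
    (Seq (ISet ''k'' [] (ICon 3))
    (Seq (ISet ''m'' [] (ICon 1))
    (Seq (Loop (ILess (iv ''m'') (iv ''n''))
       (Seq (ISet ''k'' [] (IAdd (iv ''k'') (ICon 1))) (ISet ''m'' [] (IAdd (iv ''m'') (iv ''m'')))))
    (Seq (RSet ''s'' [] (RInt (ICon 1)))
    (Seq (For ''u'' (iv ''n'') (For ''v'' (iv ''n'')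
       (Cond (BAnd (RLess (RInt (ICon 0)) (RCell ''d'' [iv ''u'', iv ''v'']))
                   (RLess (RCell ''d'' [iv ''u'', iv ''v'']) (rv ''s'')))
         (RSet ''s'' [] (RCell ''d'' [iv ''u'', iv ''v'']))
         Skip)))
    (Seq (For ''v'' (iv ''n'') (Seq (ISet ''A'' [iv ''v''] (ICon 0)) (ISet ''B'' [iv ''v''] (ICon 1))))
    (Seq (RSet ''p'' [] (RMul (rv ''e'') (rv ''f'')))
    (Seq (RSet ''a'' [] (RDiv (RInt (iv ''k'')) (rv ''e'')))
    (Seq (ISet ''z'' [] (ICon 0))
         (ISet ''y'' [] (ICon 1)))))))))))"

text \<open>The flag \<open>y\<close> is cleared before the level is executed, so the first scale
  below the gap still gets its own level, and there are \<open>Suc depth\<close> of them.\<close>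

definition main_com :: com where
  "main_com =
     Loop (Pos (iv ''y''))
       (Seq (Cond (RLess (rv ''p'') (rv ''s'')) (ISet ''y'' [] (ICon 0)) Skip)
       (Seq level_com
       (Seq (RSet ''p'' [] (RDiv (rv ''p'') (RInt (ICon 2))))
       (Seq (RSet ''a'' [] (RMul (rv ''a'') (RInt (ICon 2))))
            (ISet ''z'' [] (ICon 1))))))"

definition output_com :: com where
  "output_com =
     For ''u'' (iv ''n'')
       (Seq (Cond (IEq (iat ''A'' (iv ''u'')) (iv ''u'')) (ISet ''R'' [iv ''u''] (ICon 1)) (ISet ''R'' [iv ''u''] (ICon 0)))
         (For ''v'' (iv ''n'')
           (Cond (IEq (iv ''u'') (iv ''v'')) (RSet ''D'' [iv ''u'', iv ''v''] (RInt (ICon 0)))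
           (Cond (IEq (iat ''A'' (iv ''u'')) (iat ''A'' (iv ''v'')))
             (RSet ''D'' [iv ''u'', iv ''v''] (RInt (ICon 1)))
             (RSet ''D'' [iv ''u'', iv ''v''] (RInt (ICon 2)))))))"

definition ufl_com :: com where
  "ufl_com = Seq init_com (Seq main_com output_com)"

lemma log_bound: "n \<le> 2 ^ log_bound n"
  unfolding log_bound_def by (rule LeastI[of _ n]) (simp add: less_imp_le)

lemma not_log_bound: "j < log_bound n \<Longrightarrow> 2 ^ j < n"
  unfolding log_bound_def using not_less_Least[of j] by force

lemma log_bound_le: "log_bound n \<le> n"
  unfolding log_bound_def by (rule Least_le) (simp add: less_imp_le)

lemma depth:
  assumes "0 < gap n d"
  shows "min 1 \<epsilon> * f / 2 ^ depth n d f \<epsilon> < gap n d"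
proof -
  have "\<exists>i. min 1 \<epsilon> * f / gap n d < 2 ^ i"
    by (rule real_arch_pow) simp
  then have "\<exists>i. min 1 \<epsilon> * f / 2 ^ i < gap n d"
    using assms by (simp add: field_simps)
  then show ?thesis
    unfolding depth_def by (rule LeastI_ex)
qed

lemma not_depth: "i < depth n d f \<epsilon> \<Longrightarrow> gap n d \<le> min 1 \<epsilon> * f / 2 ^ i"
  unfolding depth_def using not_less_Least[of i] by force

text \<open>What the nested loops that compute the gap have seen when they reach row
  \<open>i\<close> and column \<open>j\<close>.\<close>

definition near_pairs :: "nat \<Rightarrow> (nat \<Rightarrow> nat \<Rightarrow> real) \<Rightarrow> nat \<Rightarrow> nat \<Rightarrow> real set" where
  "near_pairs n d i j = {d u v |u v. (u < i \<or> u = i \<and> v < j) \<and> u < n \<and> v < n \<and> 0 < d u v}"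

lemma finite_near_pairs [simp]: "finite (near_pairs n d i j)"
  by (rule finite_subset[of _ "(\<lambda>(u, v). d u v) ` ({..<n} \<times> {..<n})"]) (auto simp: near_pairs_def)

lemma near_pairs_simps:
  "near_pairs n d 0 0 = {}"
  "i < n \<Longrightarrow> j < n \<Longrightarrow> near_pairs n d i (Suc j) = (if 0 < d i j then insert (d i j) (near_pairs n d i j) else near_pairs n d i j)"
  "near_pairs n d i n = near_pairs n d (Suc i) 0"
  by (auto simp: near_pairs_def less_Suc_eq)

definition least_pair :: "nat \<Rightarrow> (nat \<Rightarrow> nat \<Rightarrow> real) \<Rightarrow> nat \<Rightarrow> nat \<Rightarrow> real" where
  "least_pair n d i j = Min (insert 1 (near_pairs n d i j))"

lemma least_pair_simps:
  "least_pair n d 0 0 = 1"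
  "i < n \<Longrightarrow> j < n \<Longrightarrow> least_pair n d i (Suc j) =
     (if 0 < d i j \<and> d i j < least_pair n d i j then d i j else least_pair n d i j)"
  "least_pair n d i n = least_pair n d (Suc i) 0"
proof -
  assume "i < n" "j < n"
  have min_less: "min x y = (if x < y then x else y)" for x y :: real
    by auto
  have *: "Min (insert 1 (insert (d i j) (near_pairs n d i j))) =
      min (d i j) (Min (insert 1 (near_pairs n d i j)))"
    by (subst insert_commute, subst Min_insert) auto
  then show "least_pair n d i (Suc j) =
      (if 0 < d i j \<and> d i j < least_pair n d i j then d i j else least_pair n d i j)"
    unfolding least_pair_def near_pairs_simps(2)[OF \<open>i < n\<close> \<open>j < n\<close>]
    by (cases "0 < d i j") (simp_all only: if_True if_False simp_thms * min_less)
qed (simp_all add: least_pair_def near_pairs_simps)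

lemma gap_eq: "gap n d = least_pair n d n 0"
  unfolding gap_def least_pair_def near_pairs_def
  by (rule arg_cong[of _ _ "\<lambda>S. Min (insert 1 S)"]) auto

text \<open>The inserted 1 covers the case that no distance is positive, in particular
  \<open>n = 1\<close>.\<close>

lemma gap_pos: "0 < gap n d"
  unfolding gap_eq least_pair_def
  by (subst Min_gr_iff, simp, simp) (auto simp: near_pairs_def)

lemma gap_le: "u < n \<Longrightarrow> v < n \<Longrightarrow> 0 < d u v \<Longrightarrow> gap n d \<le> d u v"
  unfolding gap_eq least_pair_def
  by (rule Min_le, simp) (auto simp: near_pairs_def)

lemma gap_cases:
  obtains "gap n d = 1" | u v where "u < n" "v < n" "0 < d u v" "gap n d = d u v"
proof -
  have "gap n d \<in> insert 1 (near_pairs n d n 0)"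
    unfolding gap_eq least_pair_def by (rule Min_in) auto
  then show ?thesis
    using that by (auto simp: near_pairs_def)
qed

lemma hoare_init:
  assumes n: "1 \<le> n" "n \<le> B"
  shows "hoare B init_com (input_store n d f \<epsilon> N) (\<lambda>s. inputs n d N s \<and>
    imem s ''k'' [] = num_bits n \<and> rmem s ''s'' [] = gap n d \<and>
    represents n s (\<lambda>_. 0, \<lambda>_. True) \<and> rmem s ''p'' [] = min 1 \<epsilon> * f \<and>
    rmem s ''a'' [] = real (num_bits n) / min 1 \<epsilon> \<and> imem s ''z'' [] = 0 \<and> imem s ''y'' [] = 1)"
  unfolding init_com_def
proof (rule refine_after[where Q = "\<lambda>s. inputs n d N s \<and> rmem s ''f'' [] = f \<and> rmem s ''e'' [] = min 1 \<epsilon>"], goal_cases)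
  case 1
  show ?case
    by (intro refine_Cond refine_RSet) (auto simp: input_store_def inputs_def)
next
  case (2 s1)
  let ?I = "\<lambda>s. inputs n d N s \<and> rmem s ''f'' [] = f \<and> rmem s ''e'' [] = min 1 \<epsilon>"
  have s1: "?I s1"
    using 2(1) by simp
  show ?case
  proof (rule refine_after[where Q = "\<lambda>s. ?I s \<and> imem s ''k'' [] = 3"], goal_cases)
    case 1
    show ?case by (rule refine_ISet) (simp add: s1)
  next
    case (2 s2)
    note s2 = 2(1)
    let ?J = "\<lambda>i s. ?I s \<and> imem s ''k'' [] = 3 + i \<and> imem s ''m'' [] = 2 ^ i"
    show ?case
    proof (rule refine_after[where Q = "?J 0"], goal_cases)
      case 1
      show ?case by (rule refine_ISet) (simp add: s2)
    next
      case (2 s3)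
      note s3 = 2(1)
      show ?case
      proof (rule refine_after[where Q = "?J (log_bound n)"], goal_cases)
        case 1
        have "refine B (Loop (ILess (iv ''m'') (iv ''n''))
          (Seq (ISet ''k'' [] (IAdd (iv ''k'') (ICon 1))) (ISet ''m'' [] (IAdd (iv ''m'') (iv ''m''))))) s3
          (\<lambda>s _. ?J (log_bound n) s) (iter_pmf (log_bound n) (\<lambda>i. return_pmf) ())"
        proof (rule refine_Loop[where R = "\<lambda>i s _. ?J i s"], goal_cases)
          case 1
          show ?case using n log_bound_le[of n] by linarith
        next
          case 2
          show ?case by (rule s3)
        next
          case (3 i s a)
          then show ?case
            using log_bound[of n] not_log_bound[of i n] by (cases "i = log_bound n") (auto simp: inputs_def)
        next
          case (4 i s a)
          show ?case
            by (rule refine_after[where Q = "\<lambda>s. ?I s \<and> imem s ''k'' [] = 3 + Suc i \<and> imem s ''m'' [] = 2 ^ i"])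
               (rule refine_ISet, use 4 in \<open>auto intro!: refine_ISet\<close>)
        qed
        then show ?case by simp
      next
        case (2 s4)
        note s4 = 2(1)
        let ?K = "\<lambda>s. ?I s \<and> imem s ''k'' [] = num_bits n"
        let ?L = "\<lambda>i j s. ?K s \<and> rmem s ''s'' [] = least_pair n d i j"
        show ?case
        proof (rule refine_after[where Q = "?L 0 0"], goal_cases)
          case 1
          show ?case by (rule refine_RSet) (simp add: s4 least_pair_simps num_bits_def)
        next
          case (2 s5)
          note s5 = 2(1)
          show ?case
          proof (rule refine_after[where Q = "?L n 0"], goal_cases)
            case 1
            show ?case
            proof (rule hoare_For[where Q = "\<lambda>i. ?L i 0"], goal_cases)
              case (7 u s6)
              note s6 = 7
              show ?case
              proof (rule hoare_conseq[where Q = "\<lambda>s. ?L u n s \<and> imem s ''u'' [] = u"], rule hoare_For[where Q = "\<lambda>i s. ?L u i s \<and> imem s ''u'' [] = u"], goal_cases)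
                case (7 v s7)
                note s7 = 7(1-3)
                have vals: "imem s7 ''u'' [] = u" "imem s7 ''v'' [] = v" "rmem s7 ''d'' [u, v] = d u v"
                  using s7 s6(1) by (simp_all add: inputs_def)
                have step: "least_pair n d u (Suc v) =
                    (if 0 < d u v \<and> d u v < least_pair n d u v then d u v else least_pair n d u v)"
                  by (rule least_pair_simps(2)) (use s6 s7 in simp_all)
                show ?case
                  by (intro refine_Cond refine_RSet refine_Skip)
                     (use s7(2) in \<open>simp_all add: vals step\<close>)
              next
                case (8 s)
                then show ?case
                  by (simp add: least_pair_simps(3))
              qed (use s6 n in \<open>simp_all add: inputs_def\<close>)
            qed (use s5 n in \<open>simp_all add: inputs_def\<close>)
          next
            case (2 s6)
            note s6 = 2(1)
            let ?M = "\<lambda>s. ?K s \<and> rmem s ''s'' [] = gap n d"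
            let ?P = "\<lambda>i s. ?M s \<and> (\<forall>v<i. imem s ''A'' [v] = 0 \<and> imem s ''B'' [v] = 1)"
            show ?case
            proof (rule refine_after[where Q = "\<lambda>s. ?M s \<and> represents n s (\<lambda>_. 0, \<lambda>_. True)"], goal_cases)
              case 1
              show ?case
              proof (rule hoare_conseq[where Q = "?P n"], rule hoare_For[where Q = ?P], goal_cases)
                case (7 v s7)
                show ?case
                  by (rule refine_after[where Q = "\<lambda>s. ?P v s \<and> imem s ''v'' [] = v \<and> imem s ''A'' [v] = 0"])
                     (use 7 in \<open>auto simp: less_Suc_eq intro!: refine_ISet\<close>)
              qed (use s6 n in \<open>auto simp: inputs_def represents_def gap_eq\<close>)
            next
              case (2 s7)
              note s7 = 2(1)
              let ?s8 = "rset ''p'' [] (min 1 \<epsilon> * f) s7"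
              let ?s9 = "rset ''a'' [] (real (num_bits n) / min 1 \<epsilon>) ?s8"
              let ?s10 = "iset ''z'' [] 0 ?s9"
              show ?case
                apply (rule refine_after[where Q = "\<lambda>s. s = ?s8"], rule refine_RSet, simp add: s7)
                apply (rule refine_after[where Q = "\<lambda>s. s = ?s9"], rule refine_RSet, simp add: s7)
                apply (rule refine_after[where Q = "\<lambda>s. s = ?s10"], rule refine_ISet, simp)
                apply (rule refine_ISet)
                using s7 by simp
            qed
          qed
        qed
      qed
    qed
  qed
qed

lemma refine_main:
  assumes B: "n \<le> B" "num_bits n \<le> B" "Suc (depth n d f \<epsilon>) \<le> B"
    and s: "inputs n d N s" "imem s ''k'' [] = num_bits n" "rmem s ''s'' [] = gap n d"
      "represents n s (\<lambda>_. 0, \<lambda>_. True)" "rmem s ''p'' [] = min 1 \<epsilon> * f"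
      "rmem s ''a'' [] = real (num_bits n) / min 1 \<epsilon>" "imem s ''z'' [] = 0" "imem s ''y'' [] = 1"
  shows "refine B main_com s (\<lambda>s st. inputs n d N s \<and> represents n s st)
    (levels_pmf n d f \<epsilon> N (Suc (depth n d f \<epsilon>)))"
proof -
  define m where "m = depth n d f \<epsilon>"
  define \<rho> where "\<rho> i = min 1 \<epsilon> * f / 2 ^ i" for i :: nat
  define a where "a i = real (num_bits n) / min 1 \<epsilon> * 2 ^ i" for i :: nat
  define z where "z i = (if i = 0 then 0 else 1 :: nat)" for i :: nat
  let ?S = "\<lambda>i s. inputs n d N s \<and> imem s ''k'' [] = num_bits n \<and> rmem s ''s'' [] = gap n d \<and>
      rmem s ''p'' [] = \<rho> i \<and> rmem s ''a'' [] = a i \<and> imem s ''z'' [] = z i"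
  let ?R = "\<lambda>i s st. ?S i s \<and> represents n s st \<and> (0 < imem s ''y'' []) = (i < Suc m)"
  let ?F = "\<lambda>i. level_pmf n d N (num_bits n) (\<rho> i) (a i) (z i)"
  have "refine B main_com s (?R (Suc m)) (iter_pmf (Suc m) ?F (\<lambda>_. 0, \<lambda>_. True))"
    unfolding main_com_def
  proof (rule refine_Loop[where R = ?R], goal_cases)
    case (4 i s st)
    \<comment> \<open>As \<open>depth\<close> is the least such index, the test succeeds in the last
      round only.\<close>
    have p: "\<rho> i < gap n d \<longleftrightarrow> i = m"
      using 4(1) depth[OF gap_pos, of \<epsilon> f n d] not_depth[of i n d f \<epsilon>]
      by (cases "i = m") (auto simp: m_def \<rho>_def)
    let ?P = "\<lambda>s. ?S i s \<and> represents n s st \<and> (0 < imem s ''y'' []) = (Suc i < Suc m)"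
    show ?case
    proof (rule refine_after[where Q = ?P], goal_cases)
      case 1
      show ?case
        by (intro refine_Cond refine_ISet refine_Skip) (use 4 p in simp_all)
    next
      case (2 s1)
      note s1 = 2(1)
      have level: "refine B level_com s1 (represents n) (?F i st)"
        by (rule refine_level) (use s1 B in simp_all)
      have "refine B (Seq level_com (Seq (RSet ''p'' [] (RDiv (rv ''p'') (RInt (ICon 2))))
         (Seq (RSet ''a'' [] (RMul (rv ''a'') (RInt (ICon 2)))) (ISet ''z'' [] (ICon 1))))) s1
         (?R (Suc i)) (map_pmf (\<lambda>x. x) (?F i st))"
      proof (rule refine_before[OF level])
        fix s2 st'
        assume st': "represents n s2 st'"
        assume "same_outside (iwrites level_com) (rwrites level_com) s1 s2"
        note frame = this[unfolded level_com_def radius_com_def priorities_com_def center_com_def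
          child_com_def marks_com_def update_com_def]
        have s2: "?S i s2 \<and> (0 < imem s2 ''y'' []) = (Suc i < Suc m)"
          using s1 inputs_same_outside[OF _ frame] same_outside_imem[OF frame] same_outside_rmem[OF frame]
          by simp
        let ?s3 = "rset ''p'' [] (\<rho> (Suc i)) s2"
        let ?s4 = "rset ''a'' [] (a (Suc i)) ?s3"
        show "hoare B (Seq (RSet ''p'' [] (RDiv (rv ''p'') (RInt (ICon 2))))
           (Seq (RSet ''a'' [] (RMul (rv ''a'') (RInt (ICon 2)))) (ISet ''z'' [] (ICon 1)))) s2
           (\<lambda>s. ?R (Suc i) s st')"
          apply (rule refine_after[where Q = "\<lambda>s. s = ?s3"], rule refine_RSet)
           apply (simp add: s2, simp add: \<rho>_def mult.commute)
          apply (rule refine_after[where Q = "\<lambda>s. s = ?s4"], rule refine_RSet)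
           apply (simp add: s2, simp add: a_def mult_ac)
          apply (rule refine_ISet)
          using s2 st' by (simp add: z_def)
      qed
      then show ?case
        by (simp add: pmf.map_ident)
    qed
  qed (use B s in \<open>simp_all add: m_def \<rho>_def a_def z_def\<close>)
  then show ?thesis
    unfolding levels_pmf_def m_def \<rho>_def a_def z_def by (rule refine_conseq) simp_all
qed

lemma hoare_output:
  assumes n: "n \<le> B" and s: "inputs n d N s" "represents n s st"
  shows "hoare B output_com s (\<lambda>s'. output_of n s' = partition_output n st)"
proof -
  let ?D = "\<lambda>u v. if u = v then 0 else if fst st u = fst st v then 1 else 2 :: real"
  let ?I = "\<lambda>s. imem s ''n'' [] = n \<and> represents n s st"
  let ?Q = "\<lambda>i s. ?I s \<and> (\<forall>u<i. (imem s ''R'' [u] \<noteq> 0) = (fst st u = u) \<and> (\<forall>v<n. rmem s ''D'' [u, v] = ?D u v))"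
  show ?thesis
    unfolding output_com_def
  proof (rule hoare_conseq[where Q = "?Q n"], rule hoare_For[where Q = ?Q], goal_cases)
    case (7 u s1)
    note s1 = 7(1-3)
    let ?U = "\<lambda>s. ?Q u s \<and> imem s ''u'' [] = u \<and> (imem s ''R'' [u] \<noteq> 0) = (fst st u = u)"
    show ?case
    proof (rule refine_after[where Q = ?U], goal_cases)
      case 1
      have "imem s1 ''u'' [] = u" "imem s1 ''A'' [u] = fst st u"
        using s1 by (simp_all add: represents_def)
      then show ?case
        by (intro refine_Cond refine_ISet) (use s1 in simp_all)
    next
      case (2 s2)
      note s2 = 2(1)
      let ?J = "\<lambda>j s. ?U s \<and> (\<forall>v<j. rmem s ''D'' [u, v] = ?D u v)"
      show ?case
      proof (rule hoare_conseq[where Q = "?J n"], rule hoare_For[where Q = ?J], goal_cases)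
        case (7 v s3)
        note s3 = 7(1-3)
        have "imem s3 ''u'' [] = u" "imem s3 ''v'' [] = v" "imem s3 ''A'' [u] = fst st u"
            "imem s3 ''A'' [v] = fst st v"
          using s1(1) s3 by (simp_all add: represents_def)
        then show ?case
          by (intro refine_Cond refine_RSet) (use s3 in \<open>auto simp: less_Suc_eq\<close>)
      qed (use s2 n in \<open>auto simp: less_Suc_eq\<close>)
    qed
  next
    case (8 s)
    then show ?case
      by (auto simp: output_of_def partition_output_def fun_eq_iff)
  qed (use s n in \<open>auto simp: inputs_def\<close>)
qed

lemma refine_ufl:
  assumes "1 \<le> n" "n \<le> B" "num_bits n \<le> B" "Suc (depth n d f \<epsilon>) \<le> B"
  shows "refine B ufl_com (input_store n d f \<epsilon> N) (\<lambda>s st. output_of n s = partition_output n st)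
    (levels_pmf n d f \<epsilon> N (Suc (depth n d f \<epsilon>)))"
proof -
  have "refine B ufl_com (input_store n d f \<epsilon> N) (\<lambda>s st. output_of n s = partition_output n st)
    (map_pmf (\<lambda>x. x) (levels_pmf n d f \<epsilon> N (Suc (depth n d f \<epsilon>))))"
    unfolding ufl_com_def
  proof (rule refine_after[OF hoare_init], goal_cases)
    case (3 s)
    show ?case
      by (rule refine_before[OF refine_main], use 3 assms in simp_all)
         (use assms in \<open>blast intro: hoare_output\<close>)
  qed (use assms in simp_all)
  then show ?thesis
    by (simp add: pmf.map_ident)
qed

text \<open>The program is now replaced by \<open>levels_pmf\<close>; apart from the running time,
  all that follows concerns this distribution.\<close>

lemma ufl_algorithm_eq:
  assumes "1 \<le> n"
  shows "ufl_algorithm ufl_com n d f \<epsilon> N =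
    map_pmf (partition_output n) (levels_pmf n d f \<epsilon> N (Suc (depth n d f \<epsilon>)))"
proof -
  define B where "B = n + num_bits n + Suc (depth n d f \<epsilon>)"
  obtain p where p: "computes ufl_com (input_store n d f \<epsilon> N) p (time_bound B ufl_com)"
      "rel_pmf (\<lambda>s st. output_of n s = partition_output n st) p (levels_pmf n d f \<epsilon> N (Suc (depth n d f \<epsilon>)))"
    using refine_ufl[of n B d f \<epsilon> N] assms unfolding refine_def B_def by auto
  \<comment> \<open>A coupling on which two functions always agree makes their distributions
    equal.\<close>
  have "map_pmf (output_of n) p = map_pmf (partition_output n) (levels_pmf n d f \<epsilon> N (Suc (depth n d f \<epsilon>)))"
    unfolding pmf.rel_eq[symmetric] pmf.rel_map using p(2) by simp
  then show ?thesis
    unfolding ufl_algorithm_def computes_final_store[OF p(1)] .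
qed

lemma halts_within_ufl:
  assumes "1 \<le> n"
  shows "halts_within ufl_com (input_store n d f \<epsilon> N)
    (time_bound (n + num_bits n + Suc (depth n d f \<epsilon>)) ufl_com)"
  using refine_ufl[of n "n + num_bits n + Suc (depth n d f \<epsilon>)" d f \<epsilon> N] assms
  unfolding refine_def by (auto dest: computes_final(2))

section \<open>Expectations over finite supports\<close>

abbreviation E :: "'a pmf \<Rightarrow> ('a \<Rightarrow> real) \<Rightarrow> real" where
  "E p \<equiv> measure_pmf.expectation p"

text \<open>All distributions of the algorithm have finite support, so every real function is
  integrable.\<close>

abbreviation "finite_pmf p \<equiv> finite (set_pmf p)"

lemma E_bind:
  assumes "finite_pmf p" "\<And>x. x \<in> set_pmf p \<Longrightarrow> finite_pmf (F x)"
  shows "E (bind_pmf p F) h = E p (\<lambda>x. E (F x) h :: real)"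
proof -
  have "E (bind_pmf p F) h = (\<Sum>a\<in>set_pmf p. pmf p a *\<^sub>R E (F a) h)"
    by (rule pmf_expectation_bind) (use assms in auto)
  also have "\<dots> = E p (\<lambda>x. E (F x) h)"
    using assms(1) by (subst integral_measure_pmf_real[of "set_pmf p"]) (auto simp: mult.commute)
  finally show ?thesis .
qed

lemma E_map: "E (map_pmf g p) h = E p (\<lambda>x. h (g x) :: real)"
  by (rule integral_map_pmf)

lemma E_mono:
  fixes g h :: "'a \<Rightarrow> real"
  assumes "finite_pmf p" "\<And>x. x \<in> set_pmf p \<Longrightarrow> g x \<le> h x"
  shows "E p g \<le> E p h"
  using assms by (intro integral_mono_AE) (auto intro: integrable_measure_pmf_finite simp: AE_measure_pmf_iff)

lemma E_cong:
  fixes g h :: "'a \<Rightarrow> real"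
  assumes "\<And>x. x \<in> set_pmf p \<Longrightarrow> g x = h x"
  shows "E p g = E p h"
  using assms by (intro integral_cong_AE) (auto simp: AE_measure_pmf_iff)

lemma E_add:
  fixes g h :: "'a \<Rightarrow> real"
  assumes "finite_pmf p"
  shows "E p (\<lambda>x. g x + h x) = E p g + E p h"
  using assms by (intro Bochner_Integration.integral_add) (auto intro: integrable_measure_pmf_finite)

lemma E_sum:
  fixes h :: "'b \<Rightarrow> 'a \<Rightarrow> real"
  assumes "finite_pmf p"
  shows "E p (\<lambda>x. \<Sum>i\<in>I. h i x) = (\<Sum>i\<in>I. E p (h i))"
  using assms by (intro Bochner_Integration.integral_sum) (auto intro: integrable_measure_pmf_finite)

lemma E_of_bool: "E p (\<lambda>x. of_bool (x \<in> S)) = measure_pmf.prob p S"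
proof -
  have "E p (\<lambda>x. of_bool (x \<in> S)) = E p (indicator S)"
    by (rule Bochner_Integration.integral_cong) (auto simp: indicator_def)
  then show ?thesis
    by simp
qed

lemma finite_iter_pmf:
  assumes "\<And>i a. finite_pmf (F i a)"
  shows "finite_pmf (iter_pmf m F a)"
  using assms by (induction m) auto

lemma iter_pmf_invariant:
  assumes "P 0 a" "\<And>i a b. i < m \<Longrightarrow> P i a \<Longrightarrow> b \<in> set_pmf (F i a) \<Longrightarrow> P (Suc i) b"
    and "b \<in> set_pmf (iter_pmf m F a)"
  shows "P m b"
proof -
  have "j \<le> m \<Longrightarrow> b \<in> set_pmf (iter_pmf j F a) \<Longrightarrow> P j b" for j b
  proof (induction j arbitrary: b)
    case (Suc j)
    then show ?case
      using assms(2)[of j] by auto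
  qed (use assms(1) in auto)
  then show ?thesis
    using assms(3) by blast
qed

text \<open>The function \<open>h\<close> is a martingale along the iteration, as long as the states
  satisfy \<open>P\<close>.\<close>

lemma E_iter_pmf:
  fixes h :: "'a \<Rightarrow> real"
  assumes "\<And>i a. finite_pmf (F i a)" "P a"
    and "\<And>i a b. P a \<Longrightarrow> b \<in> set_pmf (F i a) \<Longrightarrow> P b"
    and "\<And>i a. P a \<Longrightarrow> E (F i a) h = h a"
  shows "E (iter_pmf m F a) h = h a"
proof (induction m)
  case (Suc m)
  have "E (iter_pmf (Suc m) F a) h = E (iter_pmf m F a) (\<lambda>x. E (F m x) h)"
    using assms(1) by (simp add: E_bind finite_iter_pmf)
  also have "\<dots> = E (iter_pmf m F a) h"
  proof (rule E_cong)
    fix x assume "x \<in> set_pmf (iter_pmf m F a)"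
    then have "P x"
      by (rule iter_pmf_invariant[where P = "\<lambda>_. P", rotated 2]) (use assms(2,3) in blast)+
    then show "E (F m x) h = h x"
      by (rule assms(4))
  qed
  finally show ?case
    using Suc by simp
qed simp

section \<open>The random radius\<close>

lemma finite_narrow: "finite_pmf (narrow t lw)"
  by (auto simp: narrow_def split: prod.splits)

lemma narrow_cases:
  assumes "(l', w') \<in> set_pmf (narrow t (l, w))"
  obtains "l < t" "t < w" "l' = t" "w' = w" | "l < t" "t < w" "l' = l" "w' = t"
    | "\<not> (l < t \<and> t < w)" "l' = l" "w' = w"
  using assms by (auto simp: narrow_def split: if_splits)

text \<open>
  The interval \<open>[l, w)\<close> is known to contain a uniform sample, and this is the conditional
  probability that the sample is at least \<open>x\<close>.
\<close>

definition above :: "real \<Rightarrow> real \<times> real \<Rightarrow> real" where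
  "above x = (\<lambda>(l, w). if x \<le> l then 1 else if w \<le> x then 0 else (w - x) / (w - l))"

text \<open>Law of total probability: averaging over the comparison with \<open>t\<close> leaves the
  probability that the sample is at least \<open>x\<close> unchanged.\<close>

lemma E_narrow:
  assumes "fst lw \<le> snd lw"
  shows "E (narrow t lw) (above x) = above x lw"
proof -
  obtain l w where [simp]: "lw = (l, w)" by fastforce
  show ?thesis
  proof (cases "l < t \<and> t < w")
    case True
    let ?p = "(w - t) / (w - l)"
    have p: "0 \<le> ?p" "?p \<le> 1" "1 - ?p = (t - l) / (w - l)"
      using True by (auto simp: field_simps)
    have "E (narrow t lw) (above x) = ?p * above x (t, w) + (1 - ?p) * above x (l, t)"
      using True p(1,2) by (simp add: narrow_def integral_bernoulli_pmf)
    also have "\<dots> = above x (l, w)"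
    proof -
      consider "x \<le> l" | "w \<le> x" | "l < x" "x \<le> t" | "t < x" "x < w"
        by linarith
      then show ?thesis
      proof cases
        case 3
        have "above x (l, t) = (t - x) / (t - l)"
          using 3 True by (simp add: above_def)
        then have "(1 - ?p) * above x (l, t) = (t - x) / (w - l)"
          unfolding p(3) using True by simp
        then show ?thesis
          using 3 True by (simp add: above_def diff_divide_distrib[symmetric] add_divide_distrib[symmetric])
      qed (use True in \<open>simp_all add: above_def\<close>)
    qed
    finally show ?thesis by simp
  qed (auto simp: narrow_def)
qed

definition sampler :: "nat \<Rightarrow> (nat \<Rightarrow> nat \<Rightarrow> real) \<Rightarrow> real \<Rightarrow> (real \<times> real) pmf" where
  "sampler n d \<rho> = iter_pmf n (\<lambda>u. iter_pmf n (\<lambda>v. narrow (d u v))) (\<rho> / 4, \<rho> / 2)"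

lemma finite_sampler: "finite_pmf (sampler n d \<rho>)"
  unfolding sampler_def by (intro finite_iter_pmf finite_narrow)

lemma sampler_range:
  assumes "0 \<le> \<rho>" "(l, w) \<in> set_pmf (sampler n d \<rho>)"
  shows "\<rho> / 4 \<le> l" "l \<le> w" "w \<le> \<rho> / 2"
proof -
  let ?P = "\<lambda>(l, w). \<rho> / 4 \<le> l \<and> l \<le> w \<and> w \<le> \<rho> / 2"
  have step: "?P b" if "?P a" "b \<in> set_pmf (narrow t a)" for a b t
    using that by (auto elim: narrow_cases)
  have "?P (l, w)"
    using assms(2) unfolding sampler_def
    apply (rule iter_pmf_invariant[where P = "\<lambda>_. ?P", rotated 2])
    subgoal using assms(1) by simp
    subgoal for i a b
      by (rule iter_pmf_invariant[where P = "\<lambda>_. ?P"]) (use step in auto)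
    done
  then show "\<rho> / 4 \<le> l" "l \<le> w" "w \<le> \<rho> / 2"
    by auto
qed

text \<open>The comparison with \<open>d u v\<close> moves one end of the interval to this value
  unless it was not inside, and later comparisons only shrink the interval.\<close>

lemma sampler_resolved:
  assumes "u < n" "v < n" "(l, w) \<in> set_pmf (sampler n d \<rho>)"
  shows "\<not> (l < d u v \<and> d u v < w)"
proof -
  let ?P = "\<lambda>a. \<not> (fst a < d u v \<and> d u v < snd a)"
  have step: "?P b" if "?P a" "b \<in> set_pmf (narrow t a)" for a b t
    using that by (cases a; cases b) (auto elim: narrow_cases)
  have hit: "?P b" if "b \<in> set_pmf (narrow (d u v) a)" for a b
    using that by (cases a; cases b) (auto elim: narrow_cases)
  have row: "?P b" if b: "b \<in> set_pmf (iter_pmf n (\<lambda>v. narrow (d u v)) a)" for a b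
  proof -
    have "v < n \<longrightarrow> ?P b"
    proof (rule iter_pmf_invariant[where P = "\<lambda>j a. v < j \<longrightarrow> ?P a", OF _ _ b])
      fix j a' b'
      assume "v < j \<longrightarrow> ?P a'" "b' \<in> set_pmf (narrow (d u j) a')"
      then show "v < Suc j \<longrightarrow> ?P b'"
        using step[of a' b' "d u j"] hit[of b' a'] by (cases "v = j") (simp_all add: less_Suc_eq)
    qed simp
    then show ?thesis
      using assms(2) by blast
  qed
  have keep: "?P b" if "?P a" "b \<in> set_pmf (iter_pmf n (\<lambda>v. narrow (d u' v)) a)" for u' a b
    using that(2) by (rule iter_pmf_invariant[where P = "\<lambda>_. ?P", rotated 2]) (use that(1) step in blast)+
  have "u < n \<longrightarrow> ?P (l, w)"
  proof (rule iter_pmf_invariant[where P = "\<lambda>i a. u < i \<longrightarrow> ?P a", OF _ _ assms(3)[unfolded sampler_def]])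
    fix i a b
    assume "u < i \<longrightarrow> ?P a" "b \<in> set_pmf (iter_pmf n (\<lambda>v. narrow (d i v)) a)"
    then show "u < Suc i \<longrightarrow> ?P b"
      using keep[of a b i] row[of b a] by (cases "u = i") (simp_all add: less_Suc_eq)
  qed simp
  then show ?thesis
    using assms(1) by (simp del: not_less not_le)
qed

lemma E_sampler:
  assumes "0 \<le> \<rho>"
  shows "E (sampler n d \<rho>) (above x) = above x (\<rho> / 4, \<rho> / 2)"
  unfolding sampler_def
proof (rule E_iter_pmf[where P = "\<lambda>a. fst a \<le> snd a"])
  have step: "fst b \<le> snd b" if "fst a \<le> snd a" "b \<in> set_pmf (narrow t a)"
    for a b :: "real \<times> real" and t
    using that by (cases a; cases b) (auto elim: narrow_cases)
  show "fst b \<le> snd b" if "fst a \<le> snd a" "b \<in> set_pmf (iter_pmf n (\<lambda>v. narrow (d i v)) a)" for i a b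
    using that(2) by (rule iter_pmf_invariant[where P = "\<lambda>_ a. fst a \<le> snd a", rotated 2])
      (use that(1) step in blast)+
  show "E (iter_pmf n (\<lambda>v. narrow (d i v)) a) (above x) = above x a" if "fst a \<le> snd a" for i a
    by (rule E_iter_pmf[where P = "\<lambda>a. fst a \<le> snd a"])
       (use that step E_narrow finite_narrow in blast)+
qed (use assms in \<open>auto intro: finite_iter_pmf finite_narrow\<close>)

lemma radius_pmf_sampler: "radius_pmf n d \<rho> = map_pmf fst (sampler n d \<rho>)"
  by (simp add: radius_pmf_def sampler_def)

lemma finite_radius: "finite_pmf (radius_pmf n d \<rho>)"
  by (simp add: radius_pmf_sampler finite_sampler)

lemma radius_range:
  assumes "0 \<le> \<rho>" "r \<in> set_pmf (radius_pmf n d \<rho>)"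
  shows "0 \<le> r" "r \<le> \<rho> / 2"
  using assms sampler_range[OF assms(1), of _ _ n d] by (force simp: radius_pmf_sampler)+

text \<open>For a distance, the indicator of the comparison is the final value of the martingale
  \<open>above\<close>, whose initial value is a ratio of lengths in an interval of length
  \<open>\<rho> / 4\<close>. Multiplying by \<open>\<rho>\<close> avoids a division and covers
  \<open>\<rho> = 0\<close>.\<close>

lemma radius_prob:
  assumes "0 \<le> \<rho>" "u < n" "v < n"
  shows "\<rho> * E (radius_pmf n d \<rho>) (\<lambda>r. of_bool (d u v \<le> r)) =
    4 * (\<rho> / 4 - (min (d u v) (\<rho> / 2) - min (d u v) (\<rho> / 4)))"
proof -
  have "E (radius_pmf n d \<rho>) (\<lambda>r. of_bool (d u v \<le> r)) = E (sampler n d \<rho>) (\<lambda>a. of_bool (d u v \<le> fst a))"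
    by (simp add: radius_pmf_sampler)
  also have "\<dots> = E (sampler n d \<rho>) (above (d u v))"
  proof (rule E_cong)
    fix a assume "a \<in> set_pmf (sampler n d \<rho>)"
    then have "d u v \<le> fst a \<or> snd a \<le> d u v"
      using sampler_resolved[OF assms(2,3), of "fst a" "snd a" d \<rho>] by auto
    then show "of_bool (d u v \<le> fst a) = above (d u v) a"
      by (auto simp: above_def split: prod.splits)
  qed
  also have "\<dots> = above (d u v) (\<rho> / 4, \<rho> / 2)"
    by (rule E_sampler[OF assms(1)])
  finally show ?thesis
    using assms(1) by (auto simp: above_def min_def field_simps)
qed

section \<open>The random priorities\<close>

lemma finite_priority: "finite_pmf (priority_pmf k)"
  unfolding priority_pmf_def by (rule finite_iter_pmf) simp

text \<open>A number determines its last bit and the number that precedes it, so each new bit halves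
  all probabilities.\<close>

lemma priority_pmf_uniform:
  "priority_pmf k = pmf_of_set {2 ^ k..<2 ^ Suc k}"
proof (rule pmf_eqI)
  fix y
  have "pmf (priority_pmf k) y = (if y \<in> {2 ^ k..<2 ^ Suc k} then 1 / 2 ^ k else 0)"
  proof (induction k arbitrary: y)
    case 0
    show ?case by (auto simp: priority_pmf_def indicator_def)
  next
    case (Suc k)
    have *: "pmf (map_pmf (\<lambda>b. g + g + (if b then 1 else 0)) (bernoulli_pmf (1 / 2))) y =
        (if g = y div 2 then 1 / 2 else 0)" for g
    proof -
      have "pmf (map_pmf (\<lambda>b. g + g + (if b then 1 else 0)) (bernoulli_pmf (1 / 2))) y =
          measure_pmf.prob (bernoulli_pmf (1 / 2)) {b. g + g + (if b then 1 else 0) = y}"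
        by (simp add: pmf_map vimage_def)
      also have "{b. g + g + (if b then 1 else 0) = y} = (if g = y div 2 then {odd y} else {})"
        by (auto split: if_splits) presburger+
      finally show ?thesis
        by (auto simp: measure_pmf_single)
    qed
    have "pmf (priority_pmf (Suc k)) y = E (priority_pmf k) (\<lambda>g. if g = y div 2 then 1 / 2 else 0)"
      unfolding priority_pmf_def by (simp add: pmf_bind * priority_pmf_def[symmetric])
    also have "\<dots> = pmf (priority_pmf k) (y div 2) / 2"
      by (subst integral_measure_pmf_real[of "{y div 2}"]) (auto split: if_splits)
    also have "\<dots> = (if y \<in> {2 ^ Suc k..<2 ^ Suc (Suc k)} then 1 / 2 ^ Suc k else 0)"
      by (auto simp: Suc)
    finally show ?case .
  qed
  then show "pmf (priority_pmf k) y = pmf (pmf_of_set {2 ^ k..<2 ^ Suc k}) y"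
    by (subst pmf_of_set) (auto simp: indicator_def)
qed

lemma set_priority: "set_pmf (priority_pmf k) = {2 ^ k..<2 ^ Suc k}"
  unfolding priority_pmf_uniform by (rule set_pmf_of_set) auto

text \<open>Makes the independence of the array entries available, for the priorities as well as for
  the marks.\<close>

lemma iter_pmf_Pi:
  "iter_pmf n (\<lambda>u g. map_pmf (\<lambda>x. g(u := x)) (p u)) (\<lambda>_. x0) = Pi_pmf {..<n} x0 p"
proof (induction n)
  case (Suc n)
  have "iter_pmf (Suc n) (\<lambda>u g. map_pmf (\<lambda>x. g(u := x)) (p u)) (\<lambda>_. x0) =
      bind_pmf (Pi_pmf {..<n} x0 p) (\<lambda>g. bind_pmf (p n) (\<lambda>x. return_pmf (g(n := x))))"
    unfolding iter_pmf.simps(2) Suc unfolding map_pmf_def by (rule refl)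
  also have "\<dots> = bind_pmf (p n) (\<lambda>x. bind_pmf (Pi_pmf {..<n} x0 p) (\<lambda>g. return_pmf (g(n := x))))"
    by (rule bind_commute_pmf)
  also have "\<dots> = Pi_pmf {..<Suc n} x0 p"
    by (simp add: lessThan_Suc Pi_pmf_insert')
  finally show ?case .
qed simp

lemma priorities_pmf_Pi: "priorities_pmf n k = Pi_pmf {..<n} 0 (\<lambda>_. priority_pmf k)"
  unfolding priorities_pmf_def by (rule iter_pmf_Pi)

lemma finite_priorities: "finite_pmf (priorities_pmf n k)"
  unfolding priorities_pmf_def by (intro finite_iter_pmf) (simp add: finite_priority)

lemma priorities_support:
  assumes "g \<in> set_pmf (priorities_pmf n k)"
  shows "u < n \<Longrightarrow> 0 < g u" "g n = 0"
proof -
  have "g \<in> PiE_dflt {..<n} 0 (\<lambda>_. {2 ^ k..<2 ^ Suc k})"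
    using assms by (simp add: priorities_pmf_Pi set_Pi_pmf set_priority o_def)
  then show "u < n \<Longrightarrow> 0 < g u" "g n = 0"
    by (auto simp: PiE_dflt_def intro: less_le_trans[of 0 "2 ^ k"])
qed

text \<open>Comparison of the sum with the integral of \<open>x ^ (s - 1)\<close> in discrete form:
  the differences of consecutive \<open>s\<close>-th powers telescope.\<close>

lemma power_sum_le:
  fixes M s :: nat
  shows "real s * (\<Sum>q = 1..M. real q ^ (s - 1)) \<le> real (M + 1) ^ s"
proof (induction M)
  case (Suc M)
  show ?case
  proof (cases s)
    case (Suc t)
    have "real s * real (M + 1) ^ t \<le> real (M + 2) ^ s - real (M + 1) ^ s"
    proof -
      have "real (M + 2) ^ Suc t - real (M + 1) ^ Suc t = (\<Sum>p<Suc t. real (M + 2) ^ p * real (M + 1) ^ (t - p))"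
        by (subst power_diff_sumr2) (simp add: mult.commute)
      also have "\<dots> \<ge> (\<Sum>p<Suc t. real (M + 1) ^ p * real (M + 1) ^ (t - p))"
        by (intro sum_mono mult_right_mono power_mono) auto
      also have "(\<Sum>p<Suc t. real (M + 1) ^ p * real (M + 1) ^ (t - p)) = (\<Sum>p<Suc t. real (M + 1) ^ t)"
        by (intro sum.cong refl) (simp add: power_add[symmetric])
      finally show ?thesis
        using Suc by simp
    qed
    then show ?thesis
      using Suc.IH Suc by (simp add: algebra_simps)
  qed simp
qed simp

text \<open>For a random permutation the probability would be \<open>1 / card B\<close>. Ties are
  possible here and cost a factor \<open>(1 + 1 / M) ^ s\<close>, which is at most 3 because
  \<open>s \<le> n \<le> M = 2 ^ k\<close>.\<close>

lemma priorities_top: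
  assumes "B \<subseteq> {..<n}" "u \<in> B" "n \<le> 2 ^ k"
  shows "E (priorities_pmf n k) (\<lambda>g. of_bool (\<forall>w\<in>B. g w \<le> g u)) \<le> 3 / real (card B)"
proof -
  define M :: nat where "M = 2 ^ k"
  define A where "A = {..<n} - {u}"
  define P where "P = Pi_pmf A 0 (\<lambda>_. priority_pmf k)"
  define s where "s = card B"
  have fin: "finite B"
    using assms(1) finite_subset by blast
  then have s: "1 \<le> s" "s \<le> n"
    using assms(2) card_mono[OF _ assms(1)] by (auto simp: s_def Suc_le_eq card_gt_0_iff)
  have A: "{..<n} = insert u A" "finite A" "u \<notin> A"
    using assms(1,2) by (auto simp: A_def)
  have split: "priorities_pmf n k =
      bind_pmf (priority_pmf k) (\<lambda>y. map_pmf (\<lambda>g. g(u := y)) P)"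
    unfolding priorities_pmf_Pi P_def A(1) map_pmf_def by (rule Pi_pmf_insert'[OF A(2,3)])
  have finP: "finite_pmf P"
    unfolding P_def using A(2) by (simp add: set_Pi_pmf finite_PiE_dflt finite_priority o_def)
  \<comment> \<open>Given the priority \<open>y\<close> of \<open>u\<close>, the others are
    independent, and each of them is at most \<open>y\<close> with probability
    \<open>(y + 1 - M) / M\<close>.\<close>
  have top: "E P (\<lambda>g. of_bool (\<forall>w\<in>B. (g(u := y)) w \<le> y)) = (real (y + 1 - M) / M) ^ (s - 1)"
    if y: "y \<in> {M..<2 * M}" for y
  proof -
    have "E P (\<lambda>g. of_bool (\<forall>w\<in>B. (g(u := y)) w \<le> y)) =
        measure_pmf.prob P (Pi A (\<lambda>w. if w \<in> B then {..y} else UNIV))"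
      unfolding E_of_bool[symmetric] using assms(1)
      by (intro E_cong arg_cong[of _ _ of_bool]) (auto simp: A_def Pi_def)
    also have "\<dots> = (\<Prod>w\<in>A. measure_pmf.prob (priority_pmf k) (if w \<in> B then {..y} else UNIV))"
      unfolding P_def by (rule measure_Pi_pmf_Pi) (simp add: A_def)
    also have "\<dots> = (\<Prod>w\<in>A. if w \<in> B then measure_pmf.prob (priority_pmf k) {..y} else 1)"
      by (intro prod.cong) auto
    also have "\<dots> = measure_pmf.prob (priority_pmf k) {..y} ^ card (A \<inter> B)"
      by (simp add: prod.If_cases A_def)
    also have "A \<inter> B = B - {u}"
      using assms(1) by (auto simp: A_def)
    also have "card (B - {u}) = s - 1"
      using assms(2) fin by (simp add: s_def)
    also have "measure_pmf.prob (priority_pmf k) {..y} = real (card ({2 ^ k..<2 ^ Suc k} \<inter> {..y})) / real (card {2 ^ k..<2 ^ Suc k :: nat})"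
      unfolding priority_pmf_uniform by (rule measure_pmf_of_set) auto
    also have "{2 ^ k..<2 ^ Suc k} \<inter> {..y} = {M..<y + 1}"
      using y by (auto simp: M_def)
    finally show ?thesis
      by (simp add: M_def)
  qed
  have "E (priorities_pmf n k) (\<lambda>g. of_bool (\<forall>w\<in>B. g w \<le> g u)) =
      E (priority_pmf k) (\<lambda>y. E P (\<lambda>g. of_bool (\<forall>w\<in>B. (g(u := y)) w \<le> y)))"
    unfolding split by (subst E_bind) (auto simp: finite_priority finP)
  also have "\<dots> = E (priority_pmf k) (\<lambda>y. (real (y + 1 - M) / M) ^ (s - 1))"
    by (intro E_cong top) (simp add: set_priority M_def)
  also have "\<dots> = (\<Sum>y\<in>{M..<2 * M}. (real (y + 1 - M) / M) ^ (s - 1)) / M"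
    unfolding priority_pmf_uniform by (subst integral_pmf_of_set) (auto simp: M_def)
  also have "(\<Sum>y\<in>{M..<2 * M}. (real (y + 1 - M) / M) ^ (s - 1)) = (\<Sum>q = 1..M. (real q / M) ^ (s - 1))"
    by (rule sum.reindex_bij_witness[of _ "\<lambda>q. q + M - 1" "\<lambda>y. y + 1 - M"]) auto
  also have "\<dots> / M = (\<Sum>q = 1..M. real q ^ (s - 1)) / M ^ s"
    using s(1) by (cases s) (simp_all add: power_divide sum_divide_distrib[symmetric])
  also have "\<dots> \<le> (real (M + 1) ^ s / s) / M ^ s"
    using power_sum_le[of s M] s(1) by (intro divide_right_mono) (simp_all add: field_simps)
  also have "\<dots> = (1 + 1 / M) ^ s / s"
  proof -
    have "1 + 1 / real M = real (M + 1) / real M"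
      by (simp add: M_def add_divide_distrib)
    then show ?thesis
      by (simp add: power_divide)
  qed
  also have "\<dots> \<le> 3 / s"
  proof (intro divide_right_mono)
    have "(1 + 1 / M) ^ s \<le> (1 + 1 / real M) ^ M"
      using s assms(3) by (intro power_increasing) (auto simp: M_def)
    also have "\<dots> \<le> exp (1 / real M) ^ M"
      by (intro power_mono) auto
    also have "\<dots> = exp 1"
      by (simp add: exp_of_nat_mult[symmetric] M_def)
    also have "\<dots> \<le> 3"
      by (rule exp_le)
    finally show "(1 + 1 / M) ^ s \<le> 3" by simp
  qed simp
  finally show ?thesis by (simp add: s_def)
qed

section \<open>The random partition\<close>

definition partition_pmf :: "nat \<Rightarrow> (nat \<Rightarrow> nat \<Rightarrow> real) \<Rightarrow> nat \<Rightarrow> real \<Rightarrow> (nat \<Rightarrow> nat) pmf" where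
  "partition_pmf n d k \<rho> =
     bind_pmf (radius_pmf n d \<rho>) (\<lambda>r. map_pmf (center n d r) (priorities_pmf n k))"

text \<open>Separates the part of a level that ignores the clients from the marks, the only place
  where they enter.\<close>

lemma level_pmf_partition:
  "level_pmf n d N k \<rho> a z s = bind_pmf (partition_pmf n d k \<rho>) (\<lambda>c.
     map_pmf (update n s (child n s c)) (marks_pmf n k a z (weight n N (snd s) (child n s c))))"
  by (simp add: level_pmf_def partition_pmf_def bind_assoc_pmf bind_map_pmf Let_def)

lemma finite_partition: "finite_pmf (partition_pmf n d k \<rho>)"
  by (simp add: partition_pmf_def finite_radius finite_priorities)

lemma winner_best:
  assumes "g n = 0" "\<And>u. u < n \<Longrightarrow> 0 < g u" "m \<le> n" "u < m" "X u"
  shows "X (winner n X g m)" "winner n X g m < m"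
    "g u < g (winner n X g m) \<or> g u = g (winner n X g m) \<and> winner n X g m \<le> u"
proof -
  have "(\<forall>u<m. \<not> X u) \<and> winner n X g m = n \<or>
      X (winner n X g m) \<and> winner n X g m < m \<and>
      (\<forall>u<m. X u \<longrightarrow> g u < g (winner n X g m) \<or> g u = g (winner n X g m) \<and> winner n X g m \<le> u)"
    using assms(3)
  proof (induction m)
    case (Suc m)
    then have IH: "(\<forall>u<m. \<not> X u) \<and> winner n X g m = n \<or>
      X (winner n X g m) \<and> winner n X g m < m \<and>
      (\<forall>u<m. X u \<longrightarrow> g u < g (winner n X g m) \<or> g u = g (winner n X g m) \<and> winner n X g m \<le> u)"
      by simp
    show ?case
    proof (cases "X m \<and> g (winner n X g m) < g m")
      case True
      then show ?thesis
        using IH by (fastforce simp: less_Suc_eq)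
    next
      case False
      then show ?thesis
        using IH assms(1) assms(2)[of m] Suc.prems by (auto simp: less_Suc_eq not_less)
    qed
  qed simp
  then show "X (winner n X g m)" "winner n X g m < m"
    "g u < g (winner n X g m) \<or> g u = g (winner n X g m) \<and> winner n X g m \<le> u"
    using assms(4,5) by auto
qed

text \<open>If the ball around \<open>u\<close> reaches \<open>v\<close> or \<open>w\<close>, so do
  the balls of the same radius around all these points; \<open>u\<close> can separate the pair only
  by beating them.\<close>

definition nearer :: "nat \<Rightarrow> (nat \<Rightarrow> nat \<Rightarrow> real) \<Rightarrow> nat \<Rightarrow> nat \<Rightarrow> nat \<Rightarrow> nat set" where
  "nearer n d v w u = {x. x < n \<and> min (d x v) (d x w) \<le> min (d u v) (d u w)}"

text \<open>Of the two centers, the one of higher priority separates. It is out of reach for the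
  other point, which would have preferred it, and every point of \<open>nearer\<close> competes for
  \<open>v\<close> or \<open>w\<close> and so loses to it.\<close>

lemma center_separation:
  assumes g: "g n = 0" "\<And>u. u < n \<Longrightarrow> 0 < g u"
    and r: "0 \<le> r" and d: "d v v = 0" "d w w = 0" and vw: "v < n" "w < n"
    and neq: "center n d r g v \<noteq> center n d r g w"
  shows "\<exists>u<n. min (d u v) (d u w) \<le> r \<and> r < max (d u v) (d u w) \<and> (\<forall>x\<in>nearer n d v w u. g x \<le> g u)"
proof -
  define cv where "cv = center n d r g v"
  define cw where "cw = center n d r g w"
  have v: "cv < n" "d cv v \<le> r"
      "\<And>u. u < n \<Longrightarrow> d u v \<le> r \<Longrightarrow> g u < g cv \<or> g u = g cv \<and> cv \<le> u"
    using winner_best[where X = "\<lambda>u. d u v \<le> r" and g = g and n = n and m = n] g r d vw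
    unfolding cv_def center_def by (metis order_refl)+
  have w: "cw < n" "d cw w \<le> r"
      "\<And>u. u < n \<Longrightarrow> d u w \<le> r \<Longrightarrow> g u < g cw \<or> g u = g cw \<and> cw \<le> u"
    using winner_best[where X = "\<lambda>u. d u w \<le> r" and g = g and n = n and m = n] g r d vw
    unfolding cw_def center_def by (metis order_refl)+
  \<comment> \<open>The situation is symmetric in \<open>v\<close> and \<open>w\<close>; here the
    center of \<open>v\<close> is the better one.\<close>
  have one: "\<exists>u<n. min (d u v) (d u w) \<le> r \<and> r < max (d u v) (d u w) \<and> (\<forall>x\<in>nearer n d v w u. g x \<le> g u)"
    if v: "cv < n" "d cv v \<le> r" "\<And>u. u < n \<Longrightarrow> d u v \<le> r \<Longrightarrow> g u < g cv \<or> g u = g cv \<and> cv \<le> u"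
      and w: "\<And>u. u < n \<Longrightarrow> d u w \<le> r \<Longrightarrow> g u < g cw \<or> g u = g cw \<and> cw \<le> u"
      and ord: "cv \<noteq> cw" "g cw < g cv \<or> g cw = g cv \<and> cv \<le> cw" for v w cv cw
  proof (intro exI[of _ cv] conjI ballI)
    show "cv < n" "min (d cv v) (d cv w) \<le> r"
      using v by auto
    show "r < max (d cv v) (d cv w)"
      using w[OF v(1)] ord by (auto simp: less_max_iff_disj)
    fix x assume "x \<in> nearer n d v w cv"
    then have "x < n" "d x v \<le> r \<or> d x w \<le> r"
      using v(2) by (auto simp: nearer_def)
    then show "g x \<le> g cv"
      using v(3)[of x] w[of x] ord(2) by auto
  qed
  have ne: "cv \<noteq> cw"
    using neq by (simp add: cv_def cw_def)
  consider "g cw < g cv \<or> g cw = g cv \<and> cv \<le> cw" | "g cv < g cw \<or> g cv = g cw \<and> cw \<le> cv"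
    by linarith
  then show ?thesis
  proof cases
    case 1
    show ?thesis
      by (rule one[OF v w(3) ne 1])
  next
    case 2
    have "nearer n d w v = nearer n d v w"
      by (auto simp: nearer_def fun_eq_iff min.commute)
    then show ?thesis
      using one[where v = w and w = v and cv = cw and cw = cv, OF w v(3) ne[symmetric] 2] by (simp add: min.commute max.commute)
  qed
qed

lemma center_ball:
  assumes g: "g n = 0" "\<And>u. u < n \<Longrightarrow> 0 < g u"
    and "0 \<le> r" "d v v = 0" "v < n"
  shows "center n d r g v < n" "d (center n d r g v) v \<le> r"
  using winner_best[where X = "\<lambda>u. d u v \<le> r" and g = g and n = n and m = n] assms
  unfolding center_def by (metis order_refl)+

lemma partition_ball:
  assumes "0 \<le> \<rho>" "d v v = 0" "v < n" "c \<in> set_pmf (partition_pmf n d k \<rho>)"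
  shows "c v < n" "d (c v) v \<le> \<rho> / 2"
proof -
  obtain r g where r: "r \<in> set_pmf (radius_pmf n d \<rho>)" and g: "g \<in> set_pmf (priorities_pmf n k)"
    and c: "c = center n d r g"
    using assms(4) by (auto simp: partition_pmf_def)
  show "c v < n" "d (c v) v \<le> \<rho> / 2"
    using center_ball[of g n r d v] priorities_support[OF g] radius_range[OF assms(1) r] assms(2,3)
    unfolding c by force+
qed

text \<open>
  Up to the weights \<open>3 / card\<close>, which come from the priorities, this is four times the total
  length of the parts below \<open>\<rho> / 4\<close> of the intervals of radii that separate \<open>v\<close> from \<open>w\<close>.
  A level of scale \<open>\<rho>\<close> uses radii in \<open>[\<rho> / 4, \<rho> / 2]\<close>, so that its contribution is
  a difference of two values and the sum over the levels telescopes.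
\<close>

definition stretch :: "nat \<Rightarrow> (nat \<Rightarrow> nat \<Rightarrow> real) \<Rightarrow> nat \<Rightarrow> nat \<Rightarrow> real \<Rightarrow> real" where
  "stretch n d v w \<rho> = (\<Sum>u<n. 3 / real (card (nearer n d v w u)) *
     (4 * (min (max (d u v) (d u w)) (\<rho> / 4) - min (min (d u v) (d u w)) (\<rho> / 4))))"

text \<open>Union bound over the separating center. Radius and priorities are independent, so each
  center contributes a length of radii times the probability of beating the points nearer to the
  pair.\<close>

lemma separation_prob:
  assumes d: "\<And>v. v < n \<Longrightarrow> d v v = 0" and \<rho>: "0 \<le> \<rho>" and vw: "v < n" "w < n" and k: "n \<le> 2 ^ k"
  shows "\<rho> * E (partition_pmf n d k \<rho>) (\<lambda>c. of_bool (c v \<noteq> c w)) \<le>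
    stretch n d v w (2 * \<rho>) - stretch n d v w \<rho>"
proof -
  let ?R = "radius_pmf n d \<rho>" and ?G = "priorities_pmf n k"
  define sep where "sep u r = (of_bool (min (d u v) (d u w) \<le> r \<and> r < max (d u v) (d u w)) :: real)" for u r
  define top where "top u g = (of_bool (\<forall>x\<in>nearer n d v w u. g x \<le> g u) :: real)" for u :: nat and g :: "nat \<Rightarrow> nat"
  note fin = finite_radius finite_priorities
  have "E (partition_pmf n d k \<rho>) (\<lambda>c. of_bool (c v \<noteq> c w)) =
      E ?R (\<lambda>r. E ?G (\<lambda>g. of_bool (center n d r g v \<noteq> center n d r g w)))"
    unfolding partition_pmf_def by (subst E_bind) (simp_all add: fin)
  also have "\<dots> \<le> E ?R (\<lambda>r. E ?G (\<lambda>g. \<Sum>u<n. sep u r * top u g))"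
  proof (intro E_mono fin)
    fix r g assume rg: "r \<in> set_pmf ?R" "g \<in> set_pmf ?G"
    show "of_bool (center n d r g v \<noteq> center n d r g w) \<le> (\<Sum>u<n. sep u r * top u g)"
    proof (cases "center n d r g v = center n d r g w")
      case True
      then show ?thesis
        by (simp add: sum_nonneg sep_def top_def)
    next
      case False
      then obtain u where u: "u < n" "sep u r * top u g = 1"
        using center_separation[of g n r d v w] priorities_support[OF rg(2)] radius_range[OF \<rho> rg(1)] d[OF vw(1)] d[OF vw(2)] vw
        by (force simp: sep_def top_def)
      have "sep u r * top u g \<le> (\<Sum>u<n. sep u r * top u g)"
        by (rule member_le_sum) (use u(1) in \<open>auto simp: sep_def top_def\<close>)
      then show ?thesis
        using u(2) by simp
    qed
  qed
  also have "\<dots> = (\<Sum>u<n. E ?R (sep u) * E ?G (top u))"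
    by (simp add: E_sum fin)
  finally have "\<rho> * E (partition_pmf n d k \<rho>) (\<lambda>c. of_bool (c v \<noteq> c w)) \<le>
      (\<Sum>u<n. (\<rho> * E ?R (sep u)) * E ?G (top u))"
    using \<rho> by (simp add: mult_left_mono mult.assoc sum_distrib_left[symmetric])
  also have "\<dots> \<le> (\<Sum>u<n. (\<rho> * E ?R (sep u)) * (3 / real (card (nearer n d v w u))))"
    using \<rho> unfolding top_def
    by (intro sum_mono mult_left_mono priorities_top k) (auto simp: nearer_def sep_def intro!: mult_nonneg_nonneg integral_nonneg_AE)
  also have "\<dots> = stretch n d v w (2 * \<rho>) - stretch n d v w \<rho>"
  proof -
    \<comment> \<open>Separation by \<open>u\<close> is the difference of two one-sided comparisons
      of the radius.\<close>
    have sep: "\<rho> * E ?R (sep u) = 4 * (min (max (d u v) (d u w)) (\<rho> / 2) - min (max (d u v) (d u w)) (\<rho> / 4)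
        - (min (min (d u v) (d u w)) (\<rho> / 2) - min (min (d u v) (d u w)) (\<rho> / 4)))" if u: "u < n" for u
    proof -
      obtain a b where ab: "a < n" "b < n" "min (d u v) (d u w) = d u a" "max (d u v) (d u w) = d u b" "d u a \<le> d u b"
        using vw by (metis max_def min_def nle_le)
      have "E ?R (\<lambda>r. of_bool (d u a \<le> r)) = E ?R (\<lambda>r. sep u r + of_bool (d u b \<le> r))"
        using ab by (intro E_cong) (auto simp: sep_def)
      also have "\<dots> = E ?R (sep u) + E ?R (\<lambda>r. of_bool (d u b \<le> r))"
        by (rule E_add[OF finite_radius])
      finally have "\<rho> * E ?R (sep u) = \<rho> * E ?R (\<lambda>r. of_bool (d u a \<le> r)) - \<rho> * E ?R (\<lambda>r. of_bool (d u b \<le> r))"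
        by (simp add: algebra_simps)
      then show ?thesis
        using radius_prob[OF \<rho> u ab(1), of d] radius_prob[OF \<rho> u ab(2), of d] ab by simp
    qed
    show ?thesis
      unfolding stretch_def sum_subtractf[symmetric]
      by (intro sum.cong refl) (simp add: sep algebra_simps)
  qed
  finally show ?thesis .
qed

text \<open>In the order of the keys the \<open>j\<close>-th point has rank at least
  \<open>j\<close>, and ties only increase ranks. The induction removes a point of maximal key,
  whose rank is \<open>card A\<close>.\<close>

lemma sum_inverse_rank:
  fixes key :: "'a \<Rightarrow> real"
  assumes "finite A"
  shows "(\<Sum>u\<in>A. 1 / real (card {w \<in> A. key w \<le> key u})) \<le> harm (card A)"
  using assms
proof (induction "card A" arbitrary: A)
  case (Suc m)
  then have "A \<noteq> {}" by auto
  then obtain x where x: "x \<in> A" "\<And>y. y \<in> A \<Longrightarrow> key y \<le> key x"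
    using Suc.prems Max_in[of "key ` A"] Max_ge[of "key ` A"] by fastforce
  have A: "{w \<in> A. key w \<le> key x} = A"
    using x by auto
  have "(\<Sum>u\<in>A. 1 / real (card {w \<in> A. key w \<le> key u})) =
      1 / card A + (\<Sum>u\<in>A - {x}. 1 / real (card {w \<in> A. key w \<le> key u}))"
    using Suc.prems x(1) by (simp add: sum.remove[of A x] A)
  also have "(\<Sum>u\<in>A - {x}. 1 / real (card {w \<in> A. key w \<le> key u})) \<le>
      (\<Sum>u\<in>A - {x}. 1 / real (card {w \<in> A - {x}. key w \<le> key u}))"
  proof (intro sum_mono divide_left_mono)
    fix u assume u: "u \<in> A - {x}"
    have fin: "finite {w \<in> A. key w \<le> key u}" "finite {w \<in> A - {x}. key w \<le> key u}"
      using Suc.prems by auto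
    show "real (card {w \<in> A - {x}. key w \<le> key u}) \<le> real (card {w \<in> A. key w \<le> key u})"
      using fin by (auto intro!: card_mono)
    have "0 < card {w \<in> A. key w \<le> key u}" "0 < card {w \<in> A - {x}. key w \<le> key u}"
      using fin u unfolding card_gt_0_iff by auto
    then show "0 < real (card {w \<in> A. key w \<le> key u}) * real (card {w \<in> A - {x}. key w \<le> key u})"
      by simp
  qed simp
  also have "\<dots> \<le> harm (card (A - {x}))"
    by (rule Suc.hyps(1)) (use Suc x in auto)
  also have "1 / real (card A) + harm (card (A - {x})) = harm (card A)"
    using Suc.prems Suc.hyps(2)[symmetric] x(1) by (simp add: harm_Suc inverse_eq_divide)
  finally show ?case
    by simp
qed (simp add: harm_def)

text \<open>By the triangle inequality each center contributes an interval of length at most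
  \<open>d v w\<close>, and the inverse ranks sum to at most a harmonic number; 12 is the product of
  the constants 3 and 4 in \<open>stretch\<close>.\<close>

lemma stretch_bound:
  assumes "Metric_space {..<n} d" "v < n" "w < n"
  shows "stretch n d v w \<rho> \<le> 12 * harm n * d v w" "0 \<le> stretch n d v w \<rho>"
proof -
  interpret Metric_space "{..<n}" d by fact
  have len: "min (max x y) t - min (min x y) t \<le> \<bar>x - y\<bar>" "0 \<le> min (max x y) t - min (min x y) t" for x y t :: real
    by auto
  have tri: "\<bar>d u v - d u w\<bar> \<le> d v w" if "u < n" for u
    using triangle[of u v w] triangle[of u w v] that assms(2,3) commute[of v w] by auto
  have "stretch n d v w \<rho> \<le> (\<Sum>u<n. 3 / real (card (nearer n d v w u)) * (4 * d v w))"
    unfolding stretch_def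
  proof (intro sum_mono mult_left_mono)
    fix u assume "u \<in> {..<n}"
    then show "min (max (d u v) (d u w)) (\<rho> / 4) - min (min (d u v) (d u w)) (\<rho> / 4) \<le> d v w"
      using len(1)[of "d u v" "d u w"] tri[of u] order_trans by blast
  qed auto
  also have "\<dots> = 12 * d v w * (\<Sum>u<n. 1 / real (card {x \<in> {..<n}. min (d x v) (d x w) \<le> min (d u v) (d u w)}))"
    by (simp add: nearer_def sum_distrib_left)
  also have "\<dots> \<le> 12 * d v w * harm (card {..<n})"
    by (intro mult_left_mono sum_inverse_rank) (auto intro: nonneg)
  finally show "stretch n d v w \<rho> \<le> 12 * harm n * d v w"
    by (simp add: mult_ac)
  show "0 \<le> stretch n d v w \<rho>"
    unfolding stretch_def by (intro sum_nonneg mult_nonneg_nonneg) (use len(2) in auto)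
qed

section \<open>One level\<close>

definition core :: "nat \<Rightarrow> state \<Rightarrow> nat set" where
  "core n s = {v. v < n \<and> snd s v}"

lemma finite_core [simp]: "finite (core n s)"
  by (simp add: core_def)

text \<open>By the last condition a bound on the core diameters also bounds the distance from a core
  point to its facility.\<close>

definition well_formed :: "nat \<Rightarrow> state \<Rightarrow> bool" where
  "well_formed n s \<longleftrightarrow>
     (\<forall>v<n. fst s v < n \<and> fst s (fst s v) = fst s v \<and> (snd s v \<longrightarrow> snd s (fst s v)))"

lemma least_below_spec:
  assumes "X v"
  shows "X (least_below v X m)" "u < m \<Longrightarrow> X u \<Longrightarrow> least_below v X m \<le> u"
proof -
  have "X (least_below v X m) \<and> (\<forall>u<m. X u \<longrightarrow> least_below v X m \<le> u)"
    using assms by (induction m) (auto simp: less_Suc_eq)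
  then show "X (least_below v X m)" "u < m \<Longrightarrow> X u \<Longrightarrow> least_below v X m \<le> u"
    by auto
qed

lemma child_core:
  assumes "v \<in> core n s"
  shows "child n s c v \<in> core n s" "fst s (child n s c v) = fst s v" "c (child n s c v) = c v"
  using least_below_spec(1)[of "\<lambda>u. snd s u \<and> fst s u = fst s v \<and> c u = c v" v n] assms
    child_le[of n s c v]
  by (auto simp: core_def child_def)

lemma child_eq_iff:
  assumes v: "v \<in> core n s" and w: "w \<in> core n s"
  shows "child n s c v = child n s c w \<longleftrightarrow> fst s v = fst s w \<and> c v = c w"
proof
  assume "child n s c v = child n s c w"
  then show "fst s v = fst s w \<and> c v = c w"
    using child_core(2,3)[OF v, of c] child_core(2,3)[OF w, of c] by metis
next
  assume eq: "fst s v = fst s w \<and> c v = c w"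
  have le: "child n s c v \<le> child n s c w"
    if "v \<in> core n s" "w \<in> core n s" "fst s v = fst s w \<and> c v = c w" for v w
    unfolding child_def[of n s c v]
    by (rule least_below_spec(2)) (use that child_core[OF that(2), of c] in \<open>auto simp: core_def\<close>)
  show "child n s c v = child n s c w"
    using le[OF v w eq] le[OF w v] eq by force
qed

lemma target_cases:
  obtains v where "v < m" "snd s v" "h (q v)" "fst s v = l" "target n s q h m l = q v"
  | "\<And>v. v < m \<Longrightarrow> snd s v \<Longrightarrow> fst s v = l \<Longrightarrow> \<not> h (q v)" "target n s q h m l = n"
proof -
  have "(\<exists>v<m. snd s v \<and> h (q v) \<and> fst s v = l \<and> target n s q h m l = q v) \<or>
    (\<forall>v<m. snd s v \<longrightarrow> fst s v = l \<longrightarrow> \<not> h (q v)) \<and> target n s q h m l = n"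
  proof (induction m)
    case (Suc m)
    then show ?case
      by (cases "snd s m \<and> h (q m) \<and> fst s m = l") (auto simp: less_Suc_eq)
  qed simp
  then show ?thesis
    using that by blast
qed

text \<open>One level with the outcomes \<open>c\<close> of the partition and \<open>h\<close> of
  the marks fixed, so that everything here is deterministic.\<close>

locale level_step =
  fixes n :: nat and s :: state and c :: "nat \<Rightarrow> nat" and h :: "nat \<Rightarrow> bool"
  assumes wf: "well_formed n s"
begin

abbreviation "A \<equiv> fst s"
abbreviation "q \<equiv> child n s c"
abbreviation "s' \<equiv> update n s q h"

lemma q_less: "v < n \<Longrightarrow> q v < n"
  using child_le[of n s c v] by simp

lemma A_less: "v < n \<Longrightarrow> A v < n" and A_A: "v < n \<Longrightarrow> A (A v) = A v"
  and A_core: "v \<in> core n s \<Longrightarrow> A v \<in> core n s"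
  using wf by (auto simp: well_formed_def core_def)

lemma q_q: "v \<in> core n s \<Longrightarrow> q (q v) = q v"
  using child_core[of v n s c] by (subst child_eq_iff) auto

lemma core_update: "core n s' = {v \<in> core n s. h (q v)}"
  by (auto simp: core_def update_def)

lemma update_marked: "v \<in> core n s' \<Longrightarrow> fst s' v = q v"
  by (auto simp: core_def update_def)

lemma update_unmarked:
  assumes "v < n" "v \<notin> core n s'"
  obtains w where "w \<in> core n s'" "A w = A v" "fst s' v = q w"
  | "\<And>w. w \<in> core n s' \<Longrightarrow> A w \<noteq> A v" "fst s' v = A v"
proof (cases rule: target_cases[of n s h q "A v" n])
  case (1 w)
  then have "w \<in> core n s'" "fst s' v = q w"
    using assms q_less[of w] by (auto simp: core_def update_def)
  then show ?thesis
    using 1 that(1) by blast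
next
  case 2
  then have "\<And>w. w \<in> core n s' \<Longrightarrow> A w \<noteq> A v" "fst s' v = A v"
    using assms by (auto simp: core_def update_def)
  then show ?thesis
    using that(2) by blast
qed

lemma update_cases:
  assumes "v < n"
  obtains w where "w \<in> core n s'" "A w = A v" "fst s' v = q w" "v \<in> core n s' \<Longrightarrow> w = v"
  | "\<And>w. w \<in> core n s' \<Longrightarrow> A w \<noteq> A v" "fst s' v = A v" "v \<notin> core n s'"
  using assms update_marked update_unmarked[OF assms] by (cases "v \<in> core n s'") metis+

lemma q_core_update: "w \<in> core n s' \<Longrightarrow> q w \<in> core n s'"
  using child_core[of w n s c] q_q[of w] by (auto simp: core_update)

lemma well_formed_update: "well_formed n s'"
  unfolding well_formed_def
proof (intro allI impI)
  fix v assume v: "v < n"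
  show "fst s' v < n \<and> fst s' (fst s' v) = fst s' v \<and> (snd s' v \<longrightarrow> snd s' (fst s' v))"
  proof (cases rule: update_cases[OF v])
    case (1 w)
    then have "q w \<in> core n s'" "q (q w) = q w"
      using q_core_update[of w] q_q[of w] by (auto simp: core_update)
    then show ?thesis
      using 1(3) update_marked[of "q w"] by (auto simp: core_def)
  next
    case 2
    have "fst s' (A v) = A v"
      by (rule update_cases[OF A_less[OF v]]) (use 2 A_A[OF v] in auto)
    then show ?thesis
      using 2 v A_less[OF v] by (auto simp: core_def)
  qed
qed

text \<open>Wherever a point may still be moved now, it could already have been moved from its old
  group; hence \<open>reach\<close> does not increase.\<close>

lemma update_group:
  assumes "v < n"
  shows "insert (fst s' v) {w \<in> core n s'. fst s' w = fst s' v} \<subseteq> insert (A v) {w \<in> core n s. A w = A v}"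
proof (cases rule: update_cases[OF assms])
  case (1 w)
  have w: "w \<in> core n s"
    using 1(1) by (simp add: core_update)
  have "q w \<in> core n s" "A (q w) = A v"
    using child_core[OF w, of c] 1(2) by auto
  moreover have "A x = A v" if "x \<in> core n s'" "fst s' x = q w" for x
    using that update_marked[OF that(1)] child_eq_iff[OF _ w, of x c] 1(2) by (auto simp: core_update)
  ultimately show ?thesis
    using 1(3) by (auto simp: core_update)
next
  case 2
  have "\<not> fst s' x = A v" if x: "x \<in> core n s'" for x
  proof
    assume "fst s' x = A v"
    then have "A x = A (A v)"
      using update_marked[OF x] child_core(2)[of x n s c] x by (auto simp: core_update)
    then show False
      using 2(1)[OF x] A_A[OF assms] by simp
  qed
  then show ?thesis
    using 2 by auto
qed

end

section \<open>Counting groups\<close>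

definition groups :: "nat \<Rightarrow> (nat \<Rightarrow> nat) \<Rightarrow> state \<Rightarrow> nat set" where
  "groups n N s = fst s ` {v. v < n \<and> 0 < N v}"

text \<open>With \<open>g\<close> the group of a point, the number of splits still needed to put the
  points of \<open>Y\<close> into different groups.\<close>

definition spread :: "('a \<Rightarrow> 'b) \<Rightarrow> 'a set \<Rightarrow> real" where
  "spread g Y = real (card Y) - real (card (g ` Y))"

lemma spread_nonneg: "finite Y \<Longrightarrow> 0 \<le> spread g Y"
  by (simp add: spread_def card_image_le)

text \<open>Dropping a point lowers the cardinality by one and that of the image by at most
  one.\<close>

lemma spread_mono:
  assumes "finite Y" "Z \<subseteq> Y"
  shows "spread g Z \<le> spread g Y"
proof -
  have "g ` Y = g ` Z \<union> g ` (Y - Z)"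
    using assms(2) by auto
  then have "card (g ` Y) \<le> card (g ` Z) + card (g ` (Y - Z))"
    by (metis card_Un_le)
  also have "\<dots> \<le> card (g ` Z) + card (Y - Z)"
    using assms(1) by (simp add: card_image_le)
  also have "card (Y - Z) = card Y - card Z"
    using assms by (meson card_Diff_subset finite_subset)
  finally show ?thesis
    using card_mono[OF assms] unfolding spread_def by linarith
qed

lemma sum_card_fibres:
  assumes "finite W" "finite L" "g ` W \<subseteq> L"
  shows "(\<Sum>l\<in>L. real (card {w \<in> W. g w = l})) = real (card W)"
  using sum.group[OF assms, of "\<lambda>_. 1 :: real"] by simp

text \<open>A group with \<open>j \<ge> 2\<close> parts has \<open>j \<le> 2 * (j - 1)\<close>, and
  one with a single part contributes nothing.\<close>

lemma card_siblings:
  assumes "finite Q"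
  shows "real (card {w \<in> Q. \<exists>w'\<in>Q. w' \<noteq> w \<and> g w' = g w}) \<le> 2 * spread g Q"
proof -
  let ?S = "{w \<in> Q. \<exists>w'\<in>Q. w' \<noteq> w \<and> g w' = g w}"
  have "real (card ?S) = (\<Sum>l\<in>g ` Q. real (card {w \<in> ?S. g w = l}))"
    by (rule sum_card_fibres[symmetric]) (use assms in auto)
  also have "\<dots> \<le> (\<Sum>l\<in>g ` Q. 2 * (real (card {w \<in> Q. g w = l}) - 1))"
  proof (rule sum_mono)
    fix l assume "l \<in> g ` Q"
    then obtain w where w: "w \<in> Q" "g w = l" by auto
    have fin: "finite {w \<in> Q. g w = l}"
      using assms by simp
    show "real (card {w \<in> ?S. g w = l}) \<le> 2 * (real (card {w \<in> Q. g w = l}) - 1)"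
    proof (cases "{w \<in> Q. g w = l} = {w}")
      case True
      then have "x = w" if "x \<in> Q" "g x = l" for x
        using that by blast
      then have "{w \<in> ?S. g w = l} = {}"
        by auto
      then show ?thesis
        using True by (simp only: card.empty) simp
    next
      case False
      then obtain w' where w': "{w, w'} \<subseteq> {w \<in> Q. g w = l}" "w \<noteq> w'"
        using w by auto
      have "card {w, w'} \<le> card {w \<in> Q. g w = l}"
        by (rule card_mono[OF fin w'(1)])
      moreover have "card {w, w'} = 2"
        using w'(2) by simp
      ultimately have two: "2 \<le> real (card {w \<in> Q. g w = l})"
        by (metis of_nat_mono of_nat_numeral)
      have sub: "card {w \<in> ?S. g w = l} \<le> card {w \<in> Q. g w = l}"
        by (rule card_mono[OF fin]) auto
      then have "real (card {w \<in> ?S. g w = l}) \<le> real (card {w \<in> Q. g w = l})"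
        by (rule of_nat_mono)
      then show ?thesis
        using two unfolding right_diff_distrib by linarith
    qed
  qed
  also have "\<dots> = 2 * (real (card Q) - real (card (g ` Q)))"
    using sum_card_fibres[OF assms finite_imageI[OF assms] order_refl, of g]
    by (simp add: sum_distrib_left[symmetric] sum_subtractf)
  finally show ?thesis
    by (simp add: spread_def)
qed

context level_step
begin

text \<open>
  A group that splits keeps at most one of its parts for free. The other ones are paid for
  by the splits of \<open>S\<close>, by the heavy parts that miss \<open>S\<close>, and by the light parts which
  are marked and have a sibling.
\<close>

lemma card_groups_update:
  assumes "S \<subseteq> core n s"
  shows "real (card (groups n N s')) \<le> real (card (groups n N s)) +
    (real (card (q ` S)) - real (card (A ` S))) +
    real (card {w \<in> q ` core n s - q ` S. heavy w}) +
    real (card {w \<in> q ` core n s. \<not> heavy w \<and> h w \<and> (\<exists>w'\<in>q ` core n s. w' \<noteq> w \<and> A w' = A w)})"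
proof -
  define Q where "Q = q ` core n s"
  define C where "C = q ` S"
  define U where "U = {w \<in> Q - C. heavy w}"
  define F where "F = {w \<in> Q. \<not> heavy w \<and> h w \<and> (\<exists>w'\<in>Q. w' \<noteq> w \<and> A w' = A w)}"
  define G where "G = groups n N s"
  \<comment> \<open>Bounds the number of groups beyond the first that arise from group
    \<open>l\<close>; the subtracted term is the part that comes for free.\<close>
  define t where "t l = real (card {w \<in> C. A w = l}) - of_bool (l \<in> A ` C) + real (card {w \<in> U. A w = l}) +
    real (card {w \<in> F. A w = l})" for l
  have fin: "finite Q" "finite C" "finite U" "finite F" "finite G"
    using finite_subset[OF assms] by (auto simp: Q_def C_def U_def F_def G_def groups_def)
  have CQ: "C \<subseteq> Q"
    using assms by (auto simp: C_def Q_def)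
  have AC: "A ` C = A ` S"
    unfolding C_def image_image using assms child_core(2)[of _ n s c] by (auto intro!: image_cong)
  have t0: "0 \<le> t l" for l
  proof (cases "l \<in> A ` C")
    case True
    then have "{w \<in> C. A w = l} \<noteq> {}"
      by auto
    then have "1 \<le> card {w \<in> C. A w = l}"
      using fin(2) by (simp add: Suc_le_eq card_gt_0_iff)
    then show ?thesis
      by (simp add: t_def)
  qed (simp add: t_def)
  have part: "real (card (fst s' ` {v. v < n \<and> 0 < N v \<and> A v = l})) \<le> 1 + t l" for l
  proof (cases "\<exists>w\<in>core n s'. A w = l")
    case False
    have "fst s' ` {v. v < n \<and> 0 < N v \<and> A v = l} \<subseteq> {l}"
    proof (intro image_subsetI, clarify)
      fix v assume v: "v < n" "l = A v"
      show "fst s' v = A v"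
        by (rule update_cases[OF v(1)]) (use False v in auto)
    qed
    then have "card (fst s' ` {v. v < n \<and> 0 < N v \<and> A v = l}) \<le> card {l}"
      by (rule card_mono[rotated]) simp
    then show ?thesis
      using t0[of l] by simp
  next
    case True
    have sub: "fst s' ` {v. v < n \<and> 0 < N v \<and> A v = l} \<subseteq> {w \<in> Q. h w \<and> A w = l}"
    proof (intro image_subsetI, clarify)
      fix v assume v: "v < n" "l = A v"
      show "fst s' v \<in> Q \<and> h (fst s' v) \<and> A (fst s' v) = A v"
      proof (cases rule: update_cases[OF v(1)])
        case (1 w)
        then show ?thesis
          using child_core[of w n s c] by (auto simp: Q_def core_update)
      next
        case 2
        then show ?thesis
          using True v by blast
      qed
    qed
    show ?thesis
    proof (cases "\<exists>w. {w \<in> Q. A w = l} \<subseteq> {w}")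
      case True
      then obtain w where "fst s' ` {v. v < n \<and> 0 < N v \<and> A v = l} \<subseteq> {w}"
        using sub by blast
      then have "card (fst s' ` {v. v < n \<and> 0 < N v \<and> A v = l}) \<le> card {w}"
        by (rule card_mono[rotated]) simp
      then show ?thesis
        using t0[of l] by simp
    next
      case False
      \<comment> \<open>In a group with at least two parts, a marked part contains a point of
        \<open>S\<close>, or is heavy, or is light with a sibling.\<close>
      have "{w \<in> Q. h w \<and> A w = l} \<subseteq> {w \<in> C. A w = l} \<union> {w \<in> U. A w = l} \<union> {w \<in> F. A w = l}"
        using False by (auto simp: U_def F_def)
      with sub have "card (fst s' ` {v. v < n \<and> 0 < N v \<and> A v = l}) \<le>
          card ({w \<in> C. A w = l} \<union> {w \<in> U. A w = l} \<union> {w \<in> F. A w = l})"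
        using fin by (intro card_mono) auto
      also have "\<dots> \<le> card {w \<in> C. A w = l} + card {w \<in> U. A w = l} + card {w \<in> F. A w = l}"
        by (meson add_le_mono1 card_Un_le le_trans)
      finally show ?thesis
        by (simp add: t_def)
    qed
  qed
  have "groups n N s' = (\<Union>l\<in>G. fst s' ` {v. v < n \<and> 0 < N v \<and> A v = l})"
    by (auto simp: groups_def G_def)
  then have "card (groups n N s') \<le> (\<Sum>l\<in>G. card (fst s' ` {v. v < n \<and> 0 < N v \<and> A v = l}))"
    by (simp only: card_UN_le[OF fin(5)])
  then have "real (card (groups n N s')) \<le> (\<Sum>l\<in>G. real (card (fst s' ` {v. v < n \<and> 0 < N v \<and> A v = l})))"
    unfolding of_nat_sum[symmetric] by (rule of_nat_mono)
  also have "\<dots> \<le> (\<Sum>l\<in>G. 1 + t l)"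
    by (intro sum_mono part)
  also have "\<dots> = real (card G) + (\<Sum>l\<in>G. t l)"
    by (simp add: sum.distrib)
  \<comment> \<open>Groups without clients are added so that the sums over fibres become complete;
    this is harmless as \<open>t\<close> is nonnegative.\<close>
  also have "(\<Sum>l\<in>G. t l) \<le> (\<Sum>l\<in>G \<union> A ` Q. t l)"
    using fin t0 by (intro sum_mono2) auto
  also have "\<dots> = real (card C) - real (card (A ` C)) + real (card U) + real (card F)"
  proof -
    have "(\<Sum>l\<in>G \<union> A ` Q. of_bool (l \<in> A ` C)) = real (card ((G \<union> A ` Q) \<inter> A ` C))"
      using fin by (simp add: of_bool_def sum.If_cases)
    also have "(G \<union> A ` Q) \<inter> A ` C = A ` C"
      using CQ by auto
    finally have *: "(\<Sum>l\<in>G \<union> A ` Q. of_bool (l \<in> A ` C)) = real (card (A ` C))" .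
    have "A ` C \<subseteq> G \<union> A ` Q" "A ` U \<subseteq> G \<union> A ` Q" "A ` F \<subseteq> G \<union> A ` Q"
      using CQ by (auto simp: U_def F_def)
    then show ?thesis
      unfolding t_def sum.distrib sum_subtractf using fin
      by (simp only: sum_card_fibres finite_Un finite_imageI simp_thms *)
  qed
  finally have "real (card (groups n N s')) \<le> real (card G) + (real (card C) - real (card (A ` S))) +
      real (card U) + real (card F)"
    unfolding AC by linarith
  then show ?thesis
    unfolding U_def F_def G_def unfolding C_def Q_def .
qed

end

section \<open>The potential and its change for fixed outcomes\<close>

definition diameter_le :: "nat \<Rightarrow> (nat \<Rightarrow> nat \<Rightarrow> real) \<Rightarrow> real \<Rightarrow> state \<Rightarrow> bool" where
  "diameter_le n d \<rho> s \<longleftrightarrow> (\<forall>v\<in>core n s. \<forall>w\<in>core n s. fst s v = fst s w \<longrightarrow> d v w \<le> \<rho>)"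

text \<open>Bounds the distance to every facility that the point may still get: its present one or a
  core point of its group.\<close>

definition reach :: "nat \<Rightarrow> (nat \<Rightarrow> nat \<Rightarrow> real) \<Rightarrow> state \<Rightarrow> nat \<Rightarrow> real" where
  "reach n d s v = Max (d v ` insert (fst s v) {w \<in> core n s. fst s w = fst s v})"

lemma le_reach: "d v (fst s v) \<le> reach n d s v"
  unfolding reach_def by (rule Max_ge) auto

lemma weight_core: "weight n N (snd s) g l = (\<Sum>v\<in>{v \<in> core n s. g v = l}. real (N v))"
  unfolding weight_def core_def
  by (subst sum.inter_filter[symmetric]) (auto intro!: sum.cong)

definition separated :: "nat \<Rightarrow> (nat \<Rightarrow> nat) \<Rightarrow> state \<Rightarrow> (nat \<Rightarrow> nat) \<Rightarrow> nat \<Rightarrow> bool" where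
  "separated n cv s g v \<longleftrightarrow> \<not> (cv v \<in> core n s \<and> g (cv v) = g v)"

text \<open>Bounded, so that the total reserve is bounded; yet halving the ratio of weight to
  threshold releases enough to pay for the risk of losing a part.\<close>

definition saturate :: "real \<Rightarrow> real" where
  "saturate y = y / (y + 1)"

lemma saturate_mono: "0 \<le> x \<Longrightarrow> x \<le> y \<Longrightarrow> saturate x \<le> saturate y"
  unfolding saturate_def by (simp add: field_simps)

lemma saturate_bounds: "0 \<le> x \<Longrightarrow> 0 \<le> saturate x" "0 \<le> x \<Longrightarrow> saturate x \<le> 1"
  unfolding saturate_def by simp_all

text \<open>
  The expected final cost from a state that was produced at scale \<open>\<rho>\<close> and threshold \<open>a\<close>.
  Here \<open>cv v\<close> is the facility of an optimal solution \<open>S\<close> that serves \<open>v\<close>. The summands are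
  the cost of the present groups, the connection cost of the settled clients, that of the
  others, the cost of groups which are still to be split off and contain a point of \<open>S\<close>, the
  cost of future groups that are opened by noise, and the loss at points of \<open>S\<close> whose
  group falls below the threshold.
\<close>

definition potential ::
  "nat \<Rightarrow> (nat \<Rightarrow> nat \<Rightarrow> real) \<Rightarrow> real \<Rightarrow> (nat \<Rightarrow> nat) \<Rightarrow> nat set \<Rightarrow> (nat \<Rightarrow> nat) \<Rightarrow> nat \<Rightarrow>
    real \<Rightarrow> real \<Rightarrow> state \<Rightarrow> real" where
  "potential n d f N S cv k \<rho> a s =
     f * real (card (groups n N s)) +
     (\<Sum>v\<in>{..<n} - core n s. real (N v) * reach n d s v) +
     (\<Sum>v\<in>core n s. real (N v) *
        (if separated n cv s (fst s) v then 2 * \<rho> else 3 * stretch n d v (cv v) \<rho>)) +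
     f * spread (fst s) (core n s \<inter> S) +
     f * (2 / real n) * spread (fst s) (core n s) +
     (\<Sum>c\<in>core n s \<inter> S. 64 * real k * f * saturate (weight n N (snd s) (fst s) (fst s c) / a))"

context level_step
begin

lemma reach_update:
  assumes "v < n"
  shows "reach n d s' v \<le> reach n d s v"
  unfolding reach_def by (rule Max_mono) (use update_group[OF assms] in auto)

lemma reach_core:
  assumes "diameter_le n d \<rho> s" "v \<in> core n s"
  shows "reach n d s v \<le> \<rho>"
  unfolding reach_def
  by (subst Max_le_iff) (use assms A_core[OF assms(2)] A_A[of v] in \<open>auto simp: diameter_le_def core_def\<close>)

lemma diameter_update:
  assumes "Metric_space {..<n} d" "\<And>v. v < n \<Longrightarrow> c v < n \<and> d (c v) v \<le> \<rho> / 2"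
  shows "diameter_le n d \<rho> s'"
  unfolding diameter_le_def
proof (intro ballI impI)
  interpret Metric_space "{..<n}" d by fact
  fix v w assume vw: "v \<in> core n s'" "w \<in> core n s'" "fst s' v = fst s' w"
  then have core: "v \<in> core n s" "w \<in> core n s" and "q v = q w"
    by (simp_all add: update_marked, simp_all add: core_update)
  then have "c v = c w" "v < n" "w < n"
    using child_eq_iff[OF core, of c] by (simp_all add: core_def)
  then show "d v w \<le> \<rho>"
    using assms(2)[of v] assms(2)[of w] triangle[of v "c v" w] commute[of v "c v"] by auto
qed

lemma separated_update:
  assumes "v \<in> core n s'"
  shows "separated n cv s' (fst s') v \<longleftrightarrow> separated n cv s q v"
  using assms update_marked[of v] update_marked[of "cv v"]
  by (auto simp: separated_def core_update)

lemma weight_update: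
  assumes "w \<in> core n s'"
  shows "weight n N (snd s') (fst s') (fst s' w) = weight n N (snd s) q (q w)"
  unfolding weight_core update_marked[OF assms]
  by (intro sum.cong refl) (use assms in \<open>auto simp: core_update update_marked\<close>)

lemma spread_update: "spread (fst s') (core n s' \<inter> Y) \<le> spread q (core n s \<inter> Y)"
proof -
  have "fst s' ` (core n s' \<inter> Y) = q ` (core n s' \<inter> Y)"
    by (rule image_cong) (auto simp: update_marked)
  then have "spread (fst s') (core n s' \<inter> Y) = spread q (core n s' \<inter> Y)"
    by (simp add: spread_def)
  also have "\<dots> \<le> spread q (core n s \<inter> Y)"
    by (rule spread_mono) (auto simp: core_update)
  finally show ?thesis .
qed

text \<open>A separated client is charged \<open>3 * \<rho>\<close>. One \<open>\<rho>\<close> pays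
  for heavy parts without a point of \<open>S\<close>; the other \<open>2 * \<rho>\<close> is kept
  for later, or covers the connection if the part is unmarked, since the old group has diameter at
  most \<open>2 * \<rho>\<close>. Unseparated clients of an unmarked part are charged to the points
  of \<open>S\<close> in it.\<close>

lemma potential_update:
  fixes S :: "nat set" and k :: nat and N :: "nat \<Rightarrow> nat"
  assumes metric: "Metric_space {..<n} d"
    and diam: "diameter_le n d (2 * \<rho>) s" and cv: "\<And>v. v < n \<Longrightarrow> cv v < n \<and> cv v \<in> S"
    and f: "0 \<le> f" and \<rho>: "0 \<le> \<rho>" and a: "0 < a" "a * \<rho> = real k * f" and k: "1 \<le> k"
  defines "W \<equiv> weight n N (snd s) q"
  defines "Q \<equiv> q ` core n s"
  shows "potential n d f N S cv k \<rho> a s' \<le>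
    f * real (card (groups n N s)) +
    (\<Sum>v\<in>{..<n} - core n s. real (N v) * reach n d s v) +
    (\<Sum>v\<in>core n s. real (N v) * (if separated n cv s q v then 3 * \<rho> else 3 * stretch n d v (cv v) \<rho>)) +
    f * spread (fst s) (core n s \<inter> S) +
    f * (2 / real n) * spread q (core n s) +
    f * real (card {w \<in> Q. \<not> a \<le> W w \<and> h w \<and> (\<exists>w'\<in>Q. w' \<noteq> w \<and> A w' = A w)}) +
    (\<Sum>c\<in>core n s \<inter> S. if h (q c) then 64 * real k * f * saturate (W (q c) / a) else 2 * \<rho> * W (q c))"
proof -
  define K where "K = core n s"
  define T where "T = K \<inter> S"
  define sep where "sep = separated n cv s q"
  define U where "U = {w \<in> Q - q ` T. a \<le> W w}"
  define F where "F = {w \<in> Q. \<not> a \<le> W w \<and> h w \<and> (\<exists>w'\<in>Q. w' \<noteq> w \<and> A w' = A w)}"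
  have fin: "finite K" "finite T" "finite Q" "finite U"
    by (auto simp: K_def T_def Q_def U_def)
  have W: "W l = (\<Sum>v\<in>{v \<in> K. q v = l}. real (N v))" for l
    unfolding W_def K_def by (rule weight_core)
  have W0: "0 \<le> W l" for l
    unfolding W by (simp add: sum_nonneg)
  have mem: "cv v \<in> T" "q (cv v) = q v" if "v \<in> K" "\<not> sep v" for v
    using that cv[of v] by (auto simp: sep_def separated_def T_def K_def core_def)

  \<comment> \<open>Such a part has at least \<open>a\<close> clients, all of them separated, and
    \<open>a * \<rho> = k * f\<close> is at least \<open>f\<close>.\<close>
  have "f * real (card U) \<le> (a * \<rho>) * real (card U)"
    using f k a by (intro mult_right_mono) (auto simp: mult_le_cancel_right1)
  also have "\<dots> = \<rho> * (\<Sum>w\<in>U. a)"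
    by simp
  also have "\<dots> \<le> \<rho> * (\<Sum>w\<in>U. W w)"
    using \<rho> by (intro mult_left_mono sum_mono) (auto simp: U_def)
  also have "(\<Sum>w\<in>U. W w) = (\<Sum>v\<in>{v \<in> K. q v \<in> U}. real (N v))"
  proof -
    have "(\<Sum>w\<in>U. W w) = (\<Sum>w\<in>U. \<Sum>v\<in>{v \<in> {v \<in> K. q v \<in> U}. q v = w}. real (N v))"
      unfolding W by (intro sum.cong refl) auto
    also have "\<dots> = (\<Sum>v\<in>{v \<in> K. q v \<in> U}. real (N v))"
      by (rule sum.group) (use fin in auto)
    finally show ?thesis .
  qed
  also have "\<dots> \<le> (\<Sum>v\<in>K. if sep v then real (N v) else 0)"
  proof -
    have "sep v" if "v \<in> K" "q v \<in> U" for v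
    proof (rule ccontr)
      assume "\<not> sep v"
      then show False
        using mem[of v] that by (metis (no_types, lifting) DiffD2 U_def imageI mem_Collect_eq)
    qed
    then have "(\<Sum>v\<in>{v \<in> K. q v \<in> U}. real (N v)) = (\<Sum>v\<in>{v \<in> K. q v \<in> U}. if sep v then real (N v) else 0)"
      by (intro sum.cong) auto
    also have "\<dots> \<le> (\<Sum>v\<in>K. if sep v then real (N v) else 0)"
      by (rule sum_mono2) (use fin in auto)
    finally show ?thesis .
  qed
  finally have heavy: "f * real (card U) \<le> \<rho> * (\<Sum>v\<in>K. if sep v then real (N v) else 0)"
    using \<rho> by (simp add: mult_left_mono)

  have "real (card (groups n N s')) \<le> real (card (groups n N s)) +
      (real (card (q ` T)) - real (card (A ` T))) + real (card U) + real (card F)"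
    using card_groups_update[of T N "\<lambda>w. a \<le> W w"]
    by (simp add: K_def T_def U_def F_def Q_def)
  from mult_left_mono[OF this f]
  have groups: "f * real (card (groups n N s')) \<le> f * real (card (groups n N s)) +
      f * (real (card (q ` T)) - real (card (A ` T))) + f * real (card U) + f * real (card F)"
    by (simp add: algebra_simps)

  have spreads: "f * (real (card (q ` T)) - real (card (A ` T))) + f * spread (fst s') (core n s' \<inter> S)
      \<le> f * spread A T"
  proof -
    have "f * spread (fst s') (core n s' \<inter> S) \<le> f * spread q T"
      using spread_update[of S] f by (simp add: T_def K_def mult_left_mono)
    then show ?thesis
      by (simp add: spread_def algebra_simps)
  qed
  have spread_all: "f * (2 / real n) * spread (fst s') (core n s') \<le> f * (2 / real n) * spread q K"
    unfolding K_def using spread_update[of UNIV] f by (intro mult_left_mono) simp_all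

  \<comment> \<open>The facility \<open>cv v\<close> of an unseparated client lies in the same part.
    On the right, a part is counted once for each point of \<open>S\<close> in it.\<close>
  have lost: "(\<Sum>v\<in>{v \<in> K. \<not> h (q v) \<and> \<not> sep v}. real (N v)) \<le> (\<Sum>c\<in>{c \<in> T. \<not> h (q c)}. W (q c))"
  proof -
    have "(\<Sum>v\<in>{v \<in> K. \<not> h (q v) \<and> \<not> sep v}. real (N v)) \<le>
        (\<Sum>v\<in>K. \<Sum>c\<in>{c \<in> T. \<not> h (q c)}. if q v = q c then real (N v) else 0)"
    proof (rule order_trans)
      show "(\<Sum>v\<in>{v \<in> K. \<not> h (q v) \<and> \<not> sep v}. real (N v)) \<le>
        (\<Sum>v\<in>{v \<in> K. \<not> h (q v) \<and> \<not> sep v}. \<Sum>c\<in>{c \<in> T. \<not> h (q c)}. if q v = q c then real (N v) else 0)"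
      proof (rule sum_mono)
        fix v assume v: "v \<in> {v \<in> K. \<not> h (q v) \<and> \<not> sep v}"
        then have "(if q v = q (cv v) then real (N v) else 0) \<le>
            (\<Sum>c\<in>{c \<in> T. \<not> h (q c)}. if q v = q c then real (N v) else 0)"
          using mem[of v] fin by (intro member_le_sum) auto
        then show "real (N v) \<le> (\<Sum>c\<in>{c \<in> T. \<not> h (q c)}. if q v = q c then real (N v) else 0)"
          using mem[of v] v by simp
      qed
    qed (intro sum_mono2, use fin in \<open>auto intro: sum_nonneg\<close>)
    also have "\<dots> = (\<Sum>c\<in>{c \<in> T. \<not> h (q c)}. W (q c))"
      unfolding W by (subst sum.swap) (simp only: sum.inter_filter[OF fin(1)])
    finally show ?thesis .
  qed

  have "{..<n} - core n s' = ({..<n} - K) \<union> {v \<in> K. \<not> h (q v)}"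
    unfolding core_update K_def by (auto simp: core_def)
  then have "(\<Sum>v\<in>{..<n} - core n s'. real (N v) * reach n d s' v) =
      (\<Sum>v\<in>{..<n} - K. real (N v) * reach n d s' v) + (\<Sum>v\<in>{v \<in> K. \<not> h (q v)}. real (N v) * reach n d s' v)"
    by (simp only:) (rule sum.union_disjoint, use fin in auto)
  also have "\<dots> \<le> (\<Sum>v\<in>{..<n} - K. real (N v) * reach n d s v) + (\<Sum>v\<in>{v \<in> K. \<not> h (q v)}. real (N v) * (2 * \<rho>))"
  proof (intro add_mono sum_mono mult_left_mono)
    fix v assume "v \<in> {v \<in> K. \<not> h (q v)}"
    then show "reach n d s' v \<le> 2 * \<rho>"
      using reach_update[of v d] reach_core[OF diam, of v] by (fastforce simp: K_def core_def)
  qed (auto intro: reach_update)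
  also have "(\<Sum>v\<in>{v \<in> K. \<not> h (q v)}. real (N v) * (2 * \<rho>)) =
      (\<Sum>v\<in>{v \<in> K. \<not> h (q v) \<and> sep v}. real (N v) * (2 * \<rho>)) +
      2 * \<rho> * (\<Sum>v\<in>{v \<in> K. \<not> h (q v) \<and> \<not> sep v}. real (N v))"
  proof -
    have "{v \<in> K. \<not> h (q v)} = {v \<in> K. \<not> h (q v) \<and> sep v} \<union> {v \<in> K. \<not> h (q v) \<and> \<not> sep v}"
      by auto
    then have "(\<Sum>v\<in>{v \<in> K. \<not> h (q v)}. real (N v) * (2 * \<rho>)) =
        (\<Sum>v\<in>{v \<in> K. \<not> h (q v) \<and> sep v}. real (N v) * (2 * \<rho>)) +
        (\<Sum>v\<in>{v \<in> K. \<not> h (q v) \<and> \<not> sep v}. real (N v) * (2 * \<rho>))"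
      by (simp only:) (rule sum.union_disjoint, use fin in auto)
    then show ?thesis
      unfolding sum_distrib_right[symmetric] by (simp only: mult.commute)
  qed
  also have "\<dots> \<le> (\<Sum>v\<in>{v \<in> K. \<not> h (q v) \<and> sep v}. real (N v) * (2 * \<rho>)) +
      2 * \<rho> * (\<Sum>c\<in>{c \<in> T. \<not> h (q c)}. W (q c))"
    using lost \<rho> by (intro add_left_mono mult_left_mono) auto
  also have "(\<Sum>v\<in>{v \<in> K. \<not> h (q v) \<and> sep v}. real (N v) * (2 * \<rho>)) =
      (\<Sum>v\<in>K. if \<not> h (q v) \<and> sep v then real (N v) * (2 * \<rho>) else 0)"
    by (rule sum.inter_filter[OF fin(1)])
  also have "2 * \<rho> * (\<Sum>c\<in>{c \<in> T. \<not> h (q c)}. W (q c)) =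
      (\<Sum>c\<in>T. if \<not> h (q c) then 2 * \<rho> * W (q c) else 0)"
    unfolding sum_distrib_left by (rule sum.inter_filter[OF fin(2)])
  finally have settled: "(\<Sum>v\<in>{..<n} - core n s'. real (N v) * reach n d s' v) \<le>
      (\<Sum>v\<in>{..<n} - K. real (N v) * reach n d s v) +
      (\<Sum>v\<in>K. if \<not> h (q v) \<and> sep v then real (N v) * (2 * \<rho>) else 0) +
      (\<Sum>c\<in>T. if \<not> h (q c) then 2 * \<rho> * W (q c) else 0)"
    by (simp only: add.assoc)

  have future: "(\<Sum>v\<in>core n s'. real (N v) *
      (if separated n cv s' (fst s') v then 2 * \<rho> else 3 * stretch n d v (cv v) \<rho>)) =
      (\<Sum>v\<in>K. if h (q v) then real (N v) * (if sep v then 2 * \<rho> else 3 * stretch n d v (cv v) \<rho>) else 0)"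
    unfolding sum.inter_filter[OF fin(1), symmetric]
    by (rule sum.cong) (auto simp: core_update K_def separated_update sep_def)
  have weights: "(\<Sum>c\<in>core n s' \<inter> S. 64 * real k * f * saturate (weight n N (snd s') (fst s') (fst s' c) / a)) =
      (\<Sum>c\<in>T. if h (q c) then 64 * real k * f * saturate (W (q c) / a) else 0)"
    unfolding sum.inter_filter[OF fin(2), symmetric]
    by (rule sum.cong) (auto simp: core_update K_def T_def weight_update W_def)

  have points: "\<rho> * (\<Sum>v\<in>K. if sep v then real (N v) else 0) +
      (\<Sum>v\<in>K. if \<not> h (q v) \<and> sep v then real (N v) * (2 * \<rho>) else 0) +
      (\<Sum>v\<in>K. if h (q v) then real (N v) * (if sep v then 2 * \<rho> else 3 * stretch n d v (cv v) \<rho>) else 0) \<le>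
      (\<Sum>v\<in>K. real (N v) * (if sep v then 3 * \<rho> else 3 * stretch n d v (cv v) \<rho>))"
    unfolding sum_distrib_left sum.distrib[symmetric]
  proof (rule sum_mono)
    fix v assume "v \<in> K"
    then have "0 \<le> stretch n d v (cv v) \<rho>"
      using cv[of v] by (intro stretch_bound[OF metric]) (auto simp: K_def core_def)
    then show "\<rho> * (if sep v then real (N v) else 0) +
      (if \<not> h (q v) \<and> sep v then real (N v) * (2 * \<rho>) else 0) +
      (if h (q v) then real (N v) * (if sep v then 2 * \<rho> else 3 * stretch n d v (cv v) \<rho>) else 0) \<le>
      real (N v) * (if sep v then 3 * \<rho> else 3 * stretch n d v (cv v) \<rho>)"
      by (auto simp: algebra_simps)
  qed
  have centers: "(\<Sum>c\<in>T. if h (q c) then 64 * real k * f * saturate (W (q c) / a) else 0) +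
      (\<Sum>c\<in>T. if \<not> h (q c) then 2 * \<rho> * W (q c) else 0) =
      (\<Sum>c\<in>T. if h (q c) then 64 * real k * f * saturate (W (q c) / a) else 2 * \<rho> * W (q c))"
    unfolding sum.distrib[symmetric] by (rule sum.cong) auto
  show ?thesis
    unfolding potential_def K_def[symmetric] T_def[symmetric] sep_def[symmetric] F_def[symmetric]
    using groups heavy spreads spread_all settled points
    unfolding future weights centers[symmetric] by linarith
qed

end

section \<open>Expected change of the potential\<close>

lemma marks_pmf_Pi:
  "marks_pmf n k a z x =
     Pi_pmf {..<n} False (\<lambda>u. bernoulli_pmf (odds k a (x u) / (real z + odds k a (x u))))"
  unfolding marks_pmf_def by (rule iter_pmf_Pi)

lemma finite_marks: "finite_pmf (marks_pmf n k a z x)"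
  unfolding marks_pmf_def by (intro finite_iter_pmf) simp

lemma finite_level: "finite_pmf (level_pmf n d N k \<rho> a z s)"
  by (simp add: level_pmf_partition finite_partition finite_marks)

lemma odds_pos: "0 < a \<Longrightarrow> 0 \<le> x \<Longrightarrow> 0 < odds k a x"
  unfolding odds_def by (intro zero_less_power divide_pos_pos) auto

lemma E_marks:
  assumes "0 < a" "\<And>w. 0 \<le> x w" "w < n"
  shows "E (marks_pmf n k a z x) (\<lambda>h. F (h w)) =
    F True * (odds k a (x w) / (real z + odds k a (x w))) +
    F False * (1 - odds k a (x w) / (real z + odds k a (x w)))"
proof -
  have "E (marks_pmf n k a z x) (\<lambda>h. F (h w)) = E (map_pmf (\<lambda>h. h w) (marks_pmf n k a z x)) F"
    by (simp add: E_map)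
  also have "map_pmf (\<lambda>h. h w) (marks_pmf n k a z x) =
      bernoulli_pmf (odds k a (x w) / (real z + odds k a (x w)))"
    unfolding marks_pmf_Pi using assms(3) by (subst Pi_pmf_component) auto
  also have "E \<dots> F = F True * (odds k a (x w) / (real z + odds k a (x w))) +
      F False * (1 - odds k a (x w) / (real z + odds k a (x w)))"
    using odds_pos[OF assms(1) assms(2)[of w], of k] by (intro integral_bernoulli_pmf) (auto simp: field_simps)
  finally show ?thesis .
qed

lemma weight_nonneg: "0 \<le> weight n N X q w"
  by (simp add: weight_def sum_nonneg)

text \<open>Up to the threshold the base of the power is at most \<open>1 / 2\<close>.\<close>

lemma light_odds:
  assumes "0 < a" "0 \<le> x" "x \<le> a" "n \<le> 2 ^ k" "0 < n"
  shows "odds k a x / (1 + odds k a x) \<le> 1 / real n"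
proof -
  have "odds k a x / (1 + odds k a x) \<le> odds k a x"
    using odds_pos[OF assms(1,2), of k] by (simp add: field_simps)
  also have "\<dots> \<le> (1 / 2) ^ k"
    unfolding odds_def using assms(1-3) by (intro power_mono) (auto simp: field_simps)
  also have "\<dots> \<le> 1 / real n"
  proof -
    have "real n \<le> 2 ^ k"
      using assms(4) by (metis of_nat_le_iff of_nat_numeral of_nat_power)
    then show ?thesis
      using assms(5) by (simp add: power_one_over field_simps)
  qed
  finally show ?thesis .
qed

text \<open>Put \<open>t = x / a\<close>. As \<open>k \<ge> 2\<close>, the part is unmarked with
  probability at most \<open>16 / (t + 1)^2\<close>, so the loss is at most
  \<open>32 * t / (t + 1)^2\<close>. Halving the ratio \<open>2 * t\<close> decreases
  \<open>saturate\<close> by \<open>t / ((2 * t + 1) * (t + 1))\<close>, which is at least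
  \<open>t / (2 * (t + 1)^2)\<close>; hence the factor 64.\<close>

lemma unmarked_loss:
  assumes "0 < a" "0 \<le> x" "2 * x \<le> y" "2 \<le> k"
  shows "(1 - odds k a x / (1 + odds k a x)) * (2 * (x / a)) + 64 * saturate (x / a) \<le> 64 * saturate (y / a)"
proof -
  define t where "t = x / a"
  have t: "0 \<le> t" "odds k a x = ((t + 1) / 4) ^ k"
    using assms(1,2) by (auto simp: t_def odds_def field_simps)
  have o: "0 < odds k a x"
    by (rule odds_pos[OF assms(1,2)])
  have "1 - odds k a x / (1 + odds k a x) = 1 / (1 + odds k a x)"
    using o by (simp add: field_simps)
  also have "\<dots> \<le> 16 / (t + 1)\<^sup>2"
  proof (cases "t + 1 \<le> 4")
    case True
    then have "(t + 1)\<^sup>2 \<le> 4\<^sup>2"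
      using t by (intro power_mono) auto
    then have "1 \<le> 16 / (t + 1)\<^sup>2"
      using t by (simp add: field_simps)
    moreover have "1 / (1 + odds k a x) \<le> 1"
      using o by simp
    ultimately show ?thesis by linarith
  next
    case False
    have "((t + 1) / 4)\<^sup>2 \<le> ((t + 1) / 4) ^ k"
      using False assms(4) by (intro power_increasing) auto
    then have "(t + 1)\<^sup>2 / 16 \<le> 1 + odds k a x"
      unfolding t(2) by (simp add: power_divide)
    then show ?thesis
      using t(1) o by (simp add: field_simps)
  qed
  finally have "(1 - odds k a x / (1 + odds k a x)) * (2 * t) \<le> 16 / (t + 1)\<^sup>2 * (2 * t)"
    using t by (intro mult_right_mono) auto
  also have "\<dots> \<le> 64 * (t / ((2 * t + 1) * (t + 1)))"
  proof -
    have "t / (t + 1)\<^sup>2 \<le> 2 * (t / ((2 * t + 1) * (t + 1)))"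
    proof -
      have "(2 * t + 1) * (t + 1) \<le> 2 * (t + 1)\<^sup>2"
        using t by (simp add: power2_eq_square algebra_simps)
      then have "t / (2 * (t + 1)\<^sup>2) \<le> t / ((2 * t + 1) * (t + 1))"
        using t by (intro divide_left_mono mult_pos_pos) auto
      then show ?thesis
        by simp
    qed
    then show ?thesis
      by simp
  qed
  also have "t / ((2 * t + 1) * (t + 1)) = saturate (2 * t) - saturate t"
    using t unfolding saturate_def by (simp add: field_simps)
  finally have "(1 - odds k a x / (1 + odds k a x)) * (2 * t) + 64 * saturate t \<le> 64 * saturate (2 * t)"
    by (simp add: algebra_simps)
  also have "saturate (2 * t) \<le> saturate (y / a)"
    using assms t unfolding t_def by (intro saturate_mono) (auto simp: field_simps)
  finally show ?thesis
    by (simp add: t_def)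
qed

text \<open>The partition is fixed here. A light part is marked with probability at most
  \<open>1 / n\<close> and matters only if it has a sibling. The number of such parts is at most
  twice the decrease of the spread of the core, which pays for them.\<close>

lemma (in level_step) potential_marks:
  fixes S :: "nat set" and k :: nat and N :: "nat \<Rightarrow> nat"
  assumes metric: "Metric_space {..<n} d" and n: "0 < n" "n \<le> 2 ^ k"
    and diam: "diameter_le n d (2 * \<rho>) s" and cv: "\<And>v. v < n \<Longrightarrow> cv v < n \<and> cv v \<in> S"
    and f: "0 \<le> f" and \<rho>: "0 \<le> \<rho>" and a: "0 < a" "a * \<rho> = real k * f" and k: "2 \<le> k"
  shows "E (marks_pmf n k a 1 (weight n N (snd s) q)) (\<lambda>h. potential n d f N S cv k \<rho> a (update n s q h)) \<le>
    f * real (card (groups n N s)) +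
    (\<Sum>v\<in>{..<n} - core n s. real (N v) * reach n d s v) +
    (\<Sum>v\<in>core n s. real (N v) * (if separated n cv s q v then 3 * \<rho> else 3 * stretch n d v (cv v) \<rho>)) +
    f * spread (fst s) (core n s \<inter> S) +
    f * (2 / real n) * spread (fst s) (core n s) +
    (\<Sum>c\<in>core n s \<inter> S. 64 * real k * f * saturate (weight n N (snd s) (fst s) (fst s c) / (a / 2)))"
proof -
  define W where "W = weight n N (snd s) q"
  define M where "M = marks_pmf n k a 1 W"
  define Q where "Q = q ` core n s"
  define L where "L = {w \<in> Q. \<not> a \<le> W w \<and> (\<exists>w'\<in>Q. w' \<noteq> w \<and> A w' = A w)}"
  define T where "T = core n s \<inter> S"
  define p where "p w = odds k a (W w) / (1 + odds k a (W w))" for w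
  define C where "C = f * real (card (groups n N s)) +
    (\<Sum>v\<in>{..<n} - core n s. real (N v) * reach n d s v) +
    (\<Sum>v\<in>core n s. real (N v) * (if separated n cv s q v then 3 * \<rho> else 3 * stretch n d v (cv v) \<rho>)) +
    f * spread (fst s) (core n s \<inter> S) +
    f * (2 / real n) * spread q (core n s)"
  define g where "g c b = (if b then 64 * real k * f * saturate (W (q c) / a) else 2 * \<rho> * W (q c))" for c b
  have finM: "finite_pmf M" and fin: "finite Q" "finite L" "finite T"
    by (auto simp: M_def finite_marks Q_def L_def T_def)
  have W0: "0 \<le> W w" for w
    by (simp add: W_def weight_nonneg)
  have Qn: "w < n" if "w \<in> Q" for w
    using that q_less by (auto simp: Q_def core_def)
  have prob: "E M (\<lambda>h. F (h w)) = F True * p w + F False * (1 - p w)" if "w < n" for w F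
    unfolding M_def p_def using E_marks[OF a(1) W0 that, where k = k and z = 1 and F = F] by simp
  have p01: "0 \<le> p w" "p w \<le> 1" for w
    using odds_pos[OF a(1) W0[of w], of k] by (auto simp: p_def)
  have "E M (\<lambda>h. potential n d f N S cv k \<rho> a (update n s q h)) \<le>
      E M (\<lambda>h. C + (f * (\<Sum>w\<in>L. of_bool (h w)) + (\<Sum>c\<in>T. g c (h (q c)))))"
  proof (rule E_mono[OF finM])
    fix h
    have "real (card {w \<in> Q. \<not> a \<le> W w \<and> h w \<and> (\<exists>w'\<in>Q. w' \<noteq> w \<and> A w' = A w)}) =
        (\<Sum>w\<in>L. of_bool (h w))"
    proof -
      have "{w \<in> Q. \<not> a \<le> W w \<and> h w \<and> (\<exists>w'\<in>Q. w' \<noteq> w \<and> A w' = A w)} = L \<inter> {w. h w}"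
        by (auto simp: L_def)
      then show ?thesis
        using fin by (simp add: of_bool_def sum.If_cases)
    qed
    then show "potential n d f N S cv k \<rho> a (update n s q h) \<le>
        C + (f * (\<Sum>w\<in>L. of_bool (h w)) + (\<Sum>c\<in>T. g c (h (q c))))"
      using level_step.potential_update[OF level_step_axioms metric diam _ f \<rho> a, where N = N and h = h and c = c and S = S and cv = cv] cv k
      unfolding C_def g_def T_def W_def Q_def by (simp add: add.assoc)
  qed
  also have "\<dots> = C + (f * (\<Sum>w\<in>L. E M (\<lambda>h. of_bool (h w))) + (\<Sum>c\<in>T. E M (\<lambda>h. g c (h (q c)))))"
    by (simp add: E_add E_sum finM measure_pmf.prob_space)
  also have "(\<Sum>w\<in>L. E M (\<lambda>h. of_bool (h w))) \<le> (\<Sum>w\<in>L. 1 / real n)"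
  proof (rule sum_mono)
    fix w assume w: "w \<in> L"
    then have "E M (\<lambda>h. of_bool (h w)) = p w"
      using prob[of w of_bool] Qn[of w] by (simp add: L_def)
    also have "\<dots> \<le> 1 / real n"
      unfolding p_def by (rule light_odds) (use w a n W0 in \<open>auto simp: L_def\<close>)
    finally show "E M (\<lambda>h. of_bool (h w)) \<le> 1 / real n" .
  qed
  also have "(\<Sum>w\<in>L. 1 / real n) \<le> 2 / real n * spread A Q"
  proof -
    have "real (card L) \<le> real (card {w \<in> Q. \<exists>w'\<in>Q. w' \<noteq> w \<and> A w' = A w})"
      using fin by (intro of_nat_mono card_mono) (auto simp: L_def)
    also have "\<dots> \<le> 2 * spread A Q"
      by (rule card_siblings[OF fin(1)])
    finally show ?thesis
      using n by (simp add: field_simps)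
  qed
  also have "(\<Sum>c\<in>T. E M (\<lambda>h. g c (h (q c)))) \<le>
      (\<Sum>c\<in>T. 64 * real k * f * saturate (weight n N (snd s) A (A c) / (a / 2)))"
  proof (rule sum_mono)
    fix c' assume c': "c' \<in> T"
    then have core: "c' \<in> core n s"
      by (simp add: T_def)
    then have qc: "q c' < n"
      using q_less by (simp add: core_def)
    \<comment> \<open>A part weighs no more than its group, so relative to the doubled threshold the
      ratio has at least halved.\<close>
    have "W (q c') \<le> weight n N (snd s) A (A c')"
      unfolding W_def weight_core using child_eq_iff[OF _ core, of _ c]
      by (intro sum_mono2) auto
    then have "2 * W (q c') \<le> 2 * weight n N (snd s) A (A c')"
      by simp
    note loss = unmarked_loss[OF a(1) W0 this k]
    have s0: "0 \<le> saturate (W (q c') / a)"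
      using a W0 by (intro saturate_bounds) simp
    have "E M (\<lambda>h. g c' (h (q c'))) =
        64 * real k * f * saturate (W (q c') / a) * p (q c') + 2 * \<rho> * W (q c') * (1 - p (q c'))"
      using prob[OF qc, of "g c'"] by (simp add: g_def)
    also have "2 * \<rho> * W (q c') = (a * \<rho>) * (2 * (W (q c') / a))"
      using a(1) by simp
    also have "64 * real k * f * saturate (W (q c') / a) * p (q c') \<le> 64 * real k * f * saturate (W (q c') / a)"
      using f s0 p01 by (intro mult_left_le) auto
    also have "64 * real k * f * saturate (W (q c') / a) + a * \<rho> * (2 * (W (q c') / a)) * (1 - p (q c')) =
        real k * f * ((1 - p (q c')) * (2 * (W (q c') / a)) + 64 * saturate (W (q c') / a))"
      unfolding a(2) by (simp add: algebra_simps)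
    also have "\<dots> \<le> real k * f * (64 * saturate (2 * weight n N (snd s) A (A c') / a))"
      using loss f unfolding p_def by (intro mult_left_mono) auto
    finally show "E M (\<lambda>h. g c' (h (q c'))) \<le>
        64 * real k * f * saturate (weight n N (snd s) A (A c') / (a / 2))"
      by (simp add: mult_ac)
  qed
  finally have "E M (\<lambda>h. potential n d f N S cv k \<rho> a (update n s q h)) \<le>
      C + (f * (2 / real n * spread A Q) +
        (\<Sum>c\<in>T. 64 * real k * f * saturate (weight n N (snd s) A (A c) / (a / 2))))"
    using f by (simp add: mult_left_mono)
  \<comment> \<open>The spread of the core over its groups is what remains within the parts plus
    what the formation of the parts has released.\<close>
  moreover have "spread q (core n s) + spread A Q = spread A (core n s)"
  proof -
    have "A ` Q = A ` core n s"
      unfolding Q_def image_image using child_core(2)[of _ n s c] by (auto intro!: image_cong)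
    then show ?thesis
      by (simp add: spread_def Q_def)
  qed
  then have "f * (2 / real n) * spread q (core n s) + f * (2 / real n * spread A Q) =
      f * (2 / real n) * spread A (core n s)"
    by (metis distrib_left mult.assoc)
  ultimately show ?thesis
    unfolding C_def M_def W_def T_def by linarith
qed

text \<open>The potential is a supermartingale. A pair separated at this level costs
  \<open>3 * \<rho>\<close>, which the decrease of its stretch term pays in expectation; for a pair
  separated earlier the reserve of \<open>4 * \<rho>\<close> suffices.\<close>

lemma level_potential:
  assumes metric: "Metric_space {..<n} d" and n: "0 < n" "n \<le> 2 ^ k" and wf: "well_formed n s"
    and diam: "diameter_le n d (2 * \<rho>) s" and cv: "\<And>v. v < n \<Longrightarrow> cv v < n \<and> cv v \<in> S"
    and f: "0 \<le> f" and \<rho>: "0 \<le> \<rho>" and a: "0 < a" "a * \<rho> = real k * f" and k: "2 \<le> k"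
  shows "E (level_pmf n d N k \<rho> a 1 s) (potential n d f N S cv k \<rho> a) \<le>
    potential n d f N S cv k (2 * \<rho>) (a / 2) s"
proof -
  interpret Metric_space "{..<n}" d by fact
  have d0: "d v v = 0" if "v < n" for v
    using that zero[of v v] by simp
  define st where "st v = stretch n d v (cv v)" for v
  let ?P = "partition_pmf n d k \<rho>"
  define C1 where "C1 = f * real (card (groups n N s)) +
    (\<Sum>v\<in>{..<n} - core n s. real (N v) * reach n d s v)"
  define C2 where "C2 = f * spread (fst s) (core n s \<inter> S) +
    f * (2 / real n) * spread (fst s) (core n s) +
    (\<Sum>c\<in>core n s \<inter> S. 64 * real k * f * saturate (weight n N (snd s) (fst s) (fst s c) / (a / 2)))"
  define sep where "sep v \<longleftrightarrow> separated n cv s (fst s) v" for v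
  \<comment> \<open>Affine in the indicator \<open>b\<close> of a new separation, so that the
    expectation can be taken inside.\<close>
  let ?B = "\<lambda>v b. real (N v) *
    ((if sep v then 3 * \<rho> else 3 * st v \<rho>) + (if sep v then 0 else 3 * \<rho>) * b)"
  have st0: "0 \<le> st v \<rho>" if "v \<in> core n s" for v
    unfolding st_def using that cv[of v] by (intro stretch_bound[OF metric]) (auto simp: core_def)
  have "E (level_pmf n d N k \<rho> a 1 s) (potential n d f N S cv k \<rho> a) =
      E ?P (\<lambda>c. E (marks_pmf n k a 1 (weight n N (snd s) (child n s c)))
        (\<lambda>h. potential n d f N S cv k \<rho> a (update n s (child n s c) h)))"
    unfolding level_pmf_partition by (subst E_bind) (simp_all add: finite_partition finite_marks)
  also have "\<dots> \<le> E ?P (\<lambda>c. C1 + C2 + (\<Sum>v\<in>core n s. ?B v (of_bool (c v \<noteq> c (cv v)))))"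
  proof (rule E_mono[OF finite_partition])
    fix c assume "c \<in> set_pmf ?P"
    interpret level_step n s c by unfold_locales (rule wf)
    have "(\<Sum>v\<in>core n s. real (N v) * (if separated n cv s (child n s c) v then 3 * \<rho> else 3 * st v \<rho>)) \<le>
      (\<Sum>v\<in>core n s. ?B v (of_bool (c v \<noteq> c (cv v))))"
    proof (intro sum_mono mult_left_mono)
      fix v assume v: "v \<in> core n s"
      have "separated n cv s (child n s c) v \<longleftrightarrow> sep v \<or> c v \<noteq> c (cv v)"
        using child_eq_iff[OF _ v, of "cv v" c] by (auto simp: separated_def sep_def)
      then show "(if separated n cv s (child n s c) v then 3 * \<rho> else 3 * st v \<rho>) \<le>
          (if sep v then 3 * \<rho> else 3 * st v \<rho>) + (if sep v then 0 else 3 * \<rho>) * of_bool (c v \<noteq> c (cv v))"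
        using st0[OF v] \<rho> by auto
    qed simp
    then show "E (marks_pmf n k a 1 (weight n N (snd s) (child n s c)))
        (\<lambda>h. potential n d f N S cv k \<rho> a (update n s (child n s c) h)) \<le>
      C1 + C2 + (\<Sum>v\<in>core n s. ?B v (of_bool (c v \<noteq> c (cv v))))"
      using potential_marks[OF metric n diam _ f \<rho> a k, where N = N and S = S and cv = cv, OF cv]
      unfolding C1_def C2_def st_def by linarith
  qed
  also have "\<dots> = C1 + C2 + (\<Sum>v\<in>core n s. ?B v (E ?P (\<lambda>c. of_bool (c v \<noteq> c (cv v)))))"
    by (simp add: E_add E_sum finite_partition measure_pmf.prob_space)
  also have "\<dots> \<le> C1 + C2 + (\<Sum>v\<in>core n s. real (N v) * (if sep v then 2 * (2 * \<rho>) else 3 * st v (2 * \<rho>)))"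
  proof (intro add_left_mono sum_mono mult_left_mono)
    fix v assume v: "v \<in> core n s"
    then have "\<rho> * E ?P (\<lambda>c. of_bool (c v \<noteq> c (cv v))) \<le> st v (2 * \<rho>) - st v \<rho>"
      unfolding st_def using cv[of v] n by (intro separation_prob d0 \<rho>) (auto simp: core_def)
    then show "(if sep v then 3 * \<rho> else 3 * st v \<rho>) + (if sep v then 0 else 3 * \<rho>) * E ?P (\<lambda>c. of_bool (c v \<noteq> c (cv v)))
        \<le> (if sep v then 2 * (2 * \<rho>) else 3 * st v (2 * \<rho>))"
      using \<rho> by auto
  qed simp
  also have "\<dots> = potential n d f N S cv k (2 * \<rho>) (a / 2) s"
    unfolding potential_def C1_def C2_def sep_def st_def by simp
  finally show ?thesis .
qed

abbreviation initial :: state where "initial \<equiv> (\<lambda>_. 0, \<lambda>_. True)"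

lemma level_support:
  assumes "Metric_space {..<n} d" "0 \<le> \<rho>" "well_formed n s" "s' \<in> set_pmf (level_pmf n d N k \<rho> a z s)"
  shows "well_formed n s'" "diameter_le n d \<rho> s'"
proof -
  interpret Metric_space "{..<n}" d by fact
  obtain c h where c: "c \<in> set_pmf (partition_pmf n d k \<rho>)" and s': "s' = update n s (child n s c) h"
    using assms(4) by (auto simp: level_pmf_partition)
  interpret level_step n s c h by unfold_locales (rule assms(3))
  show "well_formed n s'"
    unfolding s' by (rule well_formed_update)
  show "diameter_le n d \<rho> s'"
    unfolding s' by (rule diameter_update[OF assms(1)]) (use partition_ball[OF assms(2) _ _ c] zero in auto)
qed

lemma marks_level0:
  assumes "0 < a" "\<And>w. 0 \<le> x w" "h \<in> set_pmf (marks_pmf n k a 0 x)" "w < n"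
  shows "h w"
proof -
  have "odds k a (x w) / (real 0 + odds k a (x w)) = 1"
    using odds_pos[OF assms(1) assms(2)[of w], of k] by simp
  moreover have "h w \<in> set_pmf (bernoulli_pmf (odds k a (x w) / (real 0 + odds k a (x w))))"
    using assms(3,4) by (auto simp: marks_pmf_Pi set_Pi_pmf PiE_dflt_def o_def)
  ultimately show ?thesis
    by (cases "h w") (auto simp: set_pmf_iff)
qed

text \<open>Every part is marked, so the core is everything. A group with clients contains a point
  of \<open>S\<close>, or all its clients are separated and each can be charged \<open>f\<close>.
  Groups and spread of \<open>S\<close> give \<open>2 * card S\<close>, the spread of all points
  gives 2, and the last term uses that \<open>saturate\<close> is at most 1.\<close>

lemma potential_initial:
  assumes metric: "Metric_space {..<n} d" and n: "0 < n" and S: "S \<subseteq> {..<n}"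
    and cv: "\<And>v. v < n \<Longrightarrow> cv v < n \<and> cv v \<in> S"
    and f: "0 \<le> f" and a: "0 < a" and h: "\<And>w. w < n \<Longrightarrow> h w"
  shows "potential n d f N S cv k \<rho> a (update n initial (child n initial c) h) \<le>
    f * (2 * card S + 2 + 64 * real k * card S) +
    (\<Sum>v<n. real (N v) * ((f + 2 * \<rho>) * of_bool (c v \<noteq> c (cv v)) + 
       (if c v \<noteq> c (cv v) then 0 else 3 * stretch n d v (cv v) \<rho>)))"
proof -
  interpret level_step n initial c h
    by unfold_locales (use n in \<open>auto simp: well_formed_def\<close>)
  have core: "core n initial = {..<n}" "core n s' = {..<n}"
    using h q_less by (auto simp: core_update) (auto simp: core_def)
  have fin: "finite S"
    using S finite_subset by blast
  have eq: "q (cv v) = q v \<longleftrightarrow> c v = c (cv v)" if "v < n" for v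
  proof -
    have "cv v \<in> core n initial" "v \<in> core n initial"
      using that cv[OF that] core(1) by simp_all
    note child_eq_iff[OF this, of c]
    then show ?thesis
      by (simp add: eq_commute[of "c v"])
  qed
  have sep: "separated n cv s' (fst s') v \<longleftrightarrow> c v \<noteq> c (cv v)" if "v < n" for v
    using that cv[OF that] core eq[OF that] separated_update[of v cv]
    by (simp add: separated_def)
  have "groups n N s' \<subseteq> q ` S \<union> q ` {v. v < n \<and> 0 < N v \<and> c v \<noteq> c (cv v)}"
  proof
    fix l assume "l \<in> groups n N s'"
    then obtain v where v: "v < n" "0 < N v" "l = fst s' v"
      unfolding groups_def by blast
    have l: "l = q v"
      using v update_marked[of v] core(2) by simp
    show "l \<in> q ` S \<union> q ` {v. v < n \<and> 0 < N v \<and> c v \<noteq> c (cv v)}"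
    proof (cases "c v = c (cv v)")
      case True
      then show ?thesis
        unfolding l using eq[OF v(1)] cv[OF v(1)] by (intro UnI1 image_eqI[of _ q "cv v"]) simp_all
    next
      case False
      then show ?thesis
        unfolding l using v by (intro UnI2 imageI) blast
    qed
  qed
  then have "card (groups n N s') \<le> card (q ` S \<union> q ` {v. v < n \<and> 0 < N v \<and> c v \<noteq> c (cv v)})"
    using fin by (intro card_mono) auto
  also have "\<dots> \<le> card (q ` S) + card (q ` {v. v < n \<and> 0 < N v \<and> c v \<noteq> c (cv v)})"
    by (rule card_Un_le)
  also have "\<dots> \<le> card S + card {v. v < n \<and> 0 < N v \<and> c v \<noteq> c (cv v)}"
    using fin by (intro add_mono card_image_le) auto
  also have "card {v. v < n \<and> 0 < N v \<and> c v \<noteq> c (cv v)} = (\<Sum>v<n. of_bool (0 < N v \<and> c v \<noteq> c (cv v)))"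
  proof -
    have "{v. v < n \<and> 0 < N v \<and> c v \<noteq> c (cv v)} = {..<n} \<inter> {v. 0 < N v \<and> c v \<noteq> c (cv v)}"
      by auto
    then show ?thesis
      by (simp add: of_bool_def sum.If_cases)
  qed
  also have "\<dots> \<le> (\<Sum>v<n. N v * of_bool (c v \<noteq> c (cv v)))"
    by (intro sum_mono) auto
  finally have "card (groups n N s') \<le> card S + (\<Sum>v<n. N v * of_bool (c v \<noteq> c (cv v)))"
    by simp
  then have "real (card (groups n N s')) \<le> real (card S + (\<Sum>v<n. N v * of_bool (c v \<noteq> c (cv v))))"
    by (rule of_nat_mono)
  then have "f * real (card (groups n N s')) \<le> f * (real (card S) + (\<Sum>v<n. real (N v) * of_bool (c v \<noteq> c (cv v))))"
    using f by (intro mult_left_mono) simp_all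
  then have groups: "f * real (card (groups n N s')) \<le>
      f * real (card S) + (\<Sum>v<n. real (N v) * (f * of_bool (c v \<noteq> c (cv v))))"
    by (simp only: distrib_left sum_distrib_left mult_ac)
  have points: "(\<Sum>v\<in>{..<n}. real (N v) * (if separated n cv s' (fst s') v then 2 * \<rho> else 3 * stretch n d v (cv v) \<rho>)) =
      (\<Sum>v<n. real (N v) * (2 * \<rho> * of_bool (c v \<noteq> c (cv v)) +
        (if c v \<noteq> c (cv v) then 0 else 3 * stretch n d v (cv v) \<rho>)))"
    by (intro sum.cong refl) (simp add: sep)
  have "spread (fst s') ({..<n} \<inter> S) \<le> real (card S)"
    using S by (simp add: spread_def Int_absorb1)
  then have spread1: "f * spread (fst s') ({..<n} \<inter> S) \<le> f * real (card S)"
    using f by (rule mult_left_mono)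
  have "f * (2 / real n) * spread (fst s') {..<n} \<le> f * (2 / real n) * real n"
    using f by (intro mult_left_mono) (auto simp: spread_def)
  then have spread2: "f * (2 / real n) * spread (fst s') {..<n} \<le> 2 * f"
    using n by simp
  have "(\<Sum>c\<in>{..<n} \<inter> S. 64 * real k * f * saturate (weight n N (snd s') (fst s') (fst s' c) / a)) \<le>
      (\<Sum>c\<in>{..<n} \<inter> S. 64 * real k * f)"
    using f a by (intro sum_mono mult_left_le saturate_bounds divide_nonneg_pos weight_nonneg) auto
  then have weights: "(\<Sum>c\<in>{..<n} \<inter> S. 64 * real k * f * saturate (weight n N (snd s') (fst s') (fst s' c) / a)) \<le>
      64 * real k * f * real (card S)"
    using S by (simp add: Int_absorb1 mult_ac)
  have "(\<Sum>v<n. real (N v) * (f * of_bool (c v \<noteq> c (cv v)))) + (\<Sum>v<n. real (N v) * (2 * \<rho> * of_bool (c v \<noteq> c (cv v)) +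
        (if c v \<noteq> c (cv v) then 0 else 3 * stretch n d v (cv v) \<rho>))) =
      (\<Sum>v<n. real (N v) * ((f + 2 * \<rho>) * of_bool (c v \<noteq> c (cv v)) + 
       (if c v \<noteq> c (cv v) then 0 else 3 * stretch n d v (cv v) \<rho>)))"
    unfolding sum.distrib[symmetric] by (rule sum.cong) (simp_all add: algebra_simps)
  then show ?thesis
    using groups spread1 spread2 weights unfolding potential_def core points by (simp add: algebra_simps)
qed

text \<open>A separated client pays \<open>f + 2 * \<rho>\<close> with
  \<open>f = \<rho> / e\<close>, hence at most \<open>3 / e\<close> times \<open>\<rho>\<close>;
  this is where the factor \<open>1 / e\<close> enters.\<close>

lemma level_initial:
  assumes metric: "Metric_space {..<n} d" and n: "0 < n" "n \<le> 2 ^ k" and S: "S \<subseteq> {..<n}"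
    and cv: "\<And>v. v < n \<Longrightarrow> cv v < n \<and> cv v \<in> S"
    and f: "0 \<le> f" and e: "0 < e" "e \<le> 1" and a: "0 < a"
  shows "E (level_pmf n d N k (e * f) a 0 initial) (potential n d f N S cv k (e * f) a) \<le>
    f * (2 * card S + 2 + 64 * real k * card S) +
    3 / e * (\<Sum>v<n. real (N v) * stretch n d v (cv v) (2 * (e * f)))"
proof -
  interpret Metric_space "{..<n}" d by fact
  define \<rho> where "\<rho> = e * f"
  have \<rho>: "0 \<le> \<rho>" "f = \<rho> / e"
    using f e by (auto simp: \<rho>_def)
  let ?P = "partition_pmf n d k \<rho>"
  let ?C = "f * (2 * card S + 2 + 64 * real k * card S)"
  define st where "st v = stretch n d v (cv v)" for v
  have st0: "0 \<le> st v t" if "v < n" for v t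
    unfolding st_def using that cv[of v] by (intro stretch_bound[OF metric]) auto
  let ?q = "child n initial"
  let ?B = "\<lambda>c. ?C + (\<Sum>v<n. real (N v) * ((f + 2 * \<rho>) * of_bool (c v \<noteq> c (cv v)) + 3 * st v \<rho>))"
  let ?M = "\<lambda>c. marks_pmf n k a 0 (weight n N (snd initial) (?q c))"
  let ?F = "\<lambda>c h. potential n d f N S cv k \<rho> a (update n initial (?q c) h)"
  have "E (level_pmf n d N k \<rho> a 0 initial) (potential n d f N S cv k \<rho> a) =
      E ?P (\<lambda>c. E (?M c) (?F c))"
    unfolding level_pmf_partition by (subst E_bind) (simp_all add: finite_partition finite_marks)
  also have "\<dots> \<le> E ?P (\<lambda>c. ?B c)"
  proof (rule E_mono[OF finite_partition])
    fix c
    have "E (?M c) (?F c) \<le> E (?M c) (\<lambda>h. ?B c)"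
    proof (rule E_mono[OF finite_marks])
      fix h assume h: "h \<in> set_pmf (?M c)"
      have "?F c h \<le>
        ?C + (\<Sum>v<n. real (N v) * ((f + 2 * \<rho>) * of_bool (c v \<noteq> c (cv v)) + 
       (if c v \<noteq> c (cv v) then 0 else 3 * stretch n d v (cv v) \<rho>)))"
        by (rule potential_initial[OF metric n(1) S _ f a])
           (use cv marks_level0[OF a weight_nonneg h] in auto)
      also have "\<dots> \<le> ?B c"
        by (intro add_left_mono sum_mono mult_left_mono) (use st0 in \<open>auto simp: st_def\<close>)
      finally show "?F c h \<le> ?B c" .
    qed
    then show "E (?M c) (?F c) \<le> ?B c"
      by (simp add: measure_pmf.prob_space)
  qed
  also have "\<dots> = ?C + (\<Sum>v<n. real (N v) * ((f + 2 * \<rho>) * E ?P (\<lambda>c. of_bool (c v \<noteq> c (cv v))) + 3 * st v \<rho>))"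
    by (simp add: E_add E_sum finite_partition measure_pmf.prob_space)
  also have "\<dots> \<le> ?C + (\<Sum>v<n. real (N v) * (3 / e * st v (2 * \<rho>)))"
  proof (intro add_left_mono sum_mono mult_left_mono)
    fix v assume "v \<in> {..<n}"
    then have v: "v < n" by simp
    let ?p = "E ?P (\<lambda>c. of_bool (c v \<noteq> c (cv v)))"
    have sep: "\<rho> * ?p \<le> st v (2 * \<rho>) - st v \<rho>"
      unfolding st_def using v cv[OF v] n(2) \<rho>(1) by (intro separation_prob) auto
    have e1: "1 / e + 2 \<le> 3 / e" "1 \<le> 1 / e"
      using e by (auto simp: field_simps)
    have "(f + 2 * \<rho>) * ?p = (1 / e + 2) * (\<rho> * ?p)"
      unfolding \<rho>(2) by (simp add: algebra_simps)
    also have "\<dots> \<le> (1 / e + 2) * (st v (2 * \<rho>) - st v \<rho>)"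
      using sep e by (intro mult_left_mono) auto
    also have "\<dots> \<le> 3 / e * (st v (2 * \<rho>) - st v \<rho>)"
      using e1 sep \<rho>(1) by (intro mult_right_mono order_trans[OF _ sep]) (auto intro!: mult_nonneg_nonneg integral_nonneg_AE)
    finally have "(f + 2 * \<rho>) * ?p \<le> 3 / e * (st v (2 * \<rho>) - st v \<rho>)" .
    moreover have "3 * st v \<rho> \<le> 3 / e * st v \<rho>"
      using e1 st0[OF v, of \<rho>] by (intro mult_right_mono) auto
    ultimately show "(f + 2 * \<rho>) * ?p + 3 * st v \<rho> \<le> 3 / e * st v (2 * \<rho>)"
      by (simp add: algebra_simps)
  qed simp
  also have "\<dots> = ?C + 3 / e * (\<Sum>v<n. real (N v) * st v (2 * \<rho>))"
    by (simp add: sum_distrib_left mult_ac)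
  finally show ?thesis
    unfolding \<rho>_def st_def .
qed

lemma num_bits: "n \<le> 2 ^ num_bits n" "2 \<le> num_bits n" "0 < num_bits n"
proof -
  have "n \<le> 2 ^ log_bound n"
    by (rule log_bound)
  also have "(2::nat) ^ log_bound n \<le> 2 ^ num_bits n"
    by (intro power_increasing) (auto simp: num_bits_def)
  finally show "n \<le> 2 ^ num_bits n" .
qed (auto simp: num_bits_def)

section \<open>Composition of the levels\<close>

lemma levels_Suc:
  "levels_pmf n d f \<epsilon> N (Suc m) = bind_pmf (levels_pmf n d f \<epsilon> N m)
     (level_pmf n d N (num_bits n) (min 1 \<epsilon> * f / 2 ^ m) (real (num_bits n) / min 1 \<epsilon> * 2 ^ m)
       (if m = 0 then 0 else 1))"
  by (simp add: levels_pmf_def)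

lemma finite_levels: "finite_pmf (levels_pmf n d f \<epsilon> N m)"
  unfolding levels_pmf_def by (intro finite_iter_pmf finite_level)

lemma levels_support:
  assumes "Metric_space {..<n} d" "0 < n" "0 \<le> f" "0 < \<epsilon>" "s \<in> set_pmf (levels_pmf n d f \<epsilon> N m)"
  shows "well_formed n s" "0 < m \<Longrightarrow> diameter_le n d (min 1 \<epsilon> * f / 2 ^ (m - 1)) s"
proof -
  let ?L = "\<lambda>m. level_pmf n d N (num_bits n) (min 1 \<epsilon> * f / 2 ^ m)
    (real (num_bits n) / min 1 \<epsilon> * 2 ^ m) (if m = 0 then 0 else 1)"
  have wf: "well_formed n s" if "s \<in> set_pmf (levels_pmf n d f \<epsilon> N m)" for s m
    using that
  proof (induction m arbitrary: s)
    case 0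
    then show ?case
      using assms(2) by (simp add: levels_pmf_def well_formed_def)
  next
    case (Suc m)
    then obtain s0 where s0: "s0 \<in> set_pmf (levels_pmf n d f \<epsilon> N m)"
      "s \<in> set_pmf (?L m s0)"
      unfolding levels_Suc by auto
    show ?case
      by (rule level_support(1)[OF assms(1) _ Suc.IH[OF s0(1)] s0(2)]) (use assms(3,4) in simp)
  qed
  then show "well_formed n s"
    using assms(5) by blast
  show "diameter_le n d (min 1 \<epsilon> * f / 2 ^ (m - 1)) s" if pos: "0 < m"
  proof -
    obtain m' where m: "m = Suc m'"
      using pos by (cases m) auto
    obtain s0 where s0: "s0 \<in> set_pmf (levels_pmf n d f \<epsilon> N m')"
      "s \<in> set_pmf (?L m' s0)"
      using assms(5) unfolding m levels_Suc by auto
    have "diameter_le n d (min 1 \<epsilon> * f / 2 ^ m') s"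
      by (rule level_support(2)[OF assms(1) _ wf[OF s0(1)] s0(2)]) (use assms(3,4) in simp)
    then show ?thesis
      by (simp add: m)
  qed
qed

lemma levels_potential:
  assumes metric: "Metric_space {..<n} d" and n: "0 < n" and S: "S \<subseteq> {..<n}"
    and cv: "\<And>v. v < n \<Longrightarrow> cv v < n \<and> cv v \<in> S"
    and f: "0 \<le> f" and \<epsilon>: "0 < \<epsilon>"
  defines "k \<equiv> num_bits n" and "e \<equiv> min 1 \<epsilon>"
  shows "E (levels_pmf n d f \<epsilon> N (Suc m)) (potential n d f N S cv k (e * f / 2 ^ m) (real k / e * 2 ^ m)) \<le>
    f * (2 * card S + 2 + 64 * real k * card S) +
    3 / e * (\<Sum>v<n. real (N v) * stretch n d v (cv v) (2 * (e * f)))"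
proof (induction m)
  case 0
  have e: "0 < e" "e \<le> 1"
    using \<epsilon> by (auto simp: e_def)
  have "levels_pmf n d f \<epsilon> N (Suc 0) = level_pmf n d N k (e * f) (real k / e) 0 initial"
    by (simp add: levels_pmf_def bind_return_pmf e_def k_def)
  then show ?case
    using level_initial[OF metric n num_bits(1) S _ f e, where cv = cv and N = N and a = "real k / e"] cv e num_bits(3)[of n]
    by (simp add: k_def)
next
  case (Suc m)
  have e: "0 < e" "e \<le> 1"
    using \<epsilon> by (auto simp: e_def)
  define \<rho> where "\<rho> = e * f / 2 ^ Suc m"
  define a where "a = real k / e * 2 ^ Suc m"
  have a: "0 < a" "a * \<rho> = real k * f" and \<rho>: "0 \<le> \<rho>"
    using e f num_bits(3)[of n] by (auto simp: a_def \<rho>_def k_def)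
  have half: "2 * \<rho> = e * f / 2 ^ m" "a / 2 = real k / e * 2 ^ m"
    by (simp_all add: \<rho>_def a_def)
  have "E (levels_pmf n d f \<epsilon> N (Suc (Suc m))) (potential n d f N S cv k \<rho> a) =
      E (levels_pmf n d f \<epsilon> N (Suc m)) (\<lambda>s. E (level_pmf n d N k \<rho> a 1 s) (potential n d f N S cv k \<rho> a))"
    unfolding levels_Suc[of _ _ _ _ _ "Suc m"]
    by (subst E_bind) (simp_all add: finite_levels finite_level \<rho>_def a_def k_def e_def)
  also have "\<dots> \<le> E (levels_pmf n d f \<epsilon> N (Suc m)) (potential n d f N S cv k (2 * \<rho>) (a / 2))"
  proof (rule E_mono[OF finite_levels])
    fix s assume s: "s \<in> set_pmf (levels_pmf n d f \<epsilon> N (Suc m))"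
    note sup = levels_support[OF metric n f \<epsilon> s]
    show "E (level_pmf n d N k \<rho> a 1 s) (potential n d f N S cv k \<rho> a) \<le>
        potential n d f N S cv k (2 * \<rho>) (a / 2) s"
      by (rule level_potential[OF metric n _ sup(1) _ _ f \<rho> a])
         (use sup(2) cv num_bits[of n] half in \<open>simp_all add: k_def e_def\<close>)
  qed
  also have "\<dots> \<le> f * (2 * card S + 2 + 64 * real k * card S) +
    3 / e * (\<Sum>v<n. real (N v) * stretch n d v (cv v) (2 * (e * f)))"
    unfolding half by (rule Suc.IH)
  finally show ?case
    unfolding \<rho>_def a_def .
qed

section \<open>From the final state to the cost of the output\<close>

lemma metric_partition_output:
  "Metric_space {..<n} (snd (partition_output n s))"
  \<comment> \<open>Different points have distance 1 or 2, so the triangle inequality cannot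
    fail.\<close>
  by unfold_locales (auto simp: partition_output_def)

lemma valid_partition_output:
  assumes "well_formed n s" "0 < n"
  shows "valid_output n (partition_output n s)"
proof -
  have "fst s 0 \<in> fst (partition_output n s)"
    using assms by (auto simp: well_formed_def partition_output_def)
  then show ?thesis
    using metric_partition_output[of n s] by (auto simp: partition_output_def)
qed

text \<open>The own facility is at distance at most 1 and every other location of \<open>R\<close>
  at distance 2, so no ties have to be resolved.\<close>

lemma opened_partition_output:
  assumes "well_formed n s"
  shows "opened n N (partition_output n s) = groups n N s"
proof -
  obtain R D where RD: "partition_output n s = (R, D)"
    by fastforce
  have R: "R = {v. v < n \<and> fst s v = v}"
    and D: "D u v = (if u < n \<and> v < n then if u = v then 0 else if fst s u = fst s v then 1 else 2 else 0)" for u v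
    using RD by (auto simp: partition_output_def)
  have "nearest D R v = fst s v" if v: "v < n" for v
  proof -
    have A: "fst s v < n" "fst s (fst s v) = fst s v"
      using assms v by (auto simp: well_formed_def)
    have best: "D v (fst s v) < D v r" if "r \<in> R" "r \<noteq> fst s v" for r
      using that v A by (auto simp: R D)
    show ?thesis
      unfolding nearest_def
    proof (rule Least_equality)
      show "fst s v \<in> R \<and> (\<forall>t\<in>R. D v (fst s v) \<le> D v t)"
        using A best by (auto simp: R intro: less_imp_le)
      show "fst s v \<le> r" if "r \<in> R \<and> (\<forall>t\<in>R. D v r \<le> D v t)" for r
        using that best[of r] A by (force simp: R)
    qed
  qed
  then have "nearest D R ` {v. v < n \<and> 0 < N v} = fst s ` {v. v < n \<and> 0 < N v}"
    by (intro image_cong) auto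
  then show ?thesis
    unfolding RD by (simp add: groups_def setcompr_eq_image)
qed

text \<open>Below the gap a core point has distance 0 from its facility, and a settled point pays at
  most its reach; the remaining summands are nonnegative.\<close>

lemma cost_le_potential:
  assumes metric: "Metric_space {..<n} d" and n: "0 < n" and wf: "well_formed n s"
    and diam: "diameter_le n d \<rho> s" and \<rho>: "0 \<le> \<rho>" "\<rho> < gap n d" and f: "0 \<le> f" and a: "0 < a"
    and cv: "\<And>v. v < n \<Longrightarrow> cv v < n"
  shows "ufl_cost n d f N (opened n N (partition_output n s)) \<le> potential n d f N S cv k \<rho> a s"
proof -
  interpret Metric_space "{..<n}" d by fact
  let ?G = "groups n N s"
  have finG: "finite ?G"
    by (simp add: groups_def)
  have conn: "real (N v) * dist_set d v ?G \<le> (if v \<in> core n s then 0 else real (N v) * reach n d s v)" if v: "v < n" for v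
  proof (cases "N v = 0")
    case False
    then have "fst s v \<in> ?G"
      using v by (auto simp: groups_def)
    then have le: "dist_set d v ?G \<le> d v (fst s v)"
      unfolding dist_set_def using finG by (intro Min_le) auto
    show ?thesis
    proof (cases "v \<in> core n s")
      case True
      then have "d v (fst s v) \<le> \<rho>"
        using diam wf v by (auto simp: diameter_le_def well_formed_def core_def)
      then have "\<not> 0 < d v (fst s v)"
        using gap_le[of v n "fst s v" d] wf v \<rho> by (auto simp: well_formed_def)
      then have "real (N v) * dist_set d v ?G \<le> 0"
        using le by (simp add: mult_nonneg_nonpos)
      then show ?thesis
        using True by simp
    next
      case nc: False
      have "dist_set d v ?G \<le> reach n d s v"
        using le le_reach[of d v s n] by linarith
      then show ?thesis
        using nc by (simp add: mult_left_mono)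
    qed
  next
    case True
    then show ?thesis by simp
  qed
  have "(\<Sum>v<n. real (N v) * dist_set d v ?G) \<le> (\<Sum>v<n. if v \<in> core n s then 0 else real (N v) * reach n d s v)"
    using conn by (intro sum_mono) auto
  also have "\<dots> = (\<Sum>v\<in>{..<n} - core n s. real (N v) * reach n d s v)"
    by (simp add: sum.If_cases Diff_eq Compl_eq)
  finally have 1: "(\<Sum>v<n. real (N v) * dist_set d v ?G) \<le> (\<Sum>v\<in>{..<n} - core n s. real (N v) * reach n d s v)" .
  have 2: "0 \<le> (\<Sum>v\<in>core n s. real (N v) * (if separated n cv s (fst s) v then 2 * \<rho> else 3 * stretch n d v (cv v) \<rho>))"
    using \<rho>(1) cv by (intro sum_nonneg) (auto intro!: mult_nonneg_nonneg stretch_bound[OF metric] simp: core_def)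
  have 3: "0 \<le> f * spread (fst s) (core n s \<inter> S)" "0 \<le> f * (2 / real n) * spread (fst s) (core n s)"
    using f by (auto intro!: mult_nonneg_nonneg divide_nonneg_nonneg spread_nonneg)
  have 4: "0 \<le> (\<Sum>c\<in>core n s \<inter> S. 64 * real k * f * saturate (weight n N (snd s) (fst s) (fst s c) / a))"
    using f a by (intro sum_nonneg mult_nonneg_nonneg saturate_bounds divide_nonneg_pos weight_nonneg) auto
  show ?thesis
    unfolding opened_partition_output[OF wf] ufl_cost_def potential_def
    using 1 2 3 4 by (simp add: mult.commute)
qed

section \<open>Privacy\<close>

lemma E_ratio:
  assumes "finite_pmf p" "finite_pmf p'" "\<And>x. pmf p x \<le> r * pmf p' x" "\<And>x. 0 \<le> g x"
  shows "E p g \<le> r * E p' g"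
proof -
  let ?A = "set_pmf p \<union> set_pmf p'"
  have "E p g = (\<Sum>x\<in>?A. g x * pmf p x)"
    by (rule integral_measure_pmf_real) (use assms(1,2) in auto)
  also have "\<dots> \<le> (\<Sum>x\<in>?A. g x * (r * pmf p' x))"
    by (intro sum_mono mult_left_mono assms)
  also have "\<dots> = r * (\<Sum>x\<in>?A. g x * pmf p' x)"
    by (simp add: sum_distrib_left mult_ac)
  also have "(\<Sum>x\<in>?A. g x * pmf p' x) = E p' g"
    by (rule integral_measure_pmf_real[symmetric]) (use assms(1,2) in auto)
  finally show ?thesis .
qed

lemma odds_ratio:
  assumes "0 < a" "0 \<le> x" "0 \<le> y" "x \<le> y + 1"
  shows "odds k a x \<le> exp (real k / a) * odds k a y"
proof -
  have "a * x \<le> a * (y + 1)"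
    using assms by (intro mult_left_mono) auto
  moreover have "0 \<le> y"
    by (rule assms(3))
  ultimately have "x + a \<le> (1 + 1 / a) * (y + a)"
    using assms(1) by (simp add: field_simps)
  also have "\<dots> \<le> exp (1 / a) * (y + a)"
    using assms by (intro mult_right_mono exp_ge_add_one_self) auto
  finally have "(x + a) / (4 * a) \<le> exp (1 / a) * ((y + a) / (4 * a))"
    using assms(1) by (simp add: divide_right_mono)
  then have "odds k a x \<le> (exp (1 / a) * ((y + a) / (4 * a))) ^ k"
    unfolding odds_def using assms by (intro power_mono) auto
  also have "\<dots> = exp (1 / a) ^ k * odds k a y"
    unfolding odds_def by (rule power_mult_distrib)
  also have "exp (1 / a) ^ k = exp (real k / a)"
    by (simp add: exp_of_nat_mult[symmetric])
  finally show ?thesis .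
qed

text \<open>Close odds control both outcomes: the probability \<open>1 / (1 + x)\<close> of
  \<open>False\<close> is bounded by the reverse inequality between the odds.\<close>

lemma bernoulli_ratio:
  fixes r x y :: real
  assumes "0 < x" "0 < y" "1 \<le> r" "x \<le> r * y" "y \<le> r * x"
  shows "pmf (bernoulli_pmf (x / (1 + x))) b \<le> r * pmf (bernoulli_pmf (y / (1 + y))) b"
proof -
  have rxy: "1 * (x * y) \<le> r * (x * y)"
    using assms by (intro mult_right_mono) auto
  have "x + x * y \<le> r * y + r * (x * y)"
    using assms(4) rxy by linarith
  then have "x / (1 + x) \<le> r * (y / (1 + y))"
    using assms(1,2) by (simp add: field_simps)
  moreover have "1 - x / (1 + x) \<le> r * (1 - y / (1 + y))"
    using assms by (simp add: field_simps)
  moreover have "0 \<le> x / (1 + x)" "x / (1 + x) \<le> 1" "0 \<le> y / (1 + y)" "y / (1 + y) \<le> 1"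
    using assms by auto
  ultimately show ?thesis
    by (cases b) simp_all
qed

lemma neighbours_cases:
  assumes "neighbours n N N'"
  obtains v0 where "v0 < n" "\<bar>int (N v0) - int (N' v0)\<bar> = 1" "\<And>v. v < n \<Longrightarrow> v \<noteq> v0 \<Longrightarrow> N v = N' v"
proof -
  let ?D = "\<lambda>v. \<bar>int (N v) - int (N' v)\<bar>"
  have sum: "(\<Sum>v<n. ?D v) = 1"
    using assms by (simp add: neighbours_def)
  then obtain v0 where v0: "v0 < n" "?D v0 \<noteq> 0"
    by (metis (no_types, lifting) lessThan_iff sum.neutral zero_neq_one)
  have split: "(\<Sum>v<n. ?D v) = ?D v0 + (\<Sum>v\<in>{..<n} - {v0}. ?D v)"
    using v0(1) by (simp add: sum.remove)
  have nn: "0 \<le> (\<Sum>v\<in>{..<n} - {v0}. ?D v)"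
    by (rule sum_nonneg) simp
  then have one: "?D v0 = 1" and zero: "(\<Sum>v\<in>{..<n} - {v0}. ?D v) = 0"
    using sum split v0(2) by linarith+
  have "\<forall>v\<in>{..<n} - {v0}. ?D v = 0"
    using zero by (subst (asm) sum_nonneg_eq_0_iff) auto
  then show ?thesis
    using that[OF v0(1) one] by auto
qed

lemma weight_neighbours:
  assumes "v0 < n" "\<bar>int (N v0) - int (N' v0)\<bar> = 1" "\<And>v. v < n \<Longrightarrow> v \<noteq> v0 \<Longrightarrow> N v = N' v"
  shows "w \<noteq> q v0 \<Longrightarrow> weight n N X q w = weight n N' X q w"
    and "weight n N X q w \<le> weight n N' X q w + 1" "weight n N' X q w \<le> weight n N X q w + 1"
proof -
  have split: "weight n M X q w = (if X v0 \<and> q v0 = w then real (M v0) else 0) +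
      (\<Sum>v\<in>{..<n} - {v0}. if X v \<and> q v = w then real (M v) else 0)" for M
    unfolding weight_def using assms(1) by (simp add: sum.remove)
  have rest: "(\<Sum>v\<in>{..<n} - {v0}. if X v \<and> q v = w then real (N v) else 0) =
      (\<Sum>v\<in>{..<n} - {v0}. if X v \<and> q v = w then real (N' v) else 0)"
    using assms(3) by (intro sum.cong) auto
  have "real (N v0) \<le> real (N' v0) + 1" "real (N' v0) \<le> real (N v0) + 1"
    using assms(2) by linarith+
  then show "w \<noteq> q v0 \<Longrightarrow> weight n N X q w = weight n N' X q w"
    and "weight n N X q w \<le> weight n N' X q w + 1" "weight n N' X q w \<le> weight n N X q w + 1"
    unfolding split[of N] split[of N'] rest by auto
qed

text \<open>The client in which the inputs differ lies in a single part, so all other factors of the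
  product agree and the ratio is paid only once.\<close>

lemma marks_ratio:
  assumes "0 < a" "neighbours n N N'"
  shows "pmf (marks_pmf n k a 1 (weight n N X q)) h \<le>
    exp (real k / a) * pmf (marks_pmf n k a 1 (weight n N' X q)) h"
proof -
  obtain v0 where v0: "v0 < n" "\<bar>int (N v0) - int (N' v0)\<bar> = 1" "\<And>v. v < n \<Longrightarrow> v \<noteq> v0 \<Longrightarrow> N v = N' v"
    by (rule neighbours_cases[OF assms(2)]) (rule that; blast)
  have W: "w \<noteq> q v0 \<Longrightarrow> weight n N X q w = weight n N' X q w"
    "weight n N X q w \<le> weight n N' X q w + 1" "weight n N' X q w \<le> weight n N X q w + 1" for w
    using weight_neighbours[where n = n and N = N and N' = N' and q = q and w = w and X = X and ?v0.0 = v0] v0 by blast+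
  define p where "p M u = pmf (bernoulli_pmf (odds k a (weight n M X q u) / (1 + odds k a (weight n M X q u)))) (h u)" for M u
  let ?r = "exp (real k / a)"
  have r: "1 \<le> ?r"
    using assms(1) by simp
  show ?thesis
  \<comment> \<open>A function that is not \<open>False\<close> from \<open>n\<close> on has
    probability 0 in the product.\<close>
  proof (cases "\<forall>u. u \<notin> {..<n} \<longrightarrow> h u = False")
    case True
    have "(\<Prod>u<n. p N u) \<le> (\<Prod>u<n. (if u = q v0 then ?r else 1) * p N' u)"
    proof (intro prod_mono conjI)
      fix u
      show "0 \<le> p N u"
        by (simp add: p_def)
      show "p N u \<le> (if u = q v0 then ?r else 1) * p N' u"
      proof (cases "u = q v0")
        case True
        have "p N u \<le> ?r * p N' u"
          unfolding p_def using assms(1) r W(2,3)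
          by (intro bernoulli_ratio odds_pos odds_ratio weight_nonneg)
        then show ?thesis
          using True by simp
      next
        case False
        then show ?thesis
          using W(1)[OF False] by (simp add: p_def)
      qed
    qed
    also have "\<dots> = (\<Prod>u<n. if u = q v0 then ?r else 1) * (\<Prod>u<n. p N' u)"
      by (rule prod.distrib)
    also have "\<dots> \<le> ?r * (\<Prod>u<n. p N' u)"
      using r by (intro mult_right_mono prod_nonneg) (auto simp: p_def prod.delta)
    finally show ?thesis
      using True by (simp add: marks_pmf_Pi pmf_Pi p_def)
  next
    case False
    then show ?thesis
      by (auto simp: marks_pmf_Pi pmf_Pi)
  qed
qed

lemma marks_unit:
  assumes "0 < a" "\<And>u. 0 \<le> x u" "\<And>u. 0 \<le> y u"
  shows "marks_pmf n k a 0 x = marks_pmf n k a 0 y"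
proof -
  have "odds k a (x u) / (real 0 + odds k a (x u)) = odds k a (y u) / (real 0 + odds k a (y u))" for u
    using odds_pos[OF assms(1) assms(2)[of u], of k] odds_pos[OF assms(1) assms(3)[of u], of k] by simp
  then show ?thesis
    by (simp add: marks_pmf_def)
qed

lemma level_ratio:
  assumes "0 < a" "neighbours n N N'" "\<And>x. 0 \<le> g x"
  shows "E (level_pmf n d N k \<rho> a (if i = 0 then 0 else 1) s) g \<le>
    exp (if i = 0 then 0 else real k / a) * E (level_pmf n d N' k \<rho> a (if i = 0 then 0 else 1) s) g"
proof -
  let ?z = "if i = 0 then 0 else 1 :: nat"
  let ?r = "exp (if i = 0 then 0 else real k / a)"
  let ?q = "\<lambda>c. child n s c"
  let ?P = "partition_pmf n d k \<rho>"
  have level: "E (level_pmf n d M k \<rho> a ?z s) g =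
      E ?P (\<lambda>c. E (marks_pmf n k a ?z (weight n M (snd s) (?q c))) (\<lambda>h. g (update n s (?q c) h)))" for M
    unfolding level_pmf_partition by (subst E_bind) (simp_all add: finite_partition finite_marks)
  have "E (level_pmf n d N k \<rho> a ?z s) g \<le> E ?P (\<lambda>c. ?r *
      E (marks_pmf n k a ?z (weight n N' (snd s) (?q c))) (\<lambda>h. g (update n s (?q c) h)))"
    unfolding level
  proof (intro E_mono finite_partition E_ratio finite_marks assms(3))
    fix c h
    show "pmf (marks_pmf n k a ?z (weight n N (snd s) (?q c))) h \<le>
        ?r * pmf (marks_pmf n k a ?z (weight n N' (snd s) (?q c))) h"
    proof (cases "i = 0")
      case True
      have "marks_pmf n k a 0 (weight n N (snd s) (?q c)) = marks_pmf n k a 0 (weight n N' (snd s) (?q c))"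
        by (rule marks_unit[OF assms(1)]) (rule weight_nonneg)+
      then show ?thesis
        using True by simp
    next
      case False
      then show ?thesis
        using marks_ratio[OF assms(1,2)] by simp
    qed
  qed
  also have "\<dots> = ?r * E (level_pmf n d N' k \<rho> a ?z s) g"
    unfolding level by simp
  finally show ?thesis .
qed

text \<open>Composition over the levels. Nonnegative functions take the place of events because the
  induction applies the claim to the expected value of \<open>g\<close> after the last
  level.\<close>

lemma levels_ratio:
  assumes "0 < \<epsilon>" "neighbours n N N'" "\<And>x. 0 \<le> g x"
  shows "E (levels_pmf n d f \<epsilon> N m) g \<le> exp \<epsilon> * E (levels_pmf n d f \<epsilon> N' m) g"
proof -
  let ?e = "\<lambda>i. if i = 0 then 0 else min 1 \<epsilon> / 2 ^ i :: real"
  have "E (levels_pmf n d f \<epsilon> N m) g \<le> exp (\<Sum>i<m. ?e i) * E (levels_pmf n d f \<epsilon> N' m) g"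
    using assms(3)
  proof (induction m arbitrary: g)
    case (Suc m)
    let ?a = "real (num_bits n) / min 1 \<epsilon> * 2 ^ m"
    let ?L = "\<lambda>N. level_pmf n d N (num_bits n) (min 1 \<epsilon> * f / 2 ^ m) ?a (if m = 0 then 0 else 1)"
    have a: "0 < ?a" "real (num_bits n) / ?a = min 1 \<epsilon> / 2 ^ m"
      using assms(1) num_bits(3)[of n] by auto
    have "E (levels_pmf n d f \<epsilon> N (Suc m)) g = E (levels_pmf n d f \<epsilon> N m) (\<lambda>s. E (?L N s) g)"
      unfolding levels_Suc by (rule E_bind) (simp_all add: finite_levels finite_level)
    also have "\<dots> \<le> E (levels_pmf n d f \<epsilon> N m) (\<lambda>s. exp (?e m) * E (?L N' s) g)"
      using level_ratio[where g = g and i = m and k = "num_bits n", OF a(1) assms(2) Suc.prems] unfolding a(2)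
      by (intro E_mono finite_levels)
    also have "\<dots> \<le> exp (\<Sum>i<m. ?e i) * E (levels_pmf n d f \<epsilon> N' m) (\<lambda>s. exp (?e m) * E (?L N' s) g)"
      using Suc.prems by (intro Suc.IH mult_nonneg_nonneg integral_nonneg_AE) auto
    also have "\<dots> = exp (\<Sum>i<Suc m. ?e i) * E (levels_pmf n d f \<epsilon> N' m) (\<lambda>s. E (?L N' s) g)"
      by (simp add: exp_add)
    also have "E (levels_pmf n d f \<epsilon> N' m) (\<lambda>s. E (?L N' s) g) = E (levels_pmf n d f \<epsilon> N' (Suc m)) g"
      unfolding levels_Suc by (rule E_bind[symmetric]) (simp_all add: finite_levels finite_level)
    finally show ?case .
  qed (simp add: levels_pmf_def)
  \<comment> \<open>A geometric series starting at \<open>i = 1\<close>, since the first level is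
    free.\<close>
  also have "(\<Sum>i<m. ?e i) \<le> \<epsilon>"
  proof (cases m)
    case (Suc m')
    have "(\<Sum>i<Suc m'. ?e i) = min 1 \<epsilon> * (1 - 1 / 2 ^ m')"
      by (induction m') (simp_all add: field_simps)
    also have "\<dots> \<le> min 1 \<epsilon> * 1"
      using assms(1) by (intro mult_left_mono) auto
    finally show ?thesis
      using Suc by simp
  qed (use assms(1) in simp)
  then have "exp (\<Sum>i<m. ?e i) * E (levels_pmf n d f \<epsilon> N' m) g \<le> exp \<epsilon> * E (levels_pmf n d f \<epsilon> N' m) g"
    using assms(3) by (intro mult_right_mono integral_nonneg_AE) auto
  finally show ?thesis .
qed

lemma private_ufl:
  assumes "1 \<le> n" "0 < \<epsilon>"
  shows "differentially_private n \<epsilon> (ufl_algorithm ufl_com n d f \<epsilon>)"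
  unfolding differentially_private_def
proof (intro allI impI)
  fix N N' T
  assume nb: "neighbours n N N'"
  let ?m = "Suc (depth n d f \<epsilon>)"
  have prob: "measure_pmf.prob (ufl_algorithm ufl_com n d f \<epsilon> M) T =
      E (levels_pmf n d f \<epsilon> M ?m) (\<lambda>s. of_bool (s \<in> partition_output n -` T))" for M
    unfolding ufl_algorithm_eq[OF assms(1)] measure_map_pmf E_of_bool ..
  show "measure_pmf.prob (ufl_algorithm ufl_com n d f \<epsilon> N) T \<le>
      exp \<epsilon> * measure_pmf.prob (ufl_algorithm ufl_com n d f \<epsilon> N') T"
    unfolding prob by (rule levels_ratio[OF assms(2) nb]) simp
qed

section \<open>Running time\<close>

lemma number_size_ge: "1 \<le> number_size x" "x \<noteq> 0 \<Longrightarrow> \<bar>log 2 \<bar>x\<bar>\<bar> \<le> number_size x"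
  by (simp_all add: number_size_def)

lemma input_size_ge:
  shows "real n \<le> input_size n d f \<epsilon> N" "1 \<le> input_size n d f \<epsilon> N"
    "number_size f \<le> input_size n d f \<epsilon> N"
    "u < n \<Longrightarrow> v < n \<Longrightarrow> number_size f + number_size (d u v) \<le> input_size n d f \<epsilon> N"
proof -
  have pos: "0 \<le> number_size x" for x
    using number_size_ge(1)[of x] by linarith
  have 1: "0 \<le> (\<Sum>u<n. \<Sum>v<n. number_size (d u v))" "0 \<le> (\<Sum>v<n. number_size (real (N v)))"
    by (intro sum_nonneg pos)+
  then show "real n \<le> input_size n d f \<epsilon> N" "1 \<le> input_size n d f \<epsilon> N"
    "number_size f \<le> input_size n d f \<epsilon> N"
    using number_size_ge(1)[of f] number_size_ge(1)[of \<epsilon>] unfolding input_size_def by linarith+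
  assume uv: "u < n" "v < n"
  have "number_size (d u v) \<le> (\<Sum>v<n. number_size (d u v))"
    by (rule member_le_sum) (use uv pos in auto)
  also have "\<dots> \<le> (\<Sum>u<n. \<Sum>v<n. number_size (d u v))"
    by (rule member_le_sum[where f = "\<lambda>u. \<Sum>v<n. number_size (d u v)"]) (use uv pos in \<open>auto intro: sum_nonneg\<close>)
  finally show "number_size f + number_size (d u v) \<le> input_size n d f \<epsilon> N"
    using 1 pos[of \<epsilon>] unfolding input_size_def by linarith
qed

text \<open>The depth is about the logarithm of \<open>f / gap\<close>, and the gap is 1 or one of
  the given distances, so both logarithms are counted in the input size.\<close>

lemma depth_le:
  assumes "0 \<le> f" "0 < \<epsilon>"
  shows "real (depth n d f \<epsilon>) \<le> input_size n d f \<epsilon> N + 1"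
proof (cases "depth n d f \<epsilon>")
  case 0
  then show ?thesis
    using input_size_ge(2)[of n d f \<epsilon> N] by simp
next
  case (Suc i)
  have "gap n d \<le> min 1 \<epsilon> * f / 2 ^ i"
    by (rule not_depth) (simp add: Suc)
  also have "\<dots> \<le> f / 2 ^ i"
    using assms by (intro divide_right_mono) (auto simp: mult_left_le_one_le)
  finally have le: "gap n d \<le> f / 2 ^ i" .
  then have "0 < f / 2 ^ i"
    using gap_pos[of n d] by linarith
  then have f: "0 < f"
    by (simp add: zero_less_divide_iff)
  have "2 ^ i \<le> f / gap n d"
    using le gap_pos[of n d] by (simp add: field_simps)
  then have "log 2 (2 ^ i) \<le> log 2 (f / gap n d)"
    using f gap_pos[of n d] by (subst log_le_cancel_iff) auto
  then have "real i \<le> log 2 f - log 2 (gap n d)"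
    using f gap_pos[of n d] by (simp add: log_divide log_nat_power)
  also have "\<dots> \<le> input_size n d f \<epsilon> N"
  proof (cases rule: gap_cases[of n d])
    case 1
    then show ?thesis
      using number_size_ge(2)[of f] input_size_ge(3)[of f n d \<epsilon> N] f by simp
  next
    case (2 u v)
    then show ?thesis
      using number_size_ge(2)[of f] number_size_ge(2)[of "d u v"] input_size_ge(4)[of u n v f d \<epsilon> N] f by simp
  qed
  finally show ?thesis
    by (simp add: Suc)
qed

lemma efficient_ufl: "efficient ufl_com"
  unfolding efficient_def
proof (rule exI, rule exI, intro allI impI)
  fix n d f N and \<epsilon> :: real
  assume inst: "ufl_instance n d f \<and> 0 < \<epsilon>"
  define B where "B = n + num_bits n + Suc (depth n d f \<epsilon>)"
  define c where "c = com_size ufl_com"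
  let ?s = "input_size n d f \<epsilon> N"
  have "real (num_bits n) \<le> 3 + real n"
    using log_bound_le[of n] by (simp add: num_bits_def)
  moreover have "real (depth n d f \<epsilon>) \<le> ?s + 1"
    using inst by (intro depth_le) (auto simp: ufl_instance_def)
  \<comment> \<open>\<open>Suc B\<close> is at most \<open>2 * n + 6\<close> plus the input size,
    which in turn is at least \<open>n\<close> and at least 1.\<close>
  ultimately have "real (Suc B) \<le> 10 * ?s"
    using input_size_ge(1,2)[of n d f \<epsilon> N] unfolding B_def by simp
  then have "real (Suc B) ^ c \<le> (10 * ?s) ^ c"
    by (intro power_mono) auto
  moreover have "real (time_bound B ufl_com) \<le> real c * real (Suc B) ^ c"
    using time_bound_le[of B ufl_com] unfolding c_def
    by (metis of_nat_le_iff of_nat_mult of_nat_power)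
  ultimately have "real (time_bound B ufl_com) \<le> real c * (10 * ?s) ^ c"
    by (meson mult_left_mono of_nat_0_le_iff order_trans)
  then have "real (time_bound B ufl_com) \<le> real (com_size ufl_com) * 10 ^ com_size ufl_com * ?s ^ com_size ufl_com"
    by (simp add: c_def power_mult_distrib mult.assoc)
  moreover have "halts_within ufl_com (input_store n d f \<epsilon> N) (time_bound B ufl_com)"
    unfolding B_def by (rule halts_within_ufl) (use inst in \<open>simp add: ufl_instance_def\<close>)
  ultimately show "\<exists>t. real t \<le> real (com_size ufl_com) * 10 ^ com_size ufl_com * ?s ^ com_size ufl_com \<and>
      halts_within ufl_com (input_store n d f \<epsilon> N) t"
    by blast
qed

section \<open>Approximation ratio\<close>

lemma ufl_cost_nonneg:
  assumes "Metric_space {..<n} d" "0 \<le> f" "feasible n N S"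
  shows "0 \<le> ufl_cost n d f N S"
proof -
  interpret Metric_space "{..<n}" d by fact
  have "0 \<le> real (N v) * dist_set d v S" if "v < n" for v
  proof (cases "S = {}")
    case True
    then show ?thesis
      using assms(3) that by (simp add: feasible_def)
  next
    case False
    have "finite S"
      using assms(3) finite_subset by (auto simp: feasible_def)
    then have "0 \<le> dist_set d v S"
      unfolding dist_set_def using False by (subst Min_ge_iff) auto
    then show ?thesis
      by simp
  qed
  then show ?thesis
    unfolding ufl_cost_def using assms(2) by (intro add_nonneg_nonneg sum_nonneg) auto
qed

lemma ufl_opt_attained:
  assumes "1 \<le> n"
  obtains S where "feasible n N S" "ufl_opt n d f N = ufl_cost n d f N S"
proof -
  have "finite {S. feasible n N S}"
    by (rule finite_subset[of _ "Pow {..<n}"]) (auto simp: feasible_def)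
  moreover have "feasible n N {..<n}"
    using assms by (auto simp: feasible_def)
  ultimately have "ufl_opt n d f N \<in> ufl_cost n d f N ` {S. feasible n N S}"
    unfolding ufl_opt_def by (intro Min_in) auto
  then show ?thesis
    using that by auto
qed

text \<open>From \<open>2 / 3 \<le> ln 2 \<le> ln n\<close> follows
  \<open>1 \<le> 3 / 2 * ln n\<close>, which absorbs the constants in the bounds
  \<open>4 + 3 / 2 * ln n\<close> and \<open>1 + ln n\<close>.\<close>

lemma log_factors:
  assumes "2 \<le> n"
  shows "real (num_bits n) \<le> 15 / 2 * ln (real n)" "harm n \<le> 5 / 2 * ln (real n)"
proof -
  have l2: "2 / 3 \<le> ln (2::real)"
    by (rule ln2_ge_two_thirds)
  also have mono: "ln (2::real) \<le> ln (real n)"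
    using assms by simp
  finally have ln: "1 \<le> 3 / 2 * ln (real n)"
    by simp
  have "harm n - ln (real n) \<le> harm 1 - ln (real 1)"
    using assms by (intro euler_mascheroni_sequence_decreasing) auto
  then have "harm n \<le> 1 + ln (real n)"
    by (simp add: harm_def)
  then show "harm n \<le> 5 / 2 * ln (real n)"
    using ln by simp
  have "real (log_bound n) \<le> 1 + 3 / 2 * ln (real n)"
  proof (cases "log_bound n")
    case 0
    then show ?thesis
      using ln by simp
  next
    case (Suc j)
    have "2 ^ j < n"
      by (rule not_log_bound) (simp add: Suc)
    then have "real (2 ^ j) < real n"
      by (simp only: of_nat_less_iff)
    then have "ln (2 ^ j :: real) \<le> ln (real n)"
      using assms by (subst ln_le_cancel_iff) auto
    then have "real j * ln 2 \<le> ln (real n)"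
      by (simp add: ln_realpow)
    moreover have "real j * (2 / 3) \<le> real j * ln 2"
      using l2 by (intro mult_left_mono) auto
    ultimately show ?thesis
      by (simp add: Suc)
  qed
  then show "real (num_bits n) \<le> 15 / 2 * ln (real n)"
    using ln by (simp add: num_bits_def)
qed

lemma approximation_ufl:
  assumes inst: "ufl_instance n d f" and \<epsilon>: "0 < \<epsilon>" and n: "2 \<le> n"
  shows "expected_cost n d f N (ufl_algorithm ufl_com n d f \<epsilon> N) \<le>
    600 * (ln (real n) / min 1 \<epsilon>) * ufl_opt n d f N"
proof -
  have metric: "Metric_space {..<n} d" and f: "0 \<le> f" and n1: "1 \<le> n" "0 < n"
    using inst n by (auto simp: ufl_instance_def)
  interpret Metric_space "{..<n}" d by fact
  define M where "M = depth n d f \<epsilon>"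
  define e where "e = min 1 \<epsilon>"
  define k where "k = num_bits n"
  define L where "L = levels_pmf n d f \<epsilon> N (Suc M)"
  have e: "0 < e" "e \<le> 1" "1 \<le> 1 / e"
    using \<epsilon> by (auto simp: e_def)
  have ln: "0 \<le> ln (real n)"
    using n by simp
  obtain S where S: "feasible n N S" and opt: "ufl_opt n d f N = ufl_cost n d f N S"
    by (rule ufl_opt_attained[OF n1(1)])
  have opt0: "0 \<le> ufl_opt n d f N"
    unfolding opt by (rule ufl_cost_nonneg[OF metric f S])
  have cost: "expected_cost n d f N (ufl_algorithm ufl_com n d f \<epsilon> N) =
      E L (\<lambda>s. ufl_cost n d f N (opened n N (partition_output n s)))"
    unfolding expected_cost_def ufl_algorithm_eq[OF n1(1)] L_def M_def by (rule E_map)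
  have sup: "well_formed n s" "diameter_le n d (e * f / 2 ^ M) s" if "s \<in> set_pmf L" for s
    using levels_support[OF metric n1(2) f \<epsilon> that[unfolded L_def]] by (auto simp: e_def)
  show ?thesis
  proof (cases "\<forall>v<n. N v = 0")
    case True
    \<comment> \<open>Without clients nothing is opened; the optimal set may be empty, so that
      \<open>cv\<close> need not exist.\<close>
    have "ufl_cost n d f N (opened n N (partition_output n s)) = 0" if "s \<in> set_pmf L" for s
      unfolding opened_partition_output[OF sup(1)[OF that]] using True by (simp add: ufl_cost_def groups_def)
    then have "expected_cost n d f N (ufl_algorithm ufl_com n d f \<epsilon> N) = E L (\<lambda>_. 0)"
      unfolding cost by (intro E_cong)
    then show ?thesis
      using opt0 ln e unfolding e_def by simp
  next
    case False
    then have S': "S \<subseteq> {..<n}" "S \<noteq> {}" "finite S"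
      using S finite_subset by (auto simp: feasible_def)
    then have card: "1 \<le> card S"
      by (simp add: Suc_le_eq card_gt_0_iff)
    have "\<exists>c. c \<in> S \<and> d v c = dist_set d v S" for v
    proof -
      have "dist_set d v S \<in> d v ` S"
        unfolding dist_set_def using S' by (intro Min_in) auto
      then show ?thesis by auto
    qed
    then obtain cv where cv: "\<And>v. cv v \<in> S" "\<And>v. d v (cv v) = dist_set d v S"
      by metis
    have cv': "\<And>v. v < n \<Longrightarrow> cv v < n \<and> cv v \<in> S"
      using cv(1) S'(1) by blast
    define conn where "conn = (\<Sum>v<n. real (N v) * dist_set d v S)"
    define F where "F = real (card S) * f"
    have FC: "0 \<le> F" "0 \<le> conn" "ufl_opt n d f N = F + conn" "f \<le> F"
      using f card by (auto simp: F_def conn_def opt ufl_cost_def cv(2)[symmetric] mult_le_cancel_right1 intro!: sum_nonneg)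
    have k: "1 \<le> real k"
      using num_bits(3)[of n] by (simp add: k_def)
    have "E L (\<lambda>s. ufl_cost n d f N (opened n N (partition_output n s))) \<le>
        E L (potential n d f N S cv k (e * f / 2 ^ M) (real k / e * 2 ^ M))"
    proof (rule E_mono)
      show "finite_pmf L"
        unfolding L_def by (rule finite_levels)
      fix s assume s: "s \<in> set_pmf L"
      show "ufl_cost n d f N (opened n N (partition_output n s)) \<le>
          potential n d f N S cv k (e * f / 2 ^ M) (real k / e * 2 ^ M) s"
        by (rule cost_le_potential[OF metric n1(2) sup[OF s] _ _ f])
           (use e f k depth[OF gap_pos, of \<epsilon> f n d] cv' in \<open>auto simp: M_def e_def\<close>)
    qed
    also have "\<dots> \<le> f * (2 * card S + 2 + 64 * real k * card S) +
        3 / e * (\<Sum>v<n. real (N v) * stretch n d v (cv v) (2 * (e * f)))"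
      unfolding L_def e_def k_def by (rule levels_potential[OF metric n1(2) S'(1) cv' f \<epsilon>])
    also have "(\<Sum>v<n. real (N v) * stretch n d v (cv v) (2 * (e * f))) \<le> (\<Sum>v<n. real (N v) * (12 * harm n * d v (cv v)))"
      using cv' by (intro sum_mono mult_left_mono stretch_bound[OF metric]) auto
    also have "(\<Sum>v<n. real (N v) * (12 * harm n * d v (cv v))) = 12 * harm n * conn"
      by (simp add: conn_def cv(2) sum_distrib_left mult_ac)
    also have "f * (2 * card S + 2 + 64 * real k * card S) = 2 * F + 2 * f + 64 * real k * F"
      by (simp add: F_def algebra_simps)
    finally have "E L (\<lambda>s. ufl_cost n d f N (opened n N (partition_output n s))) \<le>
        2 * F + 2 * f + 64 * real k * F + 3 / e * (12 * harm n * conn)"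
      using e by (simp add: mult_left_mono divide_right_mono)
    \<comment> \<open>\<open>68 = 2 + 2 + 64\<close> by \<open>f \<le> F\<close> and
      \<open>1 \<le> k\<close>, and \<open>36 = 3 * 12\<close>.\<close>
    also have "\<dots> \<le> 68 * real k * F * (1 / e) + 36 * harm n * conn * (1 / e)"
    proof -
      have "F \<le> real k * F"
        using k FC by (simp add: mult_le_cancel_right1)
      then have "2 * F + 2 * f + 64 * real k * F \<le> 68 * real k * F"
        using FC by linarith
      also have "68 * real k * F = 68 * real k * F * 1"
        by simp
      also have "\<dots> \<le> 68 * real k * F * (1 / e)"
        using FC k e by (intro mult_left_mono) auto
      finally show ?thesis
        by simp
    qed
    \<comment> \<open>600 dominates both \<open>68 * 15 / 2 = 510\<close> and
      \<open>36 * 5 / 2 = 90\<close>.\<close>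
    also have "\<dots> \<le> 600 * ln (real n) * (F + conn) * (1 / e)"
    proof -
      have "68 * real k * F \<le> 600 * ln (real n) * F"
        using log_factors(1)[OF n] ln FC unfolding k_def by (intro mult_right_mono) auto
      moreover have "36 * harm n * conn \<le> 600 * ln (real n) * conn"
        using log_factors(2)[OF n] ln FC by (intro mult_right_mono) auto
      ultimately have "(68 * real k * F + 36 * harm n * conn) * (1 / e) \<le> (600 * ln (real n) * (F + conn)) * (1 / e)"
        using e by (intro mult_right_mono) (auto simp: algebra_simps)
      then show ?thesis
        by (simp add: algebra_simps)
    qed
    also have "\<dots> = 600 * (ln (real n) / min 1 \<epsilon>) * ufl_opt n d f N"
      unfolding FC e_def by simp
    finally show ?thesis
      unfolding cost .
  qed
qed

text \<open>One program serves all instances. The minimum with 1 is there because a ratio cannot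
  fall below 1, whereas \<open>ln n / \<epsilon>\<close> tends to 0 for large
  \<open>\<epsilon>\<close>; \<open>n \<ge> 2\<close> is required because
  \<open>ln 1 = 0\<close>.\<close>

theorem theorem3:
  shows "\<exists>P. efficient P \<and>
    (\<exists>C::real. \<forall>n d f \<epsilon>. ufl_instance n d f \<and> 0 < \<epsilon> \<longrightarrow>
       differentially_private n \<epsilon> (ufl_algorithm P n d f \<epsilon>) \<and>
       (\<forall>N. \<forall>out \<in> set_pmf (ufl_algorithm P n d f \<epsilon> N). valid_output n out) \<and>
       (2 \<le> n \<longrightarrow> (\<forall>N.
          expected_cost n d f N (ufl_algorithm P n d f \<epsilon> N)
            \<le> C * (ln (real n) / min 1 \<epsilon>) * ufl_opt n d f N)))"
proof (rule exI[of _ ufl_com], intro conjI exI[of _ 600] allI impI ballI)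
  show "efficient ufl_com"
    by (rule efficient_ufl)
next
  fix n d f and \<epsilon> :: real
  assume inst: "ufl_instance n d f \<and> 0 < \<epsilon>"
  then have n: "1 \<le> n"
    by (simp add: ufl_instance_def)
  show "differentially_private n \<epsilon> (ufl_algorithm ufl_com n d f \<epsilon>)"
    by (rule private_ufl) (use inst n in auto)
  show "valid_output n out" if out: "out \<in> set_pmf (ufl_algorithm ufl_com n d f \<epsilon> N)" for N out
  proof -
    obtain s where s: "s \<in> set_pmf (levels_pmf n d f \<epsilon> N (Suc (depth n d f \<epsilon>)))" "out = partition_output n s"
      using out unfolding ufl_algorithm_eq[OF n] set_map_pmf by blast
    show ?thesis
      unfolding s(2) using inst n
      by (intro valid_partition_output levels_support(1)[OF _ _ _ _ s(1)]) (auto simp: ufl_instance_def)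
  qed
  show "expected_cost n d f N (ufl_algorithm ufl_com n d f \<epsilon> N)
      \<le> 600 * (ln (real n) / min 1 \<epsilon>) * ufl_opt n d f N" if "2 \<le> n" for N
    using inst that by (intro approximation_ufl) auto
qed

end
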